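(* In the setting described in the context (in particular (R1)--(R5), $\mathbf E=\nabla\Psi^{ext}$, $\mathbf f^*\in L^2(G)^n$), let $(\mathbf u^0,P^0,\{\Phi^0_j,\Phi_j^1\}_{1\le j\le N})$ be the unique solution of the two-scale homogenized problem (H), write $p^0=P^0$, and set $$\mathbf u(x)=\mathbb E\{\mathbf u^0\},\quad\mu_j(x)=-z_j(\Phi_j^0(x)+\Psi^{ext}(x)),\quad\mathbf j_j(x)=\frac{z_j}{\mathrm{Pe}_j}\mathbb E\Big\{n_j^0\Big(\nabla_x\Phi_j^0+\mathbf E+\Phi_j^1+\frac{\mathrm{Pe}_j}{z_j}\mathbf u^0\Big)\Big\}.$$ Introduce the flux $\mathcal J(x)=(\mathbf u,\{\mathbf j_j\}_{1\le j\le N})$ and the gradient $\mathcal G(x)=(\nabla_xp^0,\{\nabla_x\mu_j\}_{1\le j\le N})$. Then the macroscopic equations are $$\mathrm{div}_x\mathcal J=0\ \text{ in }G,\qquad\mathcal J=-\mathcal B\,\mathcal G-\mathcal B(\mathbf f^*,\{0\}),$$ with a symmetric positive definite $\mathcal B$ defined by $$\mathcal B=\begin{pmatrix}\mathbb K&\frac{\mathbb J_1}{z_1}&\cdots&\frac{\mathbb J_N}{z_N}\\ \mathbb L_1&\frac{\mathbb D_{11}}{z_1}&\cdots&\frac{\mathbb D_{1N}}{z_N}\\ \vdots&\vdots&\ddots&\vdots\\ \mathbb L_N&\frac{\mathbb D_{N1}}{z_1}&\cdots&\frac{\mathbb D_{NN}}{z_N}\end{pmatrix}$$ and complemented with the boundary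 conditions for $p^0$ and $\{\Phi_j^0\}_{1\le j\le N}$ (that is, $\mathbf u\cdot\nu=0$ and $\Phi_j^0=0$ on $\partial G$). The matrices $\mathbb J_i,\mathbb K,\mathbb D_{ji},\mathbb L_j$ are defined by their entries $$\{\mathbb J_i\}_{lk}=\mathbb E\{\mathbf v^{i,k}\cdot\mathbf e^l\},\quad\{\mathbb K\}_{lk}=\mathbb E\{\mathbf v^{0,k}\cdot\mathbf e^l\},$$ $$\{\mathbb D_{ji}\}_{lk}=\mathbb E\Big\{n_j^0\Big(\mathbf v^{i,k}+\frac{z_j}{\mathrm{Pe}_j}(\delta_{ij}\mathbf e^k+\Theta_j^{i,k})\Big)\cdot\mathbf e^l\Big\},\quad\{\mathbb L_j\}_{lk}=\mathbb E\Big\{n_j^0\Big(\mathbf v^{0,k}+\frac{z_j}{\mathrm{Pe}_j}\Theta_j^{0,k}\Big)\cdot\mathbf e^l\Big\},$$ with $\mathbf v^{i,k},\Theta_j^{i,k}$ ($0\le i\le N$, $1\le j\le N$, $1\le k\le n$) the solutions of the problems (C0), (Ci) of the context.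
   Context: Random geometry. $(\Omega,\Xi,\mu)$ is a probability space with $L^2(\Omega)$ separable, $\mathbb E$ is expectation. $\mathcal T(x):\Omega\to\Omega$, $x\in\mathbb R^n$, is an ergodic $n$-dimensional dynamical system: invertible measurable maps with $\mathcal T(0)=\mathrm{Id}$, $\mathcal T(x_1+x_2)=\mathcal T(x_1)\mathcal T(x_2)$, $\mu(\mathcal T(x)^{-1}E)=\mu(E)$ for $E\in\Xi$, $\{(x,\omega):\mathcal T(x)\omega\in E\}$ is measurable for the product of the Lebesgue $\sigma$-algebra and $\Xi$, and every $E\in\Xi$ with $\mu(\mathcal T(x)E\,\triangle\,E)=0$ for all $x$ has $\mu(E)\in\{0,1\}$. $\mathcal F\in\Xi$ with $0<\mu(\mathcal F)<1$, $\mathcal M=\Omega\setminus\mathcal F$; $F(\omega)=\{x\in\mathbb R^n:\mathcal T(x)\omega\in\mathcal F\}$ is a.s. open and connected; $M(\omega)=\mathbb R^n\setminus F(\omega)$. Almost surely: (R1) $M(\omega)=\bigcup_{j\ge1}M_j(\omega)$ is a union of non-intersecting $C^2$-smooth bounded domains; (R2) the curvature of the boundary of these domains admits a deterministic upper bound; (R3) the distance between any two of these domains is greater than a positive deterministic constant; (R4) the diameter of any of them is not greater than a positive deterministic constant; (R5) there is $r_0>0$ such that any ball of radius $r_0$ in $\mathbb R^n$ has a nontrivial intersection with $M(\omega)$. $G\subset\mathbb R^n$ is a smooth bounded domain; $L^2_0(G)$: zero-mean functions in $L^2(G)$; $\mathbf e^1,\dots,\mathbf e^n$ is the canonical basis of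 $\mathbb R^n$. Stochastic calculus. $D_j$ is the infinitesimal generator in $L^2(\Omega)$ of the unitary group $f\mapsto f(\mathcal T(te_j)\,\cdot)$; $\mathcal D(\Omega)$ is the intersection of the domains of $D_1,\dots,D_n$ with the graph norm; $\nabla_\omega f=(D_jf)_j$, $\mathrm{div}_\omega g=\sum_jD_jg_j$. $\mathcal V^2_{pot}(\Omega)$: fields $f\in L^2(\Omega)^n$ with zero mean such that almost every realization $x\mapsto f(\mathcal T(x)\omega)$ is potential in $\mathbb R^n$. $X$: closure of $\mathcal V^2_{pot}(\Omega)$ in $L^2(\Omega\setminus\mathcal M)^n$. $\mathcal W=\{\mathbf z\in\mathcal D(\Omega)^n:\mathrm{div}_\omega\mathbf z=0\text{ in }\mathcal F,\ \mathbf z=0\text{ on }\mathcal M\}$. $V=\{\mathbf z\in L^2(G;\mathcal D(\Omega)^n):\mathbf z(x,\cdot)\in\mathcal W\text{ for a.e. }x,\ \mathrm{div}_x\mathbb E(\mathbf z)=0\text{ in }G,\ \mathbb E(\mathbf z)\cdot\nu=0\text{ on }\partial G\}$. Coefficients. $N\in\mathbb N$; $\beta,N_\sigma,\mathrm{Pe}_j>0$; valences $z_j\in\mathbb Z$, $z_1<\dots<z_N$, $z_1<0<z_N$; $n_j^c\in(0,1)$ with $\sum_jz_jn_j^c=0$. The surface charge density $\sigma$ is a.s. bounded on $\partial F(\omega)$ by a deterministic constant. $\Psi^0\in\mathcal D(\Omega)\cap L^\infty(\Omega)$ is the unique statistically homogeneous solution of the Poisson--Boltzmann problem: a.s. $\psi(y)=\Psi^0(\mathcal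 T(y)\omega)$ satisfies (weakly) $-\Delta\psi=\beta\sum_jz_jn_j^ce^{-z_j\psi}$ in $F(\omega)$, $\nabla\psi\cdot\nu=-N_\sigma\sigma(\mathcal T(y)\omega)$ on $\partial F(\omega)$. $n_j^0=n_j^c\exp\{-z_j\Psi^0\}$ on $\mathcal F$, taken as zero on $\mathcal M$ in expectations. Problem (H): $(\mathbf u^0,P^0,\{\Phi_j^0,\Phi_j^1\})\in V\times L^2_0(G)\times(H^1_0(G)\times L^2(G;X))^N$ satisfies, for all $\xi\in C_0^\infty(G;\mathcal W)$, $\varphi_j\in C_0^\infty(G)$, $g_j\in L^2(G;X)$ (integrals over $G\times\mathcal F$ with respect to $dx\,d\mu$), $$\int\nabla_\omega\mathbf u^0:\nabla_\omega\xi-\int P^0\mathrm{div}_x\xi+\sum_j\int z_jn_j^0\big(-\xi\cdot(\nabla_x\Phi_j^0+\Phi_j^1)+\mathbf u^0\cdot(\nabla_x\varphi_j+g_j)\big)+\sum_j\frac{z_j^2}{\mathrm{Pe}_j}\int n_j^0(\nabla_x\Phi_j^0+\Phi_j^1)\cdot(\nabla_x\varphi_j+g_j)$$ $$=-\sum_j\frac{z_j^2}{\mathrm{Pe}_j}\int n_j^0\mathbf E\cdot(\nabla_x\varphi_j+g_j)+\sum_j\int z_jn_j^0\mathbf E\cdot\xi-\int\mathbf f^*\cdot\xi .$$ It is uniquely solvable. Random geometry problems (each uniquely solvable). For $(\mathbf v,\{\Theta_j\}),(\xi,\{\zeta_j\})\in\mathcal W\times X^N$ let $$b\big((\mathbf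 v,\Theta),(\xi,\zeta)\big)=\int_{\mathcal F}\nabla_\omega\mathbf v:\nabla_\omega\xi\,d\mu-\sum_{j=1}^N\int_{\mathcal F}z_jn_j^0\,\Theta_j\cdot\Big(\xi-\frac{z_j}{\mathrm{Pe}_j}\zeta_j\Big)d\mu+\sum_{j=1}^Nz_j\int_{\mathcal F}n_j^0\,\mathbf v\cdot\zeta_j\,d\mu .$$ (C0) $(\mathbf v^{0,k},\{\Theta_j^{0,k}\}_j)\in\mathcal W\times X^N$ satisfies $b((\mathbf v^{0,k},\Theta^{0,k}),(\xi,\zeta))=\int_{\mathcal F}\mathbf e^k\cdot\xi\,d\mu$ for all $(\xi,\zeta)\in\mathcal W\times X^N$. (Ci) For $i=1,\dots,N$, $(\mathbf v^{i,k},\{\Theta_j^{i,k}\}_j)\in\mathcal W\times X^N$ satisfies $b((\mathbf v^{i,k},\Theta^{i,k}),(\xi,\zeta))=z_i\int_{\mathcal F}n_i^0\,\mathbf e^k\cdot\big(\xi-\frac{z_i}{\mathrm{Pe}_i}\zeta_i\big)d\mu$ for all $(\xi,\zeta)\in\mathcal W\times X^N$. *)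

theory Defs
  imports "HOL-Probability.Probability"
begin

section \<open>Function spaces on Euclidean domains\<close>

text \<open>
  Infinite differentiability on an open set, as existence and continuity of the iterated
  partial derivatives of all orders; \<open>D \<alpha>\<close> is the derivative along the word \<open>\<alpha>\<close>.
\<close>

definition smooth_fun :: "(real^'n) set \<Rightarrow> (real^'n \<Rightarrow> real) \<Rightarrow> bool" where
  "smooth_fun U f \<longleftrightarrow>
     (\<exists>D :: 'n list \<Rightarrow> real^'n \<Rightarrow> real.
        (\<forall>x\<in>U. D [] x = f x) \<and>
        (\<forall>\<alpha>. continuous_on U (D \<alpha>) \<and>
          (\<forall>i. \<forall>x\<in>U. ((\<lambda>t. D \<alpha> (x + t *\<^sub>R axis i 1)) has_real_derivative D (i # \<alpha>) x) (at 0))))"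

definition test_fun :: "(real^'n) set \<Rightarrow> (real^'n \<Rightarrow> real) set" where
  "test_fun G = {\<phi>. smooth_fun UNIV \<phi> \<and> (\<exists>K. compact K \<and> K \<subseteq> G \<and> (\<forall>x. x \<notin> K \<longrightarrow> \<phi> x = 0))}"

definition grad :: "(real^'n \<Rightarrow> real) \<Rightarrow> real^'n \<Rightarrow> real^'n" where
  "grad f x = (\<chi> i. frechet_derivative f (at x) (axis i 1))"

definition L2 :: "'a measure \<Rightarrow> ('a \<Rightarrow> 'b::euclidean_space) set" where
  "L2 M = {f \<in> borel_measurable M. integrable M (\<lambda>x. (norm (f x))\<^sup>2)}"

definition L2_zero_mean :: "(real^'n) set \<Rightarrow> (real^'n \<Rightarrow> real) set" where
  "L2_zero_mean G = {f \<in> L2 (lebesgue_on G). (LINT x|lebesgue_on G. f x) = 0}"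

definition locally_integrable :: "(real^'n) set \<Rightarrow> (real^'n \<Rightarrow> 'b::euclidean_space) \<Rightarrow> bool" where
  "locally_integrable U f \<longleftrightarrow> (\<forall>K. compact K \<and> K \<subseteq> U \<longrightarrow> f absolutely_integrable_on K)"

definition has_weak_grad ::
  "(real^'n) set \<Rightarrow> (real^'n \<Rightarrow> real) \<Rightarrow> (real^'n \<Rightarrow> real^'n) \<Rightarrow> bool" where
  "has_weak_grad U f g \<longleftrightarrow> locally_integrable U f \<and> locally_integrable U g \<and>
     (\<forall>\<phi>\<in>test_fun U. \<forall>i.
        (LINT x|lebesgue_on U. f x * grad \<phi> x $ i) = - (LINT x|lebesgue_on U. g x $ i * \<phi> x))"

text \<open>A representative of the weak gradient, which is unique up to null sets.\<close>

definition wgrad :: "(real^'n) set \<Rightarrow> (real^'n \<Rightarrow> real) \<Rightarrow> real^'n \<Rightarrow> real^'n" where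
  "wgrad U f = (SOME g. has_weak_grad U f g)"

definition H1 :: "(real^'n) set \<Rightarrow> (real^'n \<Rightarrow> real) set" where
  "H1 U = {f \<in> L2 (lebesgue_on U). \<exists>g \<in> L2 (lebesgue_on U). has_weak_grad U f g}"

definition H1_0 :: "(real^'n) set \<Rightarrow> (real^'n \<Rightarrow> real) set" where
  "H1_0 U = {f \<in> H1 U. \<exists>\<phi> :: nat \<Rightarrow> real^'n \<Rightarrow> real. (\<forall>m. \<phi> m \<in> test_fun U) \<and>
     (\<lambda>m. LINT x|lebesgue_on U. (\<phi> m x - f x)\<^sup>2 + (norm (grad (\<phi> m) x - wgrad U f x))\<^sup>2)
       \<longlonglongrightarrow> 0}"

definition has_weak_div ::
  "(real^'n) set \<Rightarrow> (real^'n \<Rightarrow> real^'n) \<Rightarrow> (real^'n \<Rightarrow> real) \<Rightarrow> bool" where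
  "has_weak_div U w d \<longleftrightarrow> w \<in> L2 (lebesgue_on U) \<and> d \<in> L2 (lebesgue_on U) \<and>
     (\<forall>\<phi>\<in>test_fun U.
        (LINT x|lebesgue_on U. w x \<bullet> grad \<phi> x) = - (LINT x|lebesgue_on U. d x * \<phi> x))"

text \<open>
  The normal trace of a square integrable field \<open>w\<close> with weak divergence \<open>d\<close> is the functional
  given by Green's formula; here the test functions need not vanish on the boundary.
\<close>

definition zero_normal_trace ::
  "(real^'n) set \<Rightarrow> (real^'n \<Rightarrow> real^'n) \<Rightarrow> (real^'n \<Rightarrow> real) \<Rightarrow> bool" where
  "zero_normal_trace U w d \<longleftrightarrow> has_weak_div U w d \<and>
     (\<forall>\<phi>\<in>test_fun UNIV.
        (LINT x|lebesgue_on U. w x \<bullet> grad \<phi> x) + (LINT x|lebesgue_on U. d x * \<phi> x) = 0)"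


section \<open>Regular domains, curvature and surface measure\<close>

definition local_defining :: "(real^'n) set \<Rightarrow> (real^'n) set \<Rightarrow> (real^'n \<Rightarrow> real) \<Rightarrow> bool" where
  "local_defining D U \<rho> \<longleftrightarrow> open U \<and> (\<forall>x\<in>U. grad \<rho> x \<noteq> 0) \<and>
     D \<inter> U = {x \<in> U. \<rho> x < 0} \<and> frontier D \<inter> U = {x \<in> U. \<rho> x = 0}"

definition hessian :: "(real^'n \<Rightarrow> real) \<Rightarrow> real^'n \<Rightarrow> real^'n^'n" where
  "hessian f x = matrix (frechet_derivative (grad f) (at x))"

definition C2_on :: "(real^'n) set \<Rightarrow> (real^'n \<Rightarrow> real) \<Rightarrow> bool" where
  "C2_on U f \<longleftrightarrow> (\<forall>x\<in>U. f differentiable (at x) \<and> grad f differentiable (at x)) \<and>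
     continuous_on U (hessian f)"

definition smooth_bounded_domain :: "(real^'n) set \<Rightarrow> bool" where
  "smooth_bounded_domain D \<longleftrightarrow> D \<noteq> {} \<and> open D \<and> connected D \<and> bounded D \<and>
     (\<forall>p\<in>frontier D. \<exists>U \<rho>. p \<in> U \<and> smooth_fun U \<rho> \<and> local_defining D U \<rho>)"

definition C2_bounded_domain :: "(real^'n) set \<Rightarrow> bool" where
  "C2_bounded_domain D \<longleftrightarrow> D \<noteq> {} \<and> open D \<and> connected D \<and> bounded D \<and>
     (\<forall>p\<in>frontier D. \<exists>U \<rho>. p \<in> U \<and> C2_on U \<rho> \<and> local_defining D U \<rho>)"

text \<open>
  Normal curvature at \<open>p\<close> of the level set of \<open>\<rho>\<close> in the tangential direction \<open>\<tau>\<close>: the second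
  fundamental form with respect to the unit normal \<open>grad \<rho> / |grad \<rho>|\<close>.  Its extreme values over
  \<open>\<tau>\<close> are the extreme principal curvatures, and it does not depend on the defining function.
\<close>

definition normal_curvature :: "(real^'n \<Rightarrow> real) \<Rightarrow> real^'n \<Rightarrow> real^'n \<Rightarrow> real" where
  "normal_curvature \<rho> p \<tau> = (\<tau> \<bullet> (hessian \<rho> p *v \<tau>)) / (norm (grad \<rho> p) * (norm \<tau>)\<^sup>2)"

definition boundary_curvature_le :: "(real^'n) set \<Rightarrow> real \<Rightarrow> bool" where
  "boundary_curvature_le D \<kappa> \<longleftrightarrow>
     (\<forall>U \<rho> p \<tau>. C2_on U \<rho> \<and> local_defining D U \<rho> \<and> p \<in> frontier D \<inter> U \<and>
        \<tau> \<noteq> 0 \<and> \<tau> \<bullet> grad \<rho> p = 0 \<longrightarrow> \<bar>normal_curvature \<rho> p \<tau>\<bar> \<le> \<kappa>)"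

text \<open>
  The \<open>d\<close>-dimensional Hausdorff measure, normalised to agree with surface area on smooth
  \<open>d\<close>-dimensional surfaces.
\<close>

definition hausdorff_content :: "nat \<Rightarrow> real \<Rightarrow> (real^'n) set \<Rightarrow> ennreal" where
  "hausdorff_content d \<delta> A =
     (INF U\<in>{U :: nat \<Rightarrow> (real^'n) set. A \<subseteq> (\<Union>i. U i) \<and>
               (\<forall>i. bounded (U i) \<and> diameter (U i) \<le> \<delta>)}.
        \<Sum>i. if U i = {} then 0
             else ennreal (unit_ball_vol (real d) * (diameter (U i) / 2) ^ d))"

definition hausdorff_outer :: "nat \<Rightarrow> (real^'n) set \<Rightarrow> ennreal" where
  "hausdorff_outer d A = (SUP \<delta>\<in>{0<..}. hausdorff_content d \<delta> A)"

definition surface_measure :: "(real^'n) set \<Rightarrow> (real^'n) measure" where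
  "surface_measure S =
     completion (restrict_space
       (measure_of UNIV (sets borel) (hausdorff_outer (CARD('n) - 1))) S)"


section \<open>Random geometry\<close>

definition separable_L2 :: "'w measure \<Rightarrow> bool" where
  "separable_L2 M \<longleftrightarrow>
     (\<exists>S :: ('w \<Rightarrow> real) set. countable S \<and> S \<subseteq> L2 M \<and>
        (\<forall>f\<in>L2 M. \<forall>\<epsilon>>0. \<exists>g\<in>S. (LINT \<omega>|M. (f \<omega> - g \<omega>)\<^sup>2) < \<epsilon>))"

definition ergodic_system :: "'w measure \<Rightarrow> (real^'n \<Rightarrow> 'w \<Rightarrow> 'w) \<Rightarrow> bool" where
  "ergodic_system M T \<longleftrightarrow>
     (\<forall>x. T x \<in> measurable M M \<and> bij_betw (T x) (space M) (space M)) \<and>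
     (\<forall>\<omega>\<in>space M. T 0 \<omega> = \<omega>) \<and>
     (\<forall>x y. \<forall>\<omega>\<in>space M. T (x + y) \<omega> = T x (T y \<omega>)) \<and>
     (\<forall>x. \<forall>E\<in>sets M. emeasure M (T x -` E \<inter> space M) = emeasure M E) \<and>
     (\<forall>E\<in>sets M. {(x, \<omega>). \<omega> \<in> space M \<and> T x \<omega> \<in> E} \<in> sets (lebesgue \<Otimes>\<^sub>M M)) \<and>
     (\<forall>E\<in>sets M. (\<forall>x. emeasure M ((T x ` E - E) \<union> (E - T x ` E)) = 0) \<longrightarrow>
        measure M E \<in> {0, 1})"

definition fluid_region :: "(real^'n \<Rightarrow> 'w \<Rightarrow> 'w) \<Rightarrow> 'w set \<Rightarrow> 'w \<Rightarrow> (real^'n) set" where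
  "fluid_region T F \<omega> = {x. T x \<omega> \<in> F}"

text \<open>
  The fluid region is open, so the solid inclusions are closed: they are the closures of the \<open>C2\<close>
  domains \<open>D j\<close>.  The bounds \<open>\<kappa>\<close> (curvature), \<open>\<delta>\<close> (separation), \<open>d\<close> (diameter) and \<open>r\<^sub>0\<close> (relative
  density) do not depend on the realization.
\<close>

definition random_inclusions :: "'w measure \<Rightarrow> (real^'n \<Rightarrow> 'w \<Rightarrow> 'w) \<Rightarrow> 'w set \<Rightarrow> bool" where
  "random_inclusions M T F \<longleftrightarrow>
     F \<in> sets M \<and> 0 < measure M F \<and> measure M F < 1 \<and>
     (\<exists>\<kappa> \<delta> d r\<^sub>0. 0 < \<delta> \<and> 0 < d \<and> 0 < r\<^sub>0 \<and>
       (AE \<omega> in M.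
          open (fluid_region T F \<omega>) \<and> connected (fluid_region T F \<omega>) \<and>
          (\<exists>D :: nat \<Rightarrow> (real^'n) set.
             UNIV - fluid_region T F \<omega> = (\<Union>j. closure (D j)) \<and>
             (\<forall>j. C2_bounded_domain (D j)) \<and>
             (\<forall>i j. i \<noteq> j \<longrightarrow> closure (D i) \<inter> closure (D j) = {}) \<and>
             (\<forall>j. boundary_curvature_le (D j) \<kappa>) \<and>
             (\<forall>i j. i \<noteq> j \<longrightarrow> \<delta> < setdist (closure (D i)) (closure (D j))) \<and>
             (\<forall>j. diameter (closure (D j)) \<le> d)) \<and>
          (\<forall>c. ball c r\<^sub>0 \<inter> (UNIV - fluid_region T F \<omega>) \<noteq> {})))"


section \<open>Stochastic calculus\<close>

definition is_generator ::
  "'w measure \<Rightarrow> (real^'n \<Rightarrow> 'w \<Rightarrow> 'w) \<Rightarrow> 'n \<Rightarrow> ('w \<Rightarrow> real) \<Rightarrow> ('w \<Rightarrow> real) \<Rightarrow> bool" where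
  "is_generator M T j f g \<longleftrightarrow> f \<in> L2 M \<and> g \<in> L2 M \<and>
     ((\<lambda>t. LINT \<omega>|M. ((f (T (t *\<^sub>R axis j 1) \<omega>) - f \<omega>) / t - g \<omega>)\<^sup>2) \<longlongrightarrow> 0) (at 0)"

text \<open>A representative of \<open>D_j f\<close>, which is unique up to null sets.\<close>

definition gen ::
  "'w measure \<Rightarrow> (real^'n \<Rightarrow> 'w \<Rightarrow> 'w) \<Rightarrow> 'n \<Rightarrow> ('w \<Rightarrow> real) \<Rightarrow> 'w \<Rightarrow> real" where
  "gen M T j f = (SOME g. is_generator M T j f g)"

definition stoch_D :: "'w measure \<Rightarrow> (real^'n \<Rightarrow> 'w \<Rightarrow> 'w) \<Rightarrow> ('w \<Rightarrow> real) set" where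
  "stoch_D M T = {f \<in> L2 M. \<forall>j. \<exists>g. is_generator M T j f g}"

definition stoch_D_vec :: "'w measure \<Rightarrow> (real^'n \<Rightarrow> 'w \<Rightarrow> 'w) \<Rightarrow> ('w \<Rightarrow> real^'n) set" where
  "stoch_D_vec M T = {z. \<forall>i. (\<lambda>\<omega>. z \<omega> $ i) \<in> stoch_D M T}"

definition stoch_jac ::
  "'w measure \<Rightarrow> (real^'n \<Rightarrow> 'w \<Rightarrow> 'w) \<Rightarrow> ('w \<Rightarrow> real^'n) \<Rightarrow> 'w \<Rightarrow> real^'n^'n" where
  "stoch_jac M T z \<omega> = (\<chi> i j. gen M T j (\<lambda>\<omega>. z \<omega> $ i) \<omega>)"

definition stoch_div ::
  "'w measure \<Rightarrow> (real^'n \<Rightarrow> 'w \<Rightarrow> 'w) \<Rightarrow> ('w \<Rightarrow> real^'n) \<Rightarrow> 'w \<Rightarrow> real" where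
  "stoch_div M T z \<omega> = (\<Sum>j\<in>UNIV. gen M T j (\<lambda>\<omega>. z \<omega> $ j) \<omega>)"

text \<open>Square of the graph norm on vector fields.\<close>

definition graph_norm_sq ::
  "'w measure \<Rightarrow> (real^'n \<Rightarrow> 'w \<Rightarrow> 'w) \<Rightarrow> ('w \<Rightarrow> real^'n) \<Rightarrow> real" where
  "graph_norm_sq M T z =
     (LINT \<omega>|M. (norm (z \<omega>))\<^sup>2) + (LINT \<omega>|M. (norm (stoch_jac M T z \<omega>))\<^sup>2)"

definition potential_field :: "(real^'n \<Rightarrow> real^'n) \<Rightarrow> bool" where
  "potential_field g \<longleftrightarrow> (\<exists>\<phi>. has_weak_grad UNIV \<phi> g)"

definition V_pot :: "'w measure \<Rightarrow> (real^'n \<Rightarrow> 'w \<Rightarrow> 'w) \<Rightarrow> ('w \<Rightarrow> real^'n) set" where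
  "V_pot M T = {f \<in> L2 M. (LINT \<omega>|M. f \<omega>) = 0 \<and>
     (AE \<omega> in M. potential_field (\<lambda>x. f (T x \<omega>)))}"

text \<open>Only the restriction to \<open>F\<close> of an element of \<open>X_space M T F\<close> is relevant.\<close>

definition X_space :: "'w measure \<Rightarrow> (real^'n \<Rightarrow> 'w \<Rightarrow> 'w) \<Rightarrow> 'w set \<Rightarrow> ('w \<Rightarrow> real^'n) set" where
  "X_space M T F = {\<theta> \<in> L2 (restrict_space M F).
     \<forall>\<epsilon>>0. \<exists>f\<in>V_pot M T. (LINT \<omega>|restrict_space M F. (norm (\<theta> \<omega> - f \<omega>))\<^sup>2) < \<epsilon>}"

definition W_space :: "'w measure \<Rightarrow> (real^'n \<Rightarrow> 'w \<Rightarrow> 'w) \<Rightarrow> 'w set \<Rightarrow> ('w \<Rightarrow> real^'n) set" where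
  "W_space M T F = {z \<in> stoch_D_vec M T.
     (AE \<omega> in M. \<omega> \<in> F \<longrightarrow> stoch_div M T z \<omega> = 0) \<and>
     (AE \<omega> in M. \<omega> \<in> space M - F \<longrightarrow> z \<omega> = 0)}"

definition L2_X ::
  "'w measure \<Rightarrow> (real^'n \<Rightarrow> 'w \<Rightarrow> 'w) \<Rightarrow> 'w set \<Rightarrow> (real^'n) set
    \<Rightarrow> (real^'n \<Rightarrow> 'w \<Rightarrow> real^'n) set" where
  "L2_X M T F G = {\<theta>. (\<lambda>(x, \<omega>). \<theta> x \<omega>) \<in> L2 (lebesgue_on G \<Otimes>\<^sub>M restrict_space M F) \<and>
     (AE x in lebesgue_on G. \<theta> x \<in> X_space M T F)}"

definition L2_stoch_D ::
  "'w measure \<Rightarrow> (real^'n \<Rightarrow> 'w \<Rightarrow> 'w) \<Rightarrow> (real^'n) set \<Rightarrow> (real^'n \<Rightarrow> 'w \<Rightarrow> real^'n) set" where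
  "L2_stoch_D M T G = {z. (\<lambda>(x, \<omega>). z x \<omega>) \<in> L2 (lebesgue_on G \<Otimes>\<^sub>M M) \<and>
     (AE x in lebesgue_on G. z x \<in> stoch_D_vec M T) \<and>
     integrable (lebesgue_on G) (\<lambda>x. graph_norm_sq M T (z x))}"

definition V_space ::
  "'w measure \<Rightarrow> (real^'n \<Rightarrow> 'w \<Rightarrow> 'w) \<Rightarrow> 'w set \<Rightarrow> (real^'n) set
    \<Rightarrow> (real^'n \<Rightarrow> 'w \<Rightarrow> real^'n) set" where
  "V_space M T F G = {z \<in> L2_stoch_D M T G.
     (AE x in lebesgue_on G. z x \<in> W_space M T F) \<and>
     has_weak_div G (\<lambda>x. LINT \<omega>|M. z x \<omega>) (\<lambda>x. 0) \<and>
     zero_normal_trace G (\<lambda>x. LINT \<omega>|M. z x \<omega>) (\<lambda>x. 0)}"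

text \<open>
  Smooth compactly supported maps from \<open>G\<close> to \<open>W_space M T F\<close>, extended by zero;
  differentiability and continuity are with respect to the graph norm.
\<close>

definition test_W ::
  "'w measure \<Rightarrow> (real^'n \<Rightarrow> 'w \<Rightarrow> 'w) \<Rightarrow> 'w set \<Rightarrow> (real^'n) set
    \<Rightarrow> (real^'n \<Rightarrow> 'w \<Rightarrow> real^'n) set" where
  "test_W M T F G = {\<xi>.
     (\<exists>D :: 'n list \<Rightarrow> real^'n \<Rightarrow> 'w \<Rightarrow> real^'n. D [] = \<xi> \<and>
        (\<forall>\<alpha> x. D \<alpha> x \<in> W_space M T F) \<and>
        (\<forall>\<alpha> x. ((\<lambda>y. graph_norm_sq M T (\<lambda>\<omega>. D \<alpha> y \<omega> - D \<alpha> x \<omega>)) \<longlongrightarrow> 0) (at x)) \<and>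
        (\<forall>\<alpha> i x. ((\<lambda>t. graph_norm_sq M T
            (\<lambda>\<omega>. (D \<alpha> (x + t *\<^sub>R axis i 1) \<omega> - D \<alpha> x \<omega>) /\<^sub>R t - D (i # \<alpha>) x \<omega>)) \<longlongrightarrow> 0) (at 0))) \<and>
     (\<exists>K. compact K \<and> K \<subseteq> G \<and> (\<forall>x. x \<notin> K \<longrightarrow> (AE \<omega> in M. \<xi> x \<omega> = 0)))}"

text \<open>Partial derivatives in \<open>x\<close> of a map with values in \<open>L2 M\<close>, unique up to null sets.\<close>

definition pderiv_x ::
  "'w measure \<Rightarrow> 'n \<Rightarrow> (real^'n \<Rightarrow> 'w \<Rightarrow> real^'n) \<Rightarrow> real^'n \<Rightarrow> 'w \<Rightarrow> real^'n" where
  "pderiv_x M i \<xi> x = (SOME \<eta>. \<eta> \<in> L2 M \<and>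
     ((\<lambda>t. LINT \<omega>|M. (norm ((\<xi> (x + t *\<^sub>R axis i 1) \<omega> - \<xi> x \<omega>) /\<^sub>R t - \<eta> \<omega>))\<^sup>2) \<longlongrightarrow> 0) (at 0))"

definition div_x :: "'w measure \<Rightarrow> (real^'n \<Rightarrow> 'w \<Rightarrow> real^'n) \<Rightarrow> real^'n \<Rightarrow> 'w \<Rightarrow> real" where
  "div_x M \<xi> x \<omega> = (\<Sum>i\<in>UNIV. pderiv_x M i \<xi> x \<omega> $ i)"


section \<open>Coefficients\<close>

definition surface_charge ::
  "'w measure \<Rightarrow> (real^'n \<Rightarrow> 'w \<Rightarrow> 'w) \<Rightarrow> 'w set \<Rightarrow> ('w \<Rightarrow> real) \<Rightarrow> bool" where
  "surface_charge M T F \<sigma> \<longleftrightarrow>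
     (\<exists>C. AE \<omega> in M.
        (\<lambda>y. \<sigma> (T y \<omega>)) \<in> borel_measurable (surface_measure (frontier (fluid_region T F \<omega>))) \<and>
        (\<forall>y\<in>frontier (fluid_region T F \<omega>). \<bar>\<sigma> (T y \<omega>)\<bar> \<le> C))"

text \<open>
  Weak form of \<open>- \<Delta> \<psi> = \<beta> \<Sum>j. z j * nc j * exp (- z j * \<psi>)\<close> in the open set \<open>U\<close> with
  \<open>\<nabla>\<psi> \<cdot> \<nu> = - s\<close> on its boundary, \<open>\<nu>\<close> being the exterior normal of \<open>U\<close>.
\<close>

definition poisson_boltzmann ::
  "(real^'n) set \<Rightarrow> real \<Rightarrow> ('s::finite \<Rightarrow> int) \<Rightarrow> ('s \<Rightarrow> real) \<Rightarrow> (real^'n \<Rightarrow> real)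
    \<Rightarrow> (real^'n \<Rightarrow> real) \<Rightarrow> bool" where
  "poisson_boltzmann U \<beta> z nc s \<psi> \<longleftrightarrow> (\<exists>g. has_weak_grad U \<psi> g) \<and>
     (\<forall>\<phi>\<in>test_fun UNIV.
        (LINT y|lebesgue_on U. wgrad U \<psi> y \<bullet> grad \<phi> y)
          + (LINT y|surface_measure (frontier U). s y * \<phi> y)
        = (LINT y|lebesgue_on U.
             \<beta> * (\<Sum>j\<in>UNIV. of_int (z j) * nc j * exp (- of_int (z j) * \<psi> y)) * \<phi> y))"

definition equilibrium_potential ::
  "'w measure \<Rightarrow> (real^'n \<Rightarrow> 'w \<Rightarrow> 'w) \<Rightarrow> 'w set \<Rightarrow> real \<Rightarrow> ('s::finite \<Rightarrow> int) \<Rightarrow> ('s \<Rightarrow> real)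
    \<Rightarrow> real \<Rightarrow> ('w \<Rightarrow> real) \<Rightarrow> ('w \<Rightarrow> real) \<Rightarrow> bool" where
  "equilibrium_potential M T F \<beta> z nc N\<^sub>\<sigma> \<sigma> \<Psi> \<longleftrightarrow>
     \<Psi> \<in> stoch_D M T \<and> (\<exists>C. AE \<omega> in M. \<bar>\<Psi> \<omega>\<bar> \<le> C) \<and>
     (AE \<omega> in M. poisson_boltzmann (fluid_region T F \<omega>) \<beta> z nc
        (\<lambda>y. N\<^sub>\<sigma> * \<sigma> (T y \<omega>)) (\<lambda>y. \<Psi> (T y \<omega>)))"

definition n0 ::
  "'w set \<Rightarrow> ('s \<Rightarrow> int) \<Rightarrow> ('s \<Rightarrow> real) \<Rightarrow> ('w \<Rightarrow> real) \<Rightarrow> 's \<Rightarrow> 'w \<Rightarrow> real" where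
  "n0 F z nc \<Psi> j \<omega> = (if \<omega> \<in> F then nc j * exp (- of_int (z j) * \<Psi> \<omega>) else 0)"


section \<open>The two-scale homogenized problem\<close>

text \<open>
  Integral over \<open>G \<times> F\<close>, in iterated form: the chosen representatives of \<open>D_j (u x)\<close> need not be
  jointly measurable in \<open>(x, \<omega>)\<close>, while the inner integral does not depend on that choice.
\<close>

definition int_GF ::
  "'w measure \<Rightarrow> 'w set \<Rightarrow> (real^'n) set \<Rightarrow> (real^'n \<Rightarrow> 'w \<Rightarrow> real) \<Rightarrow> real" where
  "int_GF M F G h = (LINT x|lebesgue_on G. LINT \<omega>|restrict_space M F. h x \<omega>)"

definition two_scale_solution ::
  "'w measure \<Rightarrow> (real^'n \<Rightarrow> 'w \<Rightarrow> 'w) \<Rightarrow> 'w set \<Rightarrow> (real^'n) set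
    \<Rightarrow> ('s::finite \<Rightarrow> int) \<Rightarrow> ('s \<Rightarrow> real) \<Rightarrow> ('s \<Rightarrow> 'w \<Rightarrow> real)
    \<Rightarrow> (real^'n \<Rightarrow> real^'n) \<Rightarrow> (real^'n \<Rightarrow> real^'n)
    \<Rightarrow> (real^'n \<Rightarrow> 'w \<Rightarrow> real^'n) \<Rightarrow> (real^'n \<Rightarrow> real) \<Rightarrow> ('s \<Rightarrow> real^'n \<Rightarrow> real)
    \<Rightarrow> ('s \<Rightarrow> real^'n \<Rightarrow> 'w \<Rightarrow> real^'n) \<Rightarrow> bool" where
  "two_scale_solution M T F G z Pe n E f u P \<Phi>0 \<Phi>1 \<longleftrightarrow>
     u \<in> V_space M T F G \<and> P \<in> L2_zero_mean G \<and>
     (\<forall>j. \<Phi>0 j \<in> H1_0 G \<and> \<Phi>1 j \<in> L2_X M T F G) \<and>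
     (\<forall>\<xi> \<phi> g. \<xi> \<in> test_W M T F G \<and> (\<forall>j. \<phi> j \<in> test_fun G) \<and> (\<forall>j. g j \<in> L2_X M T F G) \<longrightarrow>
        int_GF M F G (\<lambda>x \<omega>. stoch_jac M T (u x) \<omega> \<bullet> stoch_jac M T (\<xi> x) \<omega>)
        - int_GF M F G (\<lambda>x \<omega>. P x * div_x M \<xi> x \<omega>)
        + (\<Sum>j\<in>UNIV. int_GF M F G (\<lambda>x \<omega>. of_int (z j) * n j \<omega> *
             (- (\<xi> x \<omega> \<bullet> (wgrad G (\<Phi>0 j) x + \<Phi>1 j x \<omega>))
              + u x \<omega> \<bullet> (grad (\<phi> j) x + g j x \<omega>))))
        + (\<Sum>j\<in>UNIV. (of_int (z j))\<^sup>2 / Pe j * int_GF M F G (\<lambda>x \<omega>.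
             n j \<omega> * ((wgrad G (\<Phi>0 j) x + \<Phi>1 j x \<omega>) \<bullet> (grad (\<phi> j) x + g j x \<omega>))))
        = - (\<Sum>j\<in>UNIV. (of_int (z j))\<^sup>2 / Pe j * int_GF M F G (\<lambda>x \<omega>.
               n j \<omega> * (E x \<bullet> (grad (\<phi> j) x + g j x \<omega>))))
          + (\<Sum>j\<in>UNIV. int_GF M F G (\<lambda>x \<omega>. of_int (z j) * n j \<omega> * (E x \<bullet> \<xi> x \<omega>)))
          - int_GF M F G (\<lambda>x \<omega>. f x \<bullet> \<xi> x \<omega>))"


section \<open>Auxiliary problems and the effective tensor\<close>

definition cell_form ::
  "'w measure \<Rightarrow> (real^'n \<Rightarrow> 'w \<Rightarrow> 'w) \<Rightarrow> 'w set
    \<Rightarrow> ('s::finite \<Rightarrow> int) \<Rightarrow> ('s \<Rightarrow> real) \<Rightarrow> ('s \<Rightarrow> 'w \<Rightarrow> real)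
    \<Rightarrow> ('w \<Rightarrow> real^'n) \<Rightarrow> ('s \<Rightarrow> 'w \<Rightarrow> real^'n)
    \<Rightarrow> ('w \<Rightarrow> real^'n) \<Rightarrow> ('s \<Rightarrow> 'w \<Rightarrow> real^'n) \<Rightarrow> real" where
  "cell_form M T F z Pe n v \<Theta> \<xi> \<zeta> =
     (LINT \<omega>|restrict_space M F. stoch_jac M T v \<omega> \<bullet> stoch_jac M T \<xi> \<omega>)
     - (\<Sum>j\<in>UNIV. LINT \<omega>|restrict_space M F.
          of_int (z j) * n j \<omega> * (\<Theta> j \<omega> \<bullet> (\<xi> \<omega> - (of_int (z j) / Pe j) *\<^sub>R \<zeta> j \<omega>)))
     + (\<Sum>j\<in>UNIV. of_int (z j) * (LINT \<omega>|restrict_space M F. n j \<omega> * (v \<omega> \<bullet> \<zeta> j \<omega>)))"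

text \<open>Index \<open>None\<close> stands for the problem numbered \<open>0\<close>, \<open>Some i\<close> for that of species \<open>i\<close>.\<close>

definition cell_load ::
  "'w measure \<Rightarrow> 'w set \<Rightarrow> ('s \<Rightarrow> int) \<Rightarrow> ('s \<Rightarrow> real) \<Rightarrow> ('s \<Rightarrow> 'w \<Rightarrow> real)
    \<Rightarrow> 's option \<Rightarrow> 'n::finite \<Rightarrow> ('w \<Rightarrow> real^'n) \<Rightarrow> ('s \<Rightarrow> 'w \<Rightarrow> real^'n) \<Rightarrow> real" where
  "cell_load M F z Pe n a k \<xi> \<zeta> = (case a of
       None \<Rightarrow> LINT \<omega>|restrict_space M F. axis k 1 \<bullet> \<xi> \<omega>
     | Some i \<Rightarrow> of_int (z i) * (LINT \<omega>|restrict_space M F.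
         n i \<omega> * (axis k 1 \<bullet> (\<xi> \<omega> - (of_int (z i) / Pe i) *\<^sub>R \<zeta> i \<omega>))))"

definition cell_solution ::
  "'w measure \<Rightarrow> (real^'n \<Rightarrow> 'w \<Rightarrow> 'w) \<Rightarrow> 'w set
    \<Rightarrow> ('s::finite \<Rightarrow> int) \<Rightarrow> ('s \<Rightarrow> real) \<Rightarrow> ('s \<Rightarrow> 'w \<Rightarrow> real)
    \<Rightarrow> 's option \<Rightarrow> 'n \<Rightarrow> ('w \<Rightarrow> real^'n) \<Rightarrow> ('s \<Rightarrow> 'w \<Rightarrow> real^'n) \<Rightarrow> bool" where
  "cell_solution M T F z Pe n a k v \<Theta> \<longleftrightarrow>
     v \<in> W_space M T F \<and> (\<forall>j. \<Theta> j \<in> X_space M T F) \<and>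
     (\<forall>\<xi> \<zeta>. \<xi> \<in> W_space M T F \<and> (\<forall>j. \<zeta> j \<in> X_space M T F) \<longrightarrow>
        cell_form M T F z Pe n v \<Theta> \<xi> \<zeta> = cell_load M F z Pe n a k \<xi> \<zeta>)"

definition K_mat :: "'w measure \<Rightarrow> ('s option \<Rightarrow> 'n \<Rightarrow> 'w \<Rightarrow> real^'n) \<Rightarrow> real^'n^'n" where
  "K_mat M v = (\<chi> l k. LINT \<omega>|M. v None k \<omega> \<bullet> axis l 1)"

definition J_mat :: "'w measure \<Rightarrow> ('s option \<Rightarrow> 'n \<Rightarrow> 'w \<Rightarrow> real^'n) \<Rightarrow> 's \<Rightarrow> real^'n^'n" where
  "J_mat M v i = (\<chi> l k. LINT \<omega>|M. v (Some i) k \<omega> \<bullet> axis l 1)"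

definition L_mat ::
  "'w measure \<Rightarrow> ('s \<Rightarrow> int) \<Rightarrow> ('s \<Rightarrow> real) \<Rightarrow> ('s \<Rightarrow> 'w \<Rightarrow> real)
    \<Rightarrow> ('s option \<Rightarrow> 'n \<Rightarrow> 'w \<Rightarrow> real^'n) \<Rightarrow> ('s option \<Rightarrow> 'n \<Rightarrow> 's \<Rightarrow> 'w \<Rightarrow> real^'n)
    \<Rightarrow> 's \<Rightarrow> real^'n^'n" where
  "L_mat M z Pe n v \<Theta> j = (\<chi> l k. LINT \<omega>|M.
     n j \<omega> * ((v None k \<omega> + (of_int (z j) / Pe j) *\<^sub>R \<Theta> None k j \<omega>) \<bullet> axis l 1))"

definition D_mat ::
  "'w measure \<Rightarrow> ('s \<Rightarrow> int) \<Rightarrow> ('s \<Rightarrow> real) \<Rightarrow> ('s \<Rightarrow> 'w \<Rightarrow> real)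
    \<Rightarrow> ('s option \<Rightarrow> 'n \<Rightarrow> 'w \<Rightarrow> real^'n) \<Rightarrow> ('s option \<Rightarrow> 'n \<Rightarrow> 's \<Rightarrow> 'w \<Rightarrow> real^'n)
    \<Rightarrow> 's \<Rightarrow> 's \<Rightarrow> real^'n^'n" where
  "D_mat M z Pe n v \<Theta> j i = (\<chi> l k. LINT \<omega>|M.
     n j \<omega> * ((v (Some i) k \<omega> + (of_int (z j) / Pe j) *\<^sub>R
       ((if i = j then axis k 1 else 0) + \<Theta> (Some i) k j \<omega>)) \<bullet> axis l 1))"

text \<open>
  Block vectors and matrices have entries indexed by a block (\<open>None\<close> for the fluid,
  \<open>Some j\<close> for species \<open>j\<close>) together with a spatial coordinate.
\<close>

definition block_vec :: "real^'n \<Rightarrow> ('s \<Rightarrow> real^'n) \<Rightarrow> real^('s::finite option \<times> 'n)" where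
  "block_vec a b = (\<chi> p. case fst p of None \<Rightarrow> a $ snd p | Some j \<Rightarrow> b j $ snd p)"

definition B_mat ::
  "'w measure \<Rightarrow> ('s::finite \<Rightarrow> int) \<Rightarrow> ('s \<Rightarrow> real) \<Rightarrow> ('s \<Rightarrow> 'w \<Rightarrow> real)
    \<Rightarrow> ('s option \<Rightarrow> 'n \<Rightarrow> 'w \<Rightarrow> real^'n) \<Rightarrow> ('s option \<Rightarrow> 'n \<Rightarrow> 's \<Rightarrow> 'w \<Rightarrow> real^'n)
    \<Rightarrow> real^('s option \<times> 'n)^('s option \<times> 'n)" where
  "B_mat M z Pe n v \<Theta> = (\<chi> p q. case fst p of
       None \<Rightarrow> (case fst q of
           None \<Rightarrow> K_mat M v $ snd p $ snd q
         | Some i \<Rightarrow> J_mat M v i $ snd p $ snd q / of_int (z i))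
     | Some j \<Rightarrow> (case fst q of
           None \<Rightarrow> L_mat M z Pe n v \<Theta> j $ snd p $ snd q
         | Some i \<Rightarrow> D_mat M z Pe n v \<Theta> j i $ snd p $ snd q / of_int (z i)))"

definition mean_velocity ::
  "'w measure \<Rightarrow> (real^'n \<Rightarrow> 'w \<Rightarrow> real^'n) \<Rightarrow> real^'n \<Rightarrow> real^'n" where
  "mean_velocity M u x = (LINT \<omega>|M. u x \<omega>)"

definition ionic_potential ::
  "('s \<Rightarrow> int) \<Rightarrow> ('s \<Rightarrow> real^'n \<Rightarrow> real) \<Rightarrow> (real^'n \<Rightarrow> real) \<Rightarrow> 's \<Rightarrow> real^'n \<Rightarrow> real" where
  "ionic_potential z \<Phi>0 \<Psi>ext j x = - of_int (z j) * (\<Phi>0 j x + \<Psi>ext x)"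

definition ionic_flux ::
  "'w measure \<Rightarrow> (real^'n) set \<Rightarrow> ('s \<Rightarrow> int) \<Rightarrow> ('s \<Rightarrow> real) \<Rightarrow> ('s \<Rightarrow> 'w \<Rightarrow> real)
    \<Rightarrow> (real^'n \<Rightarrow> real^'n) \<Rightarrow> (real^'n \<Rightarrow> 'w \<Rightarrow> real^'n) \<Rightarrow> ('s \<Rightarrow> real^'n \<Rightarrow> real)
    \<Rightarrow> ('s \<Rightarrow> real^'n \<Rightarrow> 'w \<Rightarrow> real^'n) \<Rightarrow> 's \<Rightarrow> real^'n \<Rightarrow> real^'n" where
  "ionic_flux M G z Pe n E u \<Phi>0 \<Phi>1 j x =
     (of_int (z j) / Pe j) *\<^sub>R (LINT \<omega>|M. n j \<omega> *\<^sub>R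
        (wgrad G (\<Phi>0 j) x + E x + \<Phi>1 j x \<omega> + (Pe j / of_int (z j)) *\<^sub>R u x \<omega>))"

end

theory Submission
  imports Defs
begin

text \<open>
  The form of the cell problems is the sum of a symmetric part and a skew part coupling velocities
  and potentials, and changing the sign of the potentials of one argument makes it symmetric.
  Hence the entries of the tensor, which are loads evaluated at cell solutions with reversed
  potentials, form a symmetric matrix. After symmetrization they are the Gram matrix of the pairs
  of a velocity gradient and the potentials \<open>\<Theta> + e\<close>, so the tensor is positive semidefinite. It is
  definite because for each direction there is a velocity field in \<open>W_space\<close> with unit mean in that
  direction and orthogonal to \<open>X_space\<close>: one subtracts from a constant the curl of a
  mollified stationary stream function that is affine near each inclusion, and orthogonality to
  potential fields is the symmetry of second derivatives.

  The two-scale problem tested with a test function times a cell solution (with reversed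
  potentials) becomes, by the same symmetry, the load of the cell problem evaluated at the
  two-scale solution; only the pressure keeps a derivative on the test function. As the permeability
  block is invertible, this gives both the weak gradient of the pressure and the flux law.
\<close>

section \<open>Test functions\<close>

text \<open>Two obstacles shape the proof. The stream function must be bounded and measurable in
  \<omega>, although the inclusions are given realization by realization, with no measurable
  numbering. It is taken as an extreme coordinate of the inclusion at the origin, measured from the
  origin: moving the origin by \<open>x\<close> adds \<open>x $ l\<close>, and chains of points from
  a countable dense set make it measurable. A curl needs a second coordinate, so dimension one must
  be excluded; there a connected fluid is incompatible with bounded, separated, relatively dense
  inclusions. The second obstacle is that \<open>gen\<close>, \<open>div_x\<close> and
  \<open>wgrad\<close> are chosen representatives, so the stochastic gradient of \<open>u x\<close>
  need not be jointly measurable in \<open>x\<close> and \<omega>. The cell problem replaces its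
  pairing with a cell solution by terms free of that gradient, whose square integrability in
  \<open>x\<close> follows from Fubini. The pressure is at first only square integrable, so its weak
  gradient has to be produced by the tests with fluid cell solutions before it can appear in the
  flux law.\<close>

lemma test_funE:
  assumes "\<phi> \<in> test_fun U"
  obtains D :: "'n list \<Rightarrow> real^'n \<Rightarrow> real" and K where "D [] = \<phi>"
    "\<And>\<alpha>. continuous_on UNIV (D \<alpha>)"
    "\<And>\<alpha> i x. ((\<lambda>t. D \<alpha> (x + t *\<^sub>R axis i 1)) has_real_derivative D (i # \<alpha>) x) (at 0)"
    "compact K" "K \<subseteq> U" "\<And>\<alpha> x. x \<notin> K \<Longrightarrow> D \<alpha> x = 0"
proof -
  from assms obtain K where K: "compact K" "K \<subseteq> U" "\<And>x. x \<notin> K \<Longrightarrow> \<phi> x = 0" and "smooth_fun UNIV \<phi>"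
    unfolding test_fun_def by blast
  then obtain D :: "'n list \<Rightarrow> real^'n \<Rightarrow> real" where D: "D [] = \<phi>"
    "\<And>\<alpha>. continuous_on UNIV (D \<alpha>)"
    "\<And>\<alpha> i x. ((\<lambda>t. D \<alpha> (x + t *\<^sub>R axis i 1)) has_real_derivative D (i # \<alpha>) x) (at 0)"
    unfolding smooth_fun_def by (auto simp: fun_eq_iff)
  \<comment> \<open>The complement of \<open>K\<close> is open, so off \<open>K\<close> the function
    \<open>D \<alpha>\<close> vanishes on a neighbourhood and its partial derivatives vanish as
    well.\<close>
  have "D \<alpha> x = 0" if "x \<notin> K" for \<alpha> x using that
  proof (induction \<alpha> arbitrary: x)
    case Nil
    then show ?case using D(1) K(3) by simp
  next
    case (Cons i \<alpha>)
    have "open ((\<lambda>t::real. x + t *\<^sub>R axis i 1) -` (- K))"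
      using compact_imp_closed[OF K(1)] by (intro open_vimage continuous_intros) auto
    moreover have "0 \<in> (\<lambda>t::real. x + t *\<^sub>R axis i 1) -` (- K)" using Cons.prems by simp
    ultimately have "((\<lambda>t. D \<alpha> (x + t *\<^sub>R axis i 1)) has_real_derivative 0) (at 0)
      \<longleftrightarrow> ((\<lambda>t. 0) has_real_derivative (0::real)) (at 0)"
      by (intro DERIV_cong_ev refl) (auto simp: eventually_nhds intro!: exI Cons.IH)
    then show ?case using D(3)[of \<alpha> x i] DERIV_unique by fastforce
  qed
  then show thesis using that D K by blast
qed

lemma DERIV_line:
  fixes f :: "real^'n \<Rightarrow> real"
  assumes der: "\<And>x. ((\<lambda>t. f (x + t *\<^sub>R axis i 1)) has_real_derivative D x) (at 0)"
  shows "((\<lambda>t. f (y + t *\<^sub>R axis i 1)) has_real_derivative D (y + s *\<^sub>R axis i 1)) (at s)"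
proof -
  have "((\<lambda>t. f (y + s *\<^sub>R axis i 1 + t *\<^sub>R axis i 1)) has_real_derivative D (y + s *\<^sub>R axis i 1)) (at (s - s))"
    using der[of "y + s *\<^sub>R axis i 1"] by simp
  then have "((\<lambda>t. f (y + s *\<^sub>R axis i 1 + (t + - s) *\<^sub>R axis i 1)) has_real_derivative D (y + s *\<^sub>R axis i 1)) (at s)"
    using DERIV_shift[of "\<lambda>t. f (y + s *\<^sub>R axis i 1 + t *\<^sub>R axis i 1)" _ s "- s"] by simp
  then show ?thesis by (simp add: algebra_simps)
qed

text \<open>\<open>smooth_fun\<close> speaks of partial derivatives only, while \<open>grad\<close>
  is read off the Frechet derivative; continuity of the partials bridges the two. The increment is
  built up one coordinate at a time, each stage being controlled by the mean value inequality on a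
  line.\<close>

lemma has_derivative_partials:
  fixes f :: "real^'n \<Rightarrow> real" and D :: "'n \<Rightarrow> real^'n \<Rightarrow> real"
  assumes cont: "\<And>i. continuous_on UNIV (D i)"
    and der: "\<And>i x. ((\<lambda>t. f (x + t *\<^sub>R axis i 1)) has_real_derivative D i x) (at 0)"
  shows "(f has_derivative (\<lambda>h. \<Sum>i\<in>UNIV. D i x * h $ i)) (at x)"
proof -
  have bl: "bounded_linear (\<lambda>h::real^'n. \<Sum>i\<in>UNIV. D i x * h $ i)"
    by (intro bounded_linear_sum bounded_linear_mult_right[THEN bounded_linear_compose] bounded_linear_vec_nth)
  show ?thesis
    unfolding has_derivative_at_within
  proof (intro conjI bl)
    have main: "\<exists>d>0. \<forall>h. norm h < d \<longrightarrow>
        norm (f (x + h) - f x - (\<Sum>i\<in>UNIV. D i x * h $ i)) \<le> e * norm h" if "0 < e" for e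
    proof -
      define e' where "e' = e / CARD('n)"
      have e': "0 < e'" using that by (simp add: e'_def)
      have "\<exists>d>0. \<forall>y. dist y x < d \<longrightarrow> dist (D i y) (D i x) < e'" for i
        using cont[of i] e' by (auto simp: continuous_on_iff)
      then obtain d where d: "\<And>i. 0 < d i" "\<And>i y. dist y x < d i \<Longrightarrow> dist (D i y) (D i x) < e'"
        by metis
      define \<delta> where "\<delta> = Min (range d)"
      have \<delta>: "0 < \<delta>" "\<And>i. \<delta> \<le> d i" using d by (auto simp: \<delta>_def)
      have "norm (f (x + h) - f x - (\<Sum>i\<in>UNIV. D i x * h $ i)) \<le> e * norm h" if h: "norm h < \<delta>" for h
      proof -
        \<comment> \<open>The increment \<open>h\<close> with its coordinates outside
          \<open>S\<close> set to zero; the induction on \<open>S\<close> switches them on one by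
          one, without ever exceeding the norm of \<open>h\<close>.\<close>
        define p where "p S = (\<chi> i. if i \<in> S then h $ i else 0)" for S
        have ind: "finite S \<Longrightarrow> \<bar>f (x + p S) - f x - (\<Sum>i\<in>S. D i x * h $ i)\<bar> \<le> e' * (\<Sum>i\<in>S. \<bar>h $ i\<bar>)" for S
        proof (induction S rule: finite_induct)
          case empty
          then show ?case by (simp add: p_def zero_vec_def[symmetric])
        next
          case (insert i S)
          have pi: "p (insert i S) = p S + (h $ i) *\<^sub>R axis i 1"
            using insert by (auto simp: p_def vec_eq_iff axis_def)
          have bnd: "norm (p S + s *\<^sub>R axis i 1) \<le> norm h" if "\<bar>s\<bar> \<le> \<bar>h $ i\<bar>" for s
            using that insert by (intro norm_le_componentwise_cart) (auto simp: p_def axis_def)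
          define g where "g s = f (x + p S + s *\<^sub>R axis i 1) - s * D i x" for s
          have gder: "(g has_real_derivative D i (x + p S + s *\<^sub>R axis i 1) - D i x) (at s)" for s
            unfolding g_def by (auto intro!: derivative_eq_intros DERIV_line der)
          have "norm (g (h $ i) - g 0) \<le> e' * norm (h $ i - 0)"
          proof (rule field_differentiable_bound[where S = "{s. \<bar>s\<bar> \<le> \<bar>h $ i\<bar>}" and f' = "\<lambda>s. D i (x + p S + s *\<^sub>R axis i 1) - D i x"])
            have "{s. \<bar>s\<bar> \<le> \<bar>h $ i\<bar>} = cbox (- \<bar>h $ i\<bar>) \<bar>h $ i\<bar>" by auto
            then show "convex {s. \<bar>s\<bar> \<le> \<bar>h $ i\<bar>}" by (metis convex_box(1))
            show "norm (D i (x + p S + s *\<^sub>R axis i 1) - D i x) \<le> e'" if "s \<in> {s. \<bar>s\<bar> \<le> \<bar>h $ i\<bar>}" for s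
            proof -
              have "dist (x + p S + s *\<^sub>R axis i 1) x < d i"
                using bnd[of s] that h \<delta>(2)[of i] by (simp add: dist_norm add.assoc)
              then show ?thesis using d(2) by (fastforce simp: dist_norm)
            qed
          qed (use gder in \<open>auto intro: has_field_derivative_at_within\<close>)
          then have "\<bar>f (x + p (insert i S)) - f (x + p S) - D i x * h $ i\<bar> \<le> e' * \<bar>h $ i\<bar>"
            by (simp add: g_def pi algebra_simps)
          with insert show ?case by (simp add: algebra_simps abs_le_iff)
        qed
        have "p UNIV = h" by (simp add: p_def vec_eq_iff)
        with ind[of UNIV] have "\<bar>f (x + h) - f x - (\<Sum>i\<in>UNIV. D i x * h $ i)\<bar> \<le> e' * (\<Sum>i\<in>UNIV. \<bar>h $ i\<bar>)" by simp
        also have "\<dots> \<le> e' * (\<Sum>i\<in>(UNIV::'n set). norm h)"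
          using e' by (intro mult_left_mono sum_mono component_le_norm_cart) auto
        also have "\<dots> = e * norm h" by (simp add: e'_def)
        finally show ?thesis by simp
      qed
      with \<delta>(1) show ?thesis by blast
    qed
    show "((\<lambda>y. (f y - f x - (\<Sum>i\<in>UNIV. D i x * (y - x) $ i)) /\<^sub>R norm (y - x)) \<longlongrightarrow> 0) (at x)"
      unfolding tendsto_iff
    proof (intro allI impI)
      fix e :: real assume e: "0 < e"
      obtain d where d: "d > 0" "\<And>h. norm h < d \<Longrightarrow>
        norm (f (x + h) - f x - (\<Sum>i\<in>UNIV. D i x * h $ i)) \<le> e / 2 * norm h"
        using main[of "e/2"] e by auto
      show "\<forall>\<^sub>F y in at x. dist ((f y - f x - (\<Sum>i\<in>UNIV. D i x * (y - x) $ i)) /\<^sub>R norm (y - x)) 0 < e"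
        unfolding eventually_at
      proof (intro exI[of _ d] conjI ballI impI d)
        fix y assume y: "y \<noteq> x \<and> dist y x < d"
        then have "norm (f y - f x - (\<Sum>i\<in>UNIV. D i x * (y - x) $ i)) \<le> e / 2 * norm (y - x)"
          using d(2)[of "y - x"] by (simp add: dist_norm)
        then have "norm ((f y - f x - (\<Sum>i\<in>UNIV. D i x * (y - x) $ i)) /\<^sub>R norm (y - x)) \<le> e / 2"
          using y by (simp add: divide_simps)
        with e show "dist ((f y - f x - (\<Sum>i\<in>UNIV. D i x * (y - x) $ i)) /\<^sub>R norm (y - x)) 0 < e" by simp
      qed
    qed
  qed
qed

lemma grad_partials:
  fixes f :: "real^'n \<Rightarrow> real"
  assumes "\<And>i. continuous_on UNIV (D i)"
    and "\<And>i x. ((\<lambda>t. f (x + t *\<^sub>R axis i 1)) has_real_derivative D i x) (at 0)"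
  shows "grad f x $ i = D i x"
proof -
  have "frechet_derivative f (at x) = (\<lambda>h. \<Sum>i\<in>UNIV. D i x * h $ i)"
    using has_derivative_partials[OF assms] by (metis frechet_derivative_at)
  then show ?thesis by (simp add: grad_def axis_def if_distrib cong: if_cong)
qed

text \<open>The second difference of \<open>D []\<close> over a square of side \<open>h\<close>
  equals \<open>h * h\<close> times a mixed derivative at an intermediate point. It is symmetric in
  the two directions, so both orders of differentiation agree at points arbitrarily close to
  \<open>x\<close>.\<close>

lemma mixed_partials_commute:
  fixes D :: "'n list \<Rightarrow> real^'n \<Rightarrow> real"
  assumes cont: "\<And>\<alpha>. continuous_on UNIV (D \<alpha>)"
    and der: "\<And>\<alpha> i x. ((\<lambda>t. D \<alpha> (x + t *\<^sub>R axis i 1)) has_real_derivative D (i # \<alpha>) x) (at 0)"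
  shows "D [i, j] x = D [j, i] x"
proof (rule ccontr)
  assume ne: "D [i, j] x \<noteq> D [j, i] x"
  define e where "e = \<bar>D [i, j] x - D [j, i] x\<bar> / 2"
  have e: "0 < e" using ne by (simp add: e_def)
  have mvt: "\<exists>y. norm (y - x) \<le> 2 * h \<and>
      D [] (x + h *\<^sub>R axis i 1 + h *\<^sub>R axis j 1) - D [] (x + h *\<^sub>R axis i 1) - D [] (x + h *\<^sub>R axis j 1) + D [] x = h * (h * D [j, i] y)"
    if h: "0 < h" for h i j
  proof -
    define g where "g s = D [] (x + h *\<^sub>R axis j 1 + s *\<^sub>R axis i 1) - D [] (x + s *\<^sub>R axis i 1)" for s
    have "(g has_real_derivative D [i] (x + h *\<^sub>R axis j 1 + s *\<^sub>R axis i 1) - D [i] (x + s *\<^sub>R axis i 1)) (at s)" for s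
      unfolding g_def by (rule DERIV_diff[OF DERIV_line[OF der] DERIV_line[OF der]])
    from MVT2[OF h this] obtain s where s: "0 < s" "s < h" "g h - g 0 = (h - 0) * (D [i] (x + h *\<^sub>R axis j 1 + s *\<^sub>R axis i 1) - D [i] (x + s *\<^sub>R axis i 1))"
      by blast
    obtain t where t: "0 < t" "t < h" "D [i] (x + s *\<^sub>R axis i 1 + h *\<^sub>R axis j 1) - D [i] (x + s *\<^sub>R axis i 1 + 0 *\<^sub>R axis j 1) = (h - 0) * D [j, i] (x + s *\<^sub>R axis i 1 + t *\<^sub>R axis j 1)"
      using MVT2[OF h DERIV_line[OF der]] by blast
    have "norm (s *\<^sub>R axis i (1::real) + t *\<^sub>R axis j 1) \<le> s + t"
      using s t by (intro order_trans[OF norm_triangle_ineq]) simp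
    then show ?thesis using s t
      by (intro exI[of _ "x + s *\<^sub>R axis i 1 + t *\<^sub>R axis j 1"]) (simp add: g_def algebra_simps)
  qed
  obtain d1 where d1: "0 < d1" "\<And>y. dist y x < d1 \<Longrightarrow> dist (D [i, j] y) (D [i, j] x) < e"
    using cont[of "[i, j]"] e unfolding continuous_on_iff by (metis UNIV_I)
  obtain d2 where d2: "0 < d2" "\<And>y. dist y x < d2 \<Longrightarrow> dist (D [j, i] y) (D [j, i] x) < e"
    using cont[of "[j, i]"] e unfolding continuous_on_iff by (metis UNIV_I)
  \<comment> \<open>The intermediate points lie within \<open>2 * h\<close> of \<open>x\<close>,
    hence the division by 3.\<close>
  define h where "h = min d1 d2 / 3"
  have h: "0 < h" "2 * h < d1" "2 * h < d2" using d1 d2 by (auto simp: h_def)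
  obtain y where y: "norm (y - x) \<le> 2 * h" "D [] (x + h *\<^sub>R axis i 1 + h *\<^sub>R axis j 1) - D [] (x + h *\<^sub>R axis i 1) - D [] (x + h *\<^sub>R axis j 1) + D [] x = h * (h * D [j, i] y)"
    using mvt[OF h(1)] by blast
  obtain w where w: "norm (w - x) \<le> 2 * h" "D [] (x + h *\<^sub>R axis j 1 + h *\<^sub>R axis i 1) - D [] (x + h *\<^sub>R axis j 1) - D [] (x + h *\<^sub>R axis i 1) + D [] x = h * (h * D [i, j] w)"
    using mvt[OF h(1)] by blast
  have "h * (h * D [j, i] y) = h * (h * D [i, j] w)"
    using y(2) w(2) by (simp add: algebra_simps)
  then have "D [j, i] y = D [i, j] w" using h(1) by simp
  moreover have "dist (D [i, j] w) (D [i, j] x) < e" "dist (D [j, i] y) (D [j, i] x) < e"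
    by (intro d1(2) d2(2); use y(1) w(1) h in \<open>simp add: dist_norm\<close>)+
  ultimately show False unfolding e_def dist_real_def by (auto simp: abs_if split: if_splits)
qed

section \<open>Smooth bump functions supported in boxes\<close>

primrec leibniz :: "'a list \<Rightarrow> ('a list \<times> 'a list) list" where
  "leibniz [] = [([], [])]"
| "leibniz (i # \<alpha>) = concat (map (\<lambda>(\<beta>, \<gamma>). [(i # \<beta>, \<gamma>), (\<beta>, i # \<gamma>)]) (leibniz \<alpha>))"

lemma smooth_fun_mult:
  fixes f g :: "real^'n \<Rightarrow> real"
  assumes "smooth_fun UNIV f" "smooth_fun UNIV g"
  shows "smooth_fun UNIV (\<lambda>x. f x * g x)"
proof -
  obtain D where D: "D [] = f" "\<And>\<alpha>. continuous_on UNIV (D \<alpha>)"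
    "\<And>\<alpha> i x. ((\<lambda>t. D \<alpha> (x + t *\<^sub>R axis i 1)) has_real_derivative D (i # \<alpha>) x) (at 0)"
    using assms(1) unfolding smooth_fun_def by (auto simp: fun_eq_iff)
  obtain H where H: "H [] = g" "\<And>\<alpha>. continuous_on UNIV (H \<alpha>)"
    "\<And>\<alpha> i x. ((\<lambda>t. H \<alpha> (x + t *\<^sub>R axis i 1)) has_real_derivative H (i # \<alpha>) x) (at 0)"
    using assms(2) unfolding smooth_fun_def by (auto simp: fun_eq_iff)
  \<comment> \<open>\<open>leibniz \<alpha>\<close> lists the ways of distributing the letters of
    \<alpha> over the two factors, repeated pairs standing in for binomial coefficients.
    \<open>P\<close> takes an arbitrary list so that the product rule can be proved by induction on
    it.\<close>
  define P where "P ps x = (\<Sum>(\<beta>, \<gamma>)\<leftarrow>ps. D \<beta> x * H \<gamma> x)" for ps x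
  have cont: "continuous_on UNIV (P ps)" for ps
    unfolding P_def by (induction ps) (auto intro!: continuous_intros D(2) H(2) split: prod.split)
  have der: "((\<lambda>t. P ps (x + t *\<^sub>R axis i 1)) has_real_derivative
      P (concat (map (\<lambda>(\<beta>, \<gamma>). [(i # \<beta>, \<gamma>), (\<beta>, i # \<gamma>)]) ps)) x) (at 0)" for ps x i
  proof (induction ps)
    case Nil
    then show ?case by (simp add: P_def)
  next
    case (Cons p ps)
    obtain \<beta> \<gamma> where p: "p = (\<beta>, \<gamma>)" by force
    have 1: "P (p # ps) y = D \<beta> y * H \<gamma> y + P ps y" for y by (simp add: P_def p)
    have 2: "P (concat (map (\<lambda>(\<beta>, \<gamma>). [(i # \<beta>, \<gamma>), (\<beta>, i # \<gamma>)]) (p # ps))) x =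
      D (i # \<beta>) x * H \<gamma> x + D \<beta> x * H (i # \<gamma>) x + P (concat (map (\<lambda>(\<beta>, \<gamma>). [(i # \<beta>, \<gamma>), (\<beta>, i # \<gamma>)]) ps)) x"
      by (simp add: P_def p)
    show ?case unfolding 1 2
      by (auto intro!: derivative_eq_intros D(3) H(3) Cons)
  qed
  show ?thesis unfolding smooth_fun_def
  proof (intro exI[of _ "\<lambda>\<alpha>. P (leibniz \<alpha>)"] conjI allI ballI cont)
    show "P (leibniz []) x = f x * g x" for x by (simp add: P_def D H)
    show "((\<lambda>t. P (leibniz \<alpha>) (x + t *\<^sub>R axis i 1)) has_real_derivative P (leibniz (i # \<alpha>)) x) (at 0)" for \<alpha> i x
      using der[of "leibniz \<alpha>" x i] by simp
  qed
qed

lemma smooth_fun_const: "smooth_fun UNIV (\<lambda>x. c)"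
  unfolding smooth_fun_def
  by (rule exI[of _ "\<lambda>\<alpha> x. if \<alpha> = [] then c else 0"]) auto

lemma smooth_fun_prod:
  fixes f :: "'i \<Rightarrow> real^'n \<Rightarrow> real"
  assumes "finite I" "\<And>i. i \<in> I \<Longrightarrow> smooth_fun UNIV (f i)"
  shows "smooth_fun UNIV (\<lambda>x. \<Prod>i\<in>I. f i x)"
  using assms by (induction I rule: finite_induct) (auto intro!: smooth_fun_mult smooth_fun_const)

text \<open>The polynomial in \<open>1 / t\<close> makes the family closed under differentiation,
  also at 0, which the flat exponential alone is not.\<close>

definition flat :: "real poly \<Rightarrow> real \<Rightarrow> real \<Rightarrow> real" where
  "flat p c t = (if 0 < t then poly p (1 / t) * exp (- (c / t)) else 0)"

text \<open>The derivative of order \<open>k\<close> of \<open>flat 1 c\<close> is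
  \<open>flat (flat_poly c k) c\<close>.\<close>

primrec flat_poly :: "real \<Rightarrow> nat \<Rightarrow> real poly" where
  "flat_poly c 0 = 1"
| "flat_poly c (Suc k) = [:0, 0, 1:] * (smult c (flat_poly c k) - pderiv (flat_poly c k))"

lemma poly_exp_tendsto_0:
  assumes "0 < c"
  shows "((\<lambda>x::real. poly p x * exp (- (c * x))) \<longlongrightarrow> 0) at_top"
proof -
  have mono: "((\<lambda>x::real. x ^ k * exp (- (c * x))) \<longlongrightarrow> 0) at_top" for k
  proof -
    have "((\<lambda>x. (c * x) ^ k / exp (c * x)) \<longlongrightarrow> 0) at_top"
      by (rule filterlim_compose[OF tendsto_power_div_exp_0])
         (use assms in \<open>auto intro: filterlim_tendsto_pos_mult_at_top[OF tendsto_const] filterlim_ident\<close>)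
    then have "((\<lambda>x. (1 / c ^ k) * ((c * x) ^ k / exp (c * x))) \<longlongrightarrow> (1 / c ^ k) * 0) at_top"
      by (intro tendsto_intros)
    then show ?thesis using assms by (simp add: power_mult_distrib exp_minus field_simps)
  qed
  have "((\<lambda>x. \<Sum>k\<le>degree p. coeff p k * (x ^ k * exp (- (c * x)))) \<longlongrightarrow> (\<Sum>k\<le>degree p. coeff p k * 0)) at_top"
    by (intro tendsto_intros mono)
  then show ?thesis by (simp add: poly_altdef sum_distrib_right mult.assoc)
qed

lemma flat_has_derivative:
  assumes c: "0 < c"
  shows "(flat p c has_real_derivative flat ([:0, 0, 1:] * (smult c p - pderiv p)) c t) (at t)"
proof -
  consider "0 < t" | "t < 0" | "t = 0" by linarith
  then show ?thesis
  proof cases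
    case 1
    have "((\<lambda>t. poly p (1 / t) * exp (- (c / t))) has_real_derivative
      flat ([:0, 0, 1:] * (smult c p - pderiv p)) c t) (at t)"
      using 1 by (auto intro!: derivative_eq_intros poly_DERIV[THEN DERIV_chain2]
         simp: flat_def field_simps power2_eq_square)
    moreover have "\<forall>\<^sub>F s in nhds t. s \<in> {0<..}"
      using 1 by (intro eventually_nhds_in_open) auto
    ultimately show ?thesis
      by (subst DERIV_cong_ev[OF refl _ refl]) (auto elim!: eventually_mono simp: flat_def)
  next
    case 2
    have "\<forall>\<^sub>F s in nhds t. s \<in> {..<0}"
      using 2 by (intro eventually_nhds_in_open) auto
    then have "(flat p c has_real_derivative 0) (at t) \<longleftrightarrow> ((\<lambda>t. 0) has_real_derivative 0) (at t)"
      by (intro DERIV_cong_ev refl) (auto elim!: eventually_mono simp: flat_def)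
    then show ?thesis using 2 by (simp add: flat_def)
  next
    case 3
    \<comment> \<open>With \<open>x = 1 / h\<close> the quotient \<open>flat p c h / h\<close>
      becomes \<open>x * poly p x * exp (- (c * x))\<close>; the extra factor \<open>x\<close> comes
      from the division by \<open>h\<close>.\<close>
    have "((\<lambda>x. poly ([:0, 1:] * p) x * exp (- (c * x))) \<longlongrightarrow> 0) at_top"
      by (rule poly_exp_tendsto_0[OF c])
    then have "((\<lambda>h. poly ([:0, 1:] * p) (inverse h) * exp (- (c * inverse h))) \<longlongrightarrow> 0) (at_right 0)"
      by (rule filterlim_compose[OF _ filterlim_inverse_at_top_right])
    then have r: "((\<lambda>h. flat p c h / h) \<longlongrightarrow> 0) (at_right 0)"
      by (rule Lim_transform_eventually)
         (auto simp: eventually_at_filter flat_def field_simps)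
    have l: "((\<lambda>h. flat p c h / h) \<longlongrightarrow> 0) (at_left 0)"
      by (rule Lim_transform_eventually[OF tendsto_const])
         (auto simp: eventually_at_filter flat_def)
    from l r have "((\<lambda>h. flat p c h / h) \<longlongrightarrow> 0) (at 0)"
      by (simp add: filterlim_at_split)
    then show ?thesis using 3 by (simp add: DERIV_def flat_def)
  qed
qed

lemma flat_1: "flat 1 c t = (if 0 < t then exp (- (c / t)) else 0)"
  by (simp add: flat_def)

lemma smooth_fun_flat_coord:
  assumes "0 < c"
  shows "smooth_fun UNIV (\<lambda>x::real^'n. flat 1 c (s * x $ i + a))"
proof -
  \<comment> \<open>A function of \<open>x $ i\<close> alone is annihilated by every word with a
    letter other than \<open>i\<close>; the remaining words give an ordinary derivative and a chain
    rule factor.\<close>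
  define D where "D \<alpha> x = (if set \<alpha> \<subseteq> {i} then s ^ length \<alpha> * flat (flat_poly c (length \<alpha>)) c (s * x $ i + a) else 0)"
    for \<alpha> and x :: "real^'n"
  have cont: "continuous_on UNIV (flat p c)" for p
    using flat_has_derivative[OF assms] by (meson DERIV_continuous_on has_field_derivative_at_within)
  show ?thesis unfolding smooth_fun_def
  proof (intro exI[of _ D] conjI allI ballI)
    show "D [] x = flat 1 c (s * x $ i + a)" for x by (simp add: D_def)
    show "continuous_on UNIV (D \<alpha>)" for \<alpha>
      unfolding D_def by (cases "set \<alpha> \<subseteq> {i}") (auto intro!: continuous_intros continuous_on_compose2[OF cont])
    show "((\<lambda>t. D \<alpha> (x + t *\<^sub>R axis j 1)) has_real_derivative D (j # \<alpha>) x) (at 0)" for \<alpha> j x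
    proof (cases "set \<alpha> \<subseteq> {i} \<and> j = i")
      case True
      then have "((\<lambda>t. s ^ length \<alpha> * flat (flat_poly c (length \<alpha>)) c (s * (x $ i + t) + a)) has_real_derivative D (j # \<alpha>) x) (at 0)"
        by (auto intro!: derivative_eq_intros flat_has_derivative[OF assms, THEN DERIV_chain2] simp: D_def)
      with True show ?thesis by (simp add: D_def axis_def)
    next
      case False
      then have "D (j # \<alpha>) x = 0" "D \<alpha> (x + t *\<^sub>R axis j 1) = D \<alpha> x" for t
        by (auto simp: D_def axis_def)
      then show ?thesis by simp
    qed
  qed
qed

text \<open>Positive exactly inside the open box. Letting \<open>c\<close> tend to 0 produces the
  indicator of the box, so that integrals against test functions determine integrals over boxes;
  \<open>c = 1\<close> serves as the raw mollifier.\<close>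

definition bump :: "real \<Rightarrow> real^'n \<Rightarrow> real^'n \<Rightarrow> real^'n \<Rightarrow> real" where
  "bump c a b x = (\<Prod>i\<in>UNIV. flat 1 c (x $ i - a $ i) * flat 1 c (b $ i - x $ i))"

lemma bump_test_fun:
  assumes "0 < c" "cbox a b \<subseteq> U"
  shows "bump c a b \<in> test_fun U"
proof -
  have "smooth_fun UNIV (bump c a b)"
    unfolding bump_def
    using smooth_fun_flat_coord[OF assms(1), of 1 _ "- a $ _"] smooth_fun_flat_coord[OF assms(1), of "-1" _ "b $ _"]
    by (intro smooth_fun_prod smooth_fun_mult) auto
  moreover have "bump c a b x = 0" if x: "x \<notin> cbox a b" for x
  proof -
    obtain i where "x $ i < a $ i \<or> b $ i < x $ i" using x unfolding mem_box_cart by (meson not_le)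
    then have "flat 1 c (x $ i - a $ i) * flat 1 c (b $ i - x $ i) = 0" by (auto simp: flat_1)
    then show ?thesis unfolding bump_def by (intro prod_zero) auto
  qed
  ultimately show ?thesis unfolding test_fun_def using assms(2) compact_cbox by blast
qed

lemma bump_nonneg: "0 \<le> bump c a b x"
  unfolding bump_def by (intro prod_nonneg) (auto simp: flat_1)

lemma bump_le: "0 < c \<Longrightarrow> bump c a b x \<le> indicator (box a b) x"
proof (cases "x \<in> box a b")
  case True
  moreover assume "0 < c"
  ultimately have "flat 1 c (x $ i - a $ i) * flat 1 c (b $ i - x $ i) \<le> 1" for i
    by (intro mult_le_one) (auto simp: flat_1)
  then show ?thesis unfolding bump_def using True by (auto intro!: prod_le_1 simp: flat_1)
next
  case False
  then obtain i where "x $ i \<le> a $ i \<or> b $ i \<le> x $ i" by (auto simp: mem_box_cart not_less)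
  then have "flat 1 c (x $ i - a $ i) * flat 1 c (b $ i - x $ i) = 0" by (auto simp: flat_1)
  then show ?thesis unfolding bump_def by (subst prod_zero) auto
qed

lemma bump_tendsto: "(\<lambda>m. bump (1 / Suc m) a b x) \<longlonglongrightarrow> indicator (box a b) x"
proof (cases "x \<in> box a b")
  case True
  have l: "(\<lambda>m. exp (- (1 / real (Suc m) / d))) \<longlonglongrightarrow> 1" if "0 < d" for d :: real
  proof -
    have "(\<lambda>m. exp (- (1 / real (Suc m) / d))) \<longlonglongrightarrow> exp (- (0 / d))"
      using that by (intro tendsto_intros LIMSEQ_Suc lim_1_over_n) auto
    then show ?thesis by simp
  qed
  have "(\<lambda>m. \<Prod>i\<in>UNIV. exp (- (1 / real (Suc m) / (x $ i - a $ i))) * exp (- (1 / real (Suc m) / (b $ i - x $ i)))) \<longlonglongrightarrow> (\<Prod>i\<in>(UNIV::'a set). 1 * 1)"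
    using True by (intro tendsto_intros l) (auto simp: mem_box_cart)
  then show ?thesis using True by (simp add: bump_def flat_1 mem_box_cart)
next
  case False
  then have "bump (1 / Suc m) a b x = 0" for m
    using bump_le[of "1 / Suc m" a b x] bump_nonneg[of "1 / Suc m" a b x] by auto
  then show ?thesis using False by simp
qed

lemma test_fun_zero: "(\<lambda>x::real^'n. 0) \<in> test_fun G"
  unfolding test_fun_def by (auto intro!: smooth_fun_const exI[of _ "{}"])

lemma grad_zero: "grad (\<lambda>x::real^'n. 0) x = 0"
  by (simp add: grad_def vec_eq_iff frechet_derivative_const)

section \<open>Weak gradients\<close>

lemma locally_integrable_test:
  fixes h :: "real^'n \<Rightarrow> 'b::euclidean_space" and \<phi> :: "real^'n \<Rightarrow> real"
  assumes "open G" "locally_integrable G h" and cont: "continuous_on UNIV \<phi>"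
    and K: "compact K" "K \<subseteq> G" "\<And>x. x \<notin> K \<Longrightarrow> \<phi> x = 0"
  shows "integrable (lebesgue_on G) (\<lambda>x. \<phi> x *\<^sub>R h x)"
proof -
  have G: "G \<in> sets lebesgue" using \<open>open G\<close> by auto
  have "integrable lebesgue (\<lambda>x. indicat_real K x *\<^sub>R h x)"
    using assms(2) K unfolding locally_integrable_def set_integrable_def by blast
  moreover have "(\<lambda>x. indicat_real K x *\<^sub>R h x) = (\<lambda>x. indicat_real G x *\<^sub>R (indicat_real K x *\<^sub>R h x))"
    using K(2) by (auto simp: fun_eq_iff indicator_def)
  ultimately have int: "integrable (lebesgue_on G) (\<lambda>x. indicat_real K x *\<^sub>R h x)"
    using G by (subst integrable_restrict_space) (auto simp del: scaleR_scaleR)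
  obtain C where C: "\<And>x. x \<in> K \<Longrightarrow> norm (\<phi> x) \<le> C"
    using compact_continuous_image[OF continuous_on_subset[OF cont subset_UNIV] K(1)]
    by (metis bounded_iff compact_imp_bounded imageI)
  have m: "\<phi> \<in> borel_measurable (lebesgue_on G)"
    using cont by (intro measurable_restrict_space1) (auto intro!: borel_measurable_continuous_onI measurable_completion)
  have "integrable (lebesgue_on G) (\<lambda>x. \<phi> x *\<^sub>R (indicat_real K x *\<^sub>R h x))"
  proof (rule Bochner_Integration.integrable_bound[OF integrable_norm[OF integrable_scaleR_right[OF int, of C]]])
    show "(\<lambda>x. \<phi> x *\<^sub>R indicat_real K x *\<^sub>R h x) \<in> borel_measurable (lebesgue_on G)"
      using m borel_measurable_integrable[OF int] by (rule borel_measurable_scaleR)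
    show "AE x in lebesgue_on G. norm (\<phi> x *\<^sub>R indicat_real K x *\<^sub>R h x) \<le> norm (norm (C *\<^sub>R indicat_real K x *\<^sub>R h x))"
      using C by (intro AE_I2) (auto simp: indicator_def intro!: mult_right_mono order_trans[OF _ abs_ge_self])
  qed
  moreover have "(\<lambda>x. \<phi> x *\<^sub>R (indicat_real K x *\<^sub>R h x)) = (\<lambda>x. \<phi> x *\<^sub>R h x)"
    using K(3) by (auto simp: fun_eq_iff indicator_def)
  ultimately show ?thesis by metis
qed

lemma locally_integrable_test_fun:
  fixes h :: "real^'n \<Rightarrow> 'b::euclidean_space" and \<phi> :: "real^'n \<Rightarrow> real"
  assumes "open G" "locally_integrable G h" "\<phi> \<in> test_fun G"
  shows "integrable (lebesgue_on G) (\<lambda>x. \<phi> x *\<^sub>R h x)"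
    and "integrable (lebesgue_on G) (\<lambda>x. (grad \<phi> x $ i) *\<^sub>R h x)"
proof -
  obtain D :: "'n list \<Rightarrow> real^'n \<Rightarrow> real" and K where D: "D [] = \<phi>"
    "\<And>\<alpha>. continuous_on UNIV (D \<alpha>)"
    "\<And>\<alpha> i x. ((\<lambda>t. D \<alpha> (x + t *\<^sub>R axis i 1)) has_real_derivative D (i # \<alpha>) x) (at 0)"
    "compact K" "K \<subseteq> G" "\<And>\<alpha> x. x \<notin> K \<Longrightarrow> D \<alpha> x = 0"
    by (rule test_funE[OF assms(3)]) (rule that)
  have "grad \<phi> x $ i = D [i] x" for x i
    using grad_partials[of "\<lambda>i. D [i]" \<phi>] D(2,3) unfolding D(1)[symmetric] by blast
  then show "integrable (lebesgue_on G) (\<lambda>x. \<phi> x *\<^sub>R h x)"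
    and "integrable (lebesgue_on G) (\<lambda>x. (grad \<phi> x $ i) *\<^sub>R h x)"
    using locally_integrable_test[OF assms(1,2) D(2)[of "[i]"] D(4,5,6)]
      locally_integrable_test[OF assms(1,2) D(2)[of "[]"] D(4,5,6)] D(1) by auto
qed

text \<open>Open boxes form an intersection-stable generator of the Borel sets, so the vanishing of
  the integrals spreads to Borel sets, and from there to Lebesgue sets, which are Borel up to a null
  set.\<close>

lemma AE_zero_if_box_integrals_zero:
  fixes h :: "'a::euclidean_space \<Rightarrow> real"
  assumes int: "integrable lebesgue h"
    and box: "\<And>a b. (LINT x:box a b|lebesgue. h x) = 0"
  shows "AE x in lebesgue. h x = 0"
proof -
  have si: "set_integrable lebesgue A h" if "A \<in> sets lebesgue" for A
    unfolding set_integrable_def using that int by (intro integrable_mult_indicator)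
  \<comment> \<open>The whole space is not a box, and complements in the Dynkin argument need its
    integral.\<close>
  have UNIV: "(LINT x:UNIV|lebesgue. h x) = 0"
  proof -
    have "(\<lambda>m. LINT x:box (- real m *\<^sub>R One) (real m *\<^sub>R One)|lebesgue. h x) \<longlonglongrightarrow>
      (LINT x:(\<Union>m. box (- real m *\<^sub>R One) (real m *\<^sub>R One))|lebesgue. h x)"
      by (intro set_integral_cont_up si)
         (auto simp: incseq_def subset_box intro!: sets.countable_UN)
    moreover have "(\<Union>m. box (- real m *\<^sub>R One) (real m *\<^sub>R One)) = (UNIV :: 'a set)"
      using UN_box_eq_UNIV by simp
    ultimately show ?thesis using box by (simp add: LIMSEQ_const_iff)
  qed
  have borel: "(LINT x:A|lebesgue. h x) = 0" if "A \<in> sets borel" for A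
  proof -
    have sets: "sets (borel :: 'a measure) = sigma_sets UNIV (range (\<lambda>(a, b). box a b))"
      by (subst borel_eq_box) simp
    have leb: "B \<in> sets lebesgue" if "B \<in> sigma_sets UNIV (range (\<lambda>(a, b). box a b))" for B :: "'a set"
      using that unfolding sets[symmetric] by auto
    have "Int_stable (range (\<lambda>(a, b). box a b :: 'a set))"
      by (auto simp: Int_stable_def box_Int_box)
    then show ?thesis
    proof (rule sigma_sets_induct_disjoint[OF _ _ that[unfolded sets], where P = "\<lambda>A. (LINT x:A|lebesgue. h x) = 0"])
      fix A :: "'a set"
      assume A: "A \<in> sigma_sets UNIV (range (\<lambda>(a, b). box a b))" "(LINT x:A|lebesgue. h x) = 0"
      have "(LINT x:A \<union> (UNIV - A)|lebesgue. h x) = (LINT x:A|lebesgue. h x) + (LINT x:UNIV - A|lebesgue. h x)"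
        using leb[OF A(1)] by (intro set_integral_Un si) auto
      then show "(LINT x:UNIV - A|lebesgue. h x) = 0" using UNIV A by simp
    next
      fix A :: "nat \<Rightarrow> 'a set"
      assume A: "disjoint_family A" "range A \<subseteq> sigma_sets UNIV (range (\<lambda>(a, b). box a b))"
        "\<And>i. (LINT x:A i|lebesgue. h x) = 0"
      have Ai: "A i \<in> sets lebesgue" for i
        using A(2) by (intro leb) auto
      have "(LINT x:(\<Union>i. A i)|lebesgue. h x) = (\<Sum>i. LINT x:A i|lebesgue. h x)"
        using A Ai by (intro lebesgue_integral_countable_add si) (auto simp: disjoint_family_on_def)
      then show "(LINT x:(\<Union>i. A i)|lebesgue. h x) = 0" using A by simp
    qed (use box in \<open>auto simp: set_lebesgue_integral_def\<close>)
  qed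
  have "AE x in lebesgue. h x = (\<lambda>_. 0) x"
  proof (rule density_unique_real[OF int])
    fix A :: "'a set" assume "A \<in> sets lebesgue"
    then obtain B N where B: "B \<in> sets borel" "negligible N" "B \<union> N = A"
      by (rule sets_lebesgue_almost_borel)
    have "AE x in lebesgue. x \<notin> N"
      using B(2) by (simp add: negligible_iff_null_sets AE_not_in)
    then have "(LINT x:A|lebesgue. h x) = (LINT x:B|lebesgue. h x)"
      using B \<open>A \<in> sets lebesgue\<close> int unfolding set_lebesgue_integral_def
      by (intro integral_cong_AE borel_measurable_scaleR borel_measurable_indicator)
         (auto simp: indicator_def)
    then show "(LINT x:A|lebesgue. h x) = (LINT x:A|lebesgue. 0)"
      using borel[OF B(1)] by (simp add: set_lebesgue_integral_def)
  qed auto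
  then show ?thesis by simp
qed

text \<open>Fundamental lemma of the calculus of variations. The bumps of a box converge to its
  indicator, dominated by \<open>h\<close> on the closed box, so the box integrals inside
  \<open>G\<close> vanish; countably many closed boxes exhaust \<open>G\<close>.\<close>

lemma AE_zero_if_test_integrals_zero:
  fixes h :: "real^'n \<Rightarrow> real"
  assumes "open G" and li: "locally_integrable G h"
    and zero: "\<And>\<phi>. \<phi> \<in> test_fun G \<Longrightarrow> (LINT x|lebesgue_on G. h x * \<phi> x) = 0"
  shows "AE x in lebesgue_on G. h x = 0"
proof -
  have G: "G \<in> sets lebesgue" using \<open>open G\<close> by auto
  have cb: "set_integrable lebesgue (cbox a b) h" if "cbox a b \<subseteq> G" for a b
    using li[unfolded locally_integrable_def, rule_format, of "cbox a b"] that by simp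
  have box0: "(LINT x:box a b|lebesgue. h x) = 0" if ab: "cbox a b \<subseteq> G" for a b
  proof -
    have i: "integrable (lebesgue_on G) (\<lambda>x. indicat_real (cbox a b) x * h x)"
    proof -
      have "(\<lambda>x. indicat_real G x *\<^sub>R (indicat_real (cbox a b) x * h x)) = (\<lambda>x. indicat_real (cbox a b) x *\<^sub>R h x)"
        using ab by (auto simp: fun_eq_iff indicator_def)
      then show ?thesis
        using cb[OF ab] G unfolding set_integrable_def by (subst integrable_restrict_space) auto
    qed
    have "(\<lambda>m. LINT x|lebesgue_on G. h x * bump (1 / Suc m) a b x) \<longlonglongrightarrow>
      (LINT x|lebesgue_on G. h x * indicator (box a b) x)"
    proof (rule integral_dominated_convergence[where w = "\<lambda>x. norm (indicat_real (cbox a b) x * h x)"])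
      show m: "(\<lambda>x. h x * bump (1 / Suc m) a b x) \<in> borel_measurable (lebesgue_on G)" for m
        using locally_integrable_test_fun(1)[OF assms(1,2) bump_test_fun[OF _ ab, of "1 / Suc m"]]
        by (auto simp: mult.commute)
      show "(\<lambda>x. h x * indicator (box a b) x) \<in> borel_measurable (lebesgue_on G)"
        by (rule borel_measurable_LIMSEQ_real[where u = "\<lambda>m x. h x * bump (1 / Suc m) a b x"])
           (intro tendsto_intros bump_tendsto, rule m)
      show "integrable (lebesgue_on G) (\<lambda>x. norm (indicat_real (cbox a b) x * h x))"
        using i by (rule integrable_norm)
      show "AE x in lebesgue_on G. (\<lambda>m. h x * bump (1 / Suc m) a b x) \<longlonglongrightarrow> h x * indicator (box a b) x"
        by (intro AE_I2 tendsto_intros bump_tendsto)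
      show "AE x in lebesgue_on G. norm (h x * bump (1 / Suc m) a b x) \<le> norm (indicat_real (cbox a b) x * h x)" for m
      proof (intro AE_I2)
        fix x
        have "bump (1 / Suc m) a b x \<le> indicat_real (cbox a b) x"
          using bump_le[of "1 / Suc m" a b x] box_subset_cbox[of a b]
          by (cases "x \<in> box a b"; cases "x \<in> cbox a b") (auto simp del: of_nat_Suc)
        then have "\<bar>h x\<bar> * bump (1 / Suc m) a b x \<le> \<bar>h x\<bar> * indicat_real (cbox a b) x"
          by (intro mult_left_mono) auto
        then show "norm (h x * bump (1 / Suc m) a b x) \<le> norm (indicat_real (cbox a b) x * h x)"
          using bump_nonneg[of "1 / Suc m" a b x] by (simp add: abs_mult mult.commute)
      qed
    qed
    then have "(LINT x|lebesgue_on G. h x * indicator (box a b) x) = 0"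
      using zero[OF bump_test_fun[OF _ ab]] by (simp add: LIMSEQ_const_iff)
    moreover have "indicat_real G x * (h x * indicat_real (box a b) x) = indicat_real (box a b) x * h x" for x
      using ab box_subset_cbox[of a b] by (auto simp: indicator_def)
    ultimately show ?thesis
      using G by (simp add: integral_restrict_space set_lebesgue_integral_def)
  qed
  have cbox0: "AE x in lebesgue. x \<in> cbox a b \<longrightarrow> h x = 0" if ab: "cbox a b \<subseteq> G" for a b
  proof -
    have "AE x in lebesgue. indicat_real (box a b) x * h x = 0"
    proof (rule AE_zero_if_box_integrals_zero)
      have "set_integrable lebesgue (box a b) h"
        using cb[OF ab] by (rule set_integrable_subset) (auto dest: subsetD[OF box_subset_cbox])
      then show "integrable lebesgue (\<lambda>x. indicat_real (box a b) x * h x)"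
        by (simp add: set_integrable_def)
      fix c d :: "real^'n"
      obtain e f where ef: "box c d \<inter> box a b = box e f" unfolding box_Int_box by blast
      have "(LINT x:box c d|lebesgue. indicat_real (box a b) x * h x) = (LINT x:box e f|lebesgue. h x)"
        unfolding set_lebesgue_integral_def ef[symmetric] by (simp add: indicator_inter_arith mult.assoc)
      also have "\<dots> = 0"
      proof (cases "box e f = {}")
        case False
        then have "cbox e f \<subseteq> cbox a b"
          using ef by (metis Int_lower2 box_subset_cbox closure_box closure_minimal closed_cbox order_trans)
        then show ?thesis using ab box0 by blast
      qed (simp add: set_lebesgue_integral_def)
      finally show "(LINT x:box c d|lebesgue. indicat_real (box a b) x * h x) = 0" .
    qed
    moreover have "AE x in lebesgue. x \<notin> cbox a b - box a b"
      by (rule AE_not_in[OF negligible_frontier_interval[unfolded negligible_iff_null_sets]])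
    ultimately show ?thesis by eventually_elim (auto simp: indicator_def split: if_splits)
  qed
  obtain \<D> where \<D>: "countable \<D>" "\<D> \<subseteq> Pow G" "\<And>X. X \<in> \<D> \<Longrightarrow> \<exists>a b. X = cbox a b" "\<Union>\<D> = G"
    by (rule open_countable_Union_open_cbox[OF \<open>open G\<close>]) (rule that)
  have "AE x in lebesgue. \<forall>X\<in>\<D>. x \<in> X \<longrightarrow> h x = 0"
    unfolding AE_ball_countable[OF \<D>(1)] using \<D>(2,3) cbox0 by (metis PowD subsetD)
  then have "AE x in lebesgue. x \<in> G \<longrightarrow> h x = 0"
    by eventually_elim (metis UnionE \<D>(4))
  then show ?thesis using G by (simp add: AE_restrict_space_iff)
qed

lemma locally_integrable_add:
  "locally_integrable U f \<Longrightarrow> locally_integrable U g \<Longrightarrow> locally_integrable U (\<lambda>x. f x + g x)"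
  unfolding locally_integrable_def by auto

lemma locally_integrable_scaleR:
  "locally_integrable U f \<Longrightarrow> locally_integrable U (\<lambda>x. c *\<^sub>R f x)"
  unfolding locally_integrable_def by (auto intro: absolutely_integrable_scaleR_left)

lemma locally_integrable_nth:
  fixes f :: "real^'m \<Rightarrow> real^'n"
  assumes "locally_integrable U f"
  shows "locally_integrable U (\<lambda>x. f x $ i)"
  unfolding locally_integrable_def set_integrable_def
proof (intro allI impI)
  fix K assume "compact K \<and> K \<subseteq> U"
  then have "integrable lebesgue (\<lambda>x. indicat_real K x *\<^sub>R f x)"
    using assms unfolding locally_integrable_def set_integrable_def by blast
  from integrable_bounded_linear[OF bounded_linear_vec_nth this, of i]
  show "integrable lebesgue (\<lambda>x. indicat_real K x *\<^sub>R f x $ i)" by simp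
qed

lemma has_weak_grad_scale:
  fixes f :: "real^'n \<Rightarrow> real"
  assumes "has_weak_grad U f g"
  shows "has_weak_grad U (\<lambda>x. c * f x) (\<lambda>x. c *\<^sub>R g x)"
  using assms locally_integrable_scaleR[of U f c] locally_integrable_scaleR[of U g c]
  unfolding has_weak_grad_def by (auto simp: mult.assoc)

lemma has_weak_grad_add:
  fixes f f' :: "real^'n \<Rightarrow> real"
  assumes "open U" "has_weak_grad U f g" "has_weak_grad U f' g'"
  shows "has_weak_grad U (\<lambda>x. f x + f' x) (\<lambda>x. g x + g' x)"
  unfolding has_weak_grad_def
proof (intro conjI ballI allI)
  fix \<phi> i assume \<phi>: "\<phi> \<in> test_fun U"
  have li: "locally_integrable U f" "locally_integrable U f'" "locally_integrable U g" "locally_integrable U g'"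
    using assms(2,3) unfolding has_weak_grad_def by auto
  note I = locally_integrable_test_fun[OF assms(1) _ \<phi>]
  have "(LINT x|lebesgue_on U. (f x + f' x) * grad \<phi> x $ i) =
    (LINT x|lebesgue_on U. f x * grad \<phi> x $ i) + (LINT x|lebesgue_on U. f' x * grad \<phi> x $ i)"
    using I(2)[OF li(1), of i] I(2)[OF li(2), of i]
    by (subst Bochner_Integration.integral_add[symmetric]) (auto simp: algebra_simps)
  also have "\<dots> = - ((LINT x|lebesgue_on U. g x $ i * \<phi> x) + (LINT x|lebesgue_on U. g' x $ i * \<phi> x))"
    using assms(2,3) \<phi> unfolding has_weak_grad_def by simp
  also have "(LINT x|lebesgue_on U. g x $ i * \<phi> x) + (LINT x|lebesgue_on U. g' x $ i * \<phi> x) =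
     (LINT x|lebesgue_on U. (g x + g' x) $ i * \<phi> x)"
    using I(1)[OF locally_integrable_nth[OF li(3)], of i] I(1)[OF locally_integrable_nth[OF li(4)], of i]
    by (subst Bochner_Integration.integral_add[symmetric]) (auto simp: algebra_simps)
  finally show "(LINT x|lebesgue_on U. (f x + f' x) * grad \<phi> x $ i) = - (LINT x|lebesgue_on U. (g x + g' x) $ i * \<phi> x)" .
qed (use assms in \<open>auto simp: has_weak_grad_def intro: locally_integrable_add\<close>)

lemma has_weak_grad_unique:
  fixes f :: "real^'n \<Rightarrow> real"
  assumes "open U" "has_weak_grad U f g" "has_weak_grad U f g'"
  shows "AE x in lebesgue_on U. g x = g' x"
proof -
  have li: "locally_integrable U g" "locally_integrable U g'"
    using assms unfolding has_weak_grad_def by auto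
  have "AE x in lebesgue_on U. \<forall>i\<in>UNIV. g x $ i - g' x $ i = 0"
  proof (rule AE_finite_allI)
    fix i
    show "AE x in lebesgue_on U. g x $ i - g' x $ i = 0"
    proof (rule AE_zero_if_test_integrals_zero[OF assms(1)])
      show "locally_integrable U (\<lambda>x. g x $ i - g' x $ i)"
        using locally_integrable_add[OF locally_integrable_nth[OF li(1)] locally_integrable_scaleR[OF locally_integrable_nth[OF li(2)], of "-1"]]
        by simp
      fix \<phi> assume \<phi>: "\<phi> \<in> test_fun U"
      have "(LINT x|lebesgue_on U. g x $ i * \<phi> x) = (LINT x|lebesgue_on U. g' x $ i * \<phi> x)"
        using assms(2,3) \<phi> unfolding has_weak_grad_def by (metis (no_types, lifting) neg_equal_iff_equal)
      moreover have "(LINT x|lebesgue_on U. (g x $ i - g' x $ i) * \<phi> x) =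
        (LINT x|lebesgue_on U. g x $ i * \<phi> x) - (LINT x|lebesgue_on U. g' x $ i * \<phi> x)"
        using locally_integrable_test_fun(1)[OF assms(1) locally_integrable_nth[OF li(1)] \<phi>, of i]
          locally_integrable_test_fun(1)[OF assms(1) locally_integrable_nth[OF li(2)] \<phi>, of i]
        by (subst Bochner_Integration.integral_diff[symmetric]) (auto simp: algebra_simps)
      ultimately show "(LINT x|lebesgue_on U. (g x $ i - g' x $ i) * \<phi> x) = 0" by simp
    qed
  qed auto
  then show ?thesis by eventually_elim (auto simp: vec_eq_iff)
qed

lemma wgrad_unique:
  assumes "open U" "has_weak_grad U f g"
  shows "has_weak_grad U f (wgrad U f)" "AE x in lebesgue_on U. wgrad U f x = g x"
proof -
  show *: "has_weak_grad U f (wgrad U f)"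
    unfolding wgrad_def by (rule someI[of "has_weak_grad U f", OF assms(2)])
  show "AE x in lebesgue_on U. wgrad U f x = g x"
    by (rule has_weak_grad_unique[OF assms(1) * assms(2)])
qed

text \<open>Lebesgue measure is complete. This matters because integrals over \<omega> are
  identified with measurable functions of \<open>x\<close> only for almost every
  \<open>x\<close>.\<close>

lemma borel_measurable_lebesgue_on_AE:
  fixes f g :: "real^'n \<Rightarrow> 'b::euclidean_space"
  assumes "f \<in> borel_measurable (lebesgue_on G)" "G \<in> sets lebesgue"
    "AE x in lebesgue_on G. f x = g x"
  shows "g \<in> borel_measurable (lebesgue_on G)"
proof -
  have "(\<lambda>x. indicator G x *\<^sub>R g x) \<in> borel_measurable lebesgue"
  proof (rule borel_measurable_AE)
    show "(\<lambda>x. indicator G x *\<^sub>R f x) \<in> borel_measurable lebesgue"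
      using assms(1,2) by (simp add: borel_measurable_restrict_space_iff)
    show "AE x in lebesgue. indicator G x *\<^sub>R f x = indicator G x *\<^sub>R g x"
      using assms(2,3) by (simp add: AE_restrict_space_iff) (auto elim!: eventually_mono simp: indicator_def)
  qed
  then show ?thesis using assms(2) by (simp add: borel_measurable_restrict_space_iff)
qed

lemma integral_lebesgue_on_cong_AE:
  fixes f g :: "real^'n \<Rightarrow> real"
  assumes "G \<in> sets lebesgue" "g \<in> borel_measurable (lebesgue_on G)" "AE x in lebesgue_on G. f x = g x"
  shows "(LINT x|lebesgue_on G. f x) = (LINT x|lebesgue_on G. g x)"
proof (rule integral_cong_AE)
  show "f \<in> borel_measurable (lebesgue_on G)"
    by (rule borel_measurable_lebesgue_on_AE[OF assms(2,1)]) (use assms(3) in \<open>auto elim: eventually_mono\<close>)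
qed (use assms in auto)

lemma H1_wgrad:
  fixes f :: "real^'n \<Rightarrow> real"
  assumes "open G" "f \<in> H1 G"
  shows "has_weak_grad G f (wgrad G f)" "wgrad G f \<in> L2 (lebesgue_on G)"
proof -
  obtain g where g: "g \<in> L2 (lebesgue_on G)" "has_weak_grad G f g"
    using assms(2) unfolding H1_def by blast
  show "has_weak_grad G f (wgrad G f)" using wgrad_unique(1)[OF assms(1) g(2)] .
  have ae: "AE x in lebesgue_on G. g x = wgrad G f x"
    using wgrad_unique(2)[OF assms(1) g(2)] by eventually_elim simp
  have m: "wgrad G f \<in> borel_measurable (lebesgue_on G)"
    by (rule borel_measurable_lebesgue_on_AE[OF _ _ ae]) (use g assms in \<open>auto simp: L2_def\<close>)
  have "integrable (lebesgue_on G) (\<lambda>x. (norm (wgrad G f x))\<^sup>2)"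
    by (rule integrable_cong_AE_imp[of _ "\<lambda>x. (norm (g x))\<^sup>2"])
       (use g m ae in \<open>auto simp: L2_def elim!: eventually_mono\<close>)
  with m show "wgrad G f \<in> L2 (lebesgue_on G)" by (simp add: L2_def)
qed

section \<open>Square integrable functions and stationary flows\<close>

lemma L2_measurable: "f \<in> L2 M \<Longrightarrow> f \<in> borel_measurable M"
  by (simp add: L2_def)

lemma L2_integrable_inner:
  fixes f g :: "'a \<Rightarrow> 'b::euclidean_space"
  assumes "f \<in> L2 M" "g \<in> L2 M"
  shows "integrable M (\<lambda>x. f x \<bullet> g x)"
proof (rule Bochner_Integration.integrable_bound)
  show "integrable M (\<lambda>x. (norm (f x))\<^sup>2 + (norm (g x))\<^sup>2)"
    using assms by (auto simp: L2_def)
  show "(\<lambda>x. f x \<bullet> g x) \<in> borel_measurable M"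
    using assms by (auto simp: L2_def)
  have "\<bar>f x \<bullet> g x\<bar> \<le> (norm (f x))\<^sup>2 + (norm (g x))\<^sup>2" for x
    using Cauchy_Schwarz_ineq2[of "f x" "g x"] sum_squares_bound[of "norm (f x)" "norm (g x)"]
      norm_ge_zero[of "f x"] norm_ge_zero[of "g x"] mult_nonneg_nonneg[of "norm (f x)" "norm (g x)"] by linarith
  then show "AE x in M. norm (f x \<bullet> g x) \<le> norm ((norm (f x))\<^sup>2 + (norm (g x))\<^sup>2)"
    by auto
qed

lemma L2_bound:
  fixes f :: "'a \<Rightarrow> 'b::euclidean_space" and g :: "'a \<Rightarrow> 'c::euclidean_space"
  assumes "f \<in> L2 M" "g \<in> borel_measurable M" "AE x in M. norm (g x) \<le> C * norm (f x)"
  shows "g \<in> L2 M"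
proof -
  have "integrable M (\<lambda>x. (norm (g x))\<^sup>2)"
  proof (rule Bochner_Integration.integrable_bound)
    show "integrable M (\<lambda>x. C\<^sup>2 * (norm (f x))\<^sup>2)" using assms(1) by (auto simp: L2_def)
    show "AE x in M. norm ((norm (g x))\<^sup>2) \<le> norm (C\<^sup>2 * (norm (f x))\<^sup>2)"
      using assms(3) by eventually_elim (auto simp: power_mult_distrib[symmetric] intro!: power_mono)
  qed (use assms(2) in auto)
  with assms(2) show ?thesis by (simp add: L2_def)
qed

lemma L2_scaleR:
  fixes f :: "'a \<Rightarrow> 'b::euclidean_space"
  shows "f \<in> L2 M \<Longrightarrow> (\<lambda>x. c *\<^sub>R f x) \<in> L2 M"
  by (rule L2_bound[where C = "\<bar>c\<bar>"]) (auto simp: L2_def)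

lemma L2_add:
  fixes f g :: "'a \<Rightarrow> 'b::euclidean_space"
  assumes "f \<in> L2 M" "g \<in> L2 M"
  shows "(\<lambda>x. f x + g x) \<in> L2 M"
proof -
  have "integrable M (\<lambda>x. f x \<bullet> f x + 2 * (f x \<bullet> g x) + g x \<bullet> g x)"
    using L2_integrable_inner[OF assms] L2_integrable_inner[OF assms(1,1)] L2_integrable_inner[OF assms(2,2)] by auto
  moreover have "(norm (f x + g x))\<^sup>2 = f x \<bullet> f x + 2 * (f x \<bullet> g x) + g x \<bullet> g x" for x
    by (simp add: power2_norm_eq_inner inner_add inner_commute)
  moreover have "(\<lambda>x. f x + g x) \<in> borel_measurable M"
    using assms[THEN L2_measurable] by (rule borel_measurable_add)
  ultimately show ?thesis by (simp add: L2_def)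
qed

lemma L2_minus:
  fixes f :: "'a \<Rightarrow> 'b::euclidean_space"
  shows "f \<in> L2 M \<Longrightarrow> (\<lambda>x. - f x) \<in> L2 M"
  using L2_scaleR[of f M "-1"] by simp

lemma L2_diff:
  fixes f g :: "'a \<Rightarrow> 'b::euclidean_space"
  shows "f \<in> L2 M \<Longrightarrow> g \<in> L2 M \<Longrightarrow> (\<lambda>x. f x - g x) \<in> L2 M"
  using L2_add[of f M "\<lambda>x. (-1) *\<^sub>R g x"] L2_scaleR[of g M "-1"] by simp

lemma L2_nth:
  fixes f :: "'a \<Rightarrow> 'b::euclidean_space^'n"
  assumes "f \<in> L2 M"
  shows "(\<lambda>x. f x $ i) \<in> L2 M"
proof (rule L2_bound[OF assms, of _ 1])
  show "(\<lambda>x. f x $ i) \<in> borel_measurable M"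
    by (rule borel_measurable_continuous_on[OF _ L2_measurable[OF assms]]) (intro continuous_intros)
qed (use Finite_Cartesian_Product.norm_nth_le in \<open>auto intro!: AE_I2\<close>)

lemma borel_measurable_vec_lambda:
  fixes f :: "'n::finite \<Rightarrow> 'a \<Rightarrow> 'b::euclidean_space"
  assumes "\<And>i. f i \<in> borel_measurable M"
  shows "(\<lambda>x. \<chi> i. f i x) \<in> borel_measurable M"
proof (rule borel_measurable_euclidean_space[THEN iffD2], intro ballI)
  fix b :: "'b^'n" assume "b \<in> Basis"
  then obtain u i where "b = axis i u" by (auto simp: Basis_vec_def)
  then show "(\<lambda>x. (\<chi> i. f i x) \<bullet> b) \<in> borel_measurable M"
    using assms by (auto simp: inner_axis)
qed

lemma L2_vec_lambda:
  fixes f :: "'n::finite \<Rightarrow> 'a \<Rightarrow> 'b::euclidean_space"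
  assumes "\<And>i. f i \<in> L2 M"
  shows "(\<lambda>x. \<chi> i. f i x) \<in> L2 M"
proof -
  have "(norm (\<chi> i. f i x))\<^sup>2 = (\<Sum>i\<in>UNIV. (norm (f i x))\<^sup>2)" for x
    by (simp add: norm_vec_def L2_set_def sum_nonneg)
  then show ?thesis
    using assms by (auto simp: L2_def intro!: borel_measurable_vec_lambda Bochner_Integration.integrable_sum)
qed

lemma L2_Cauchy_Schwarz:
  fixes f g :: "'a \<Rightarrow> 'b::euclidean_space"
  assumes "f \<in> L2 M" "g \<in> L2 M"
  shows "(LINT x|M. f x \<bullet> g x)\<^sup>2 \<le> (LINT x|M. (norm (f x))\<^sup>2) * (LINT x|M. (norm (g x))\<^sup>2)"
proof -
  define a b c where "a = (LINT x|M. (norm (f x))\<^sup>2)" and "b = (LINT x|M. f x \<bullet> g x)" and "c = (LINT x|M. (norm (g x))\<^sup>2)"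
  have pos: "0 \<le> a + 2 * s * b + s\<^sup>2 * c" for s
  proof -
    have "(LINT x|M. (norm (f x + s *\<^sub>R g x))\<^sup>2) = (LINT x|M. (norm (f x))\<^sup>2 + 2 * s * (f x \<bullet> g x) + s\<^sup>2 * (norm (g x))\<^sup>2)"
      by (intro Bochner_Integration.integral_cong) (simp_all add: power2_norm_eq_inner inner_add inner_commute, simp add: power2_eq_square algebra_simps)
    also have "\<dots> = a + 2 * s * b + s\<^sup>2 * c"
      using L2_integrable_inner[OF assms] assms unfolding a_def b_def c_def by (subst Bochner_Integration.integral_add | simp add: L2_def)+
    finally show ?thesis by (metis (no_types, lifting) Bochner_Integration.integral_nonneg zero_le_power2)
  qed
  have "0 \<le> c" by (simp add: c_def)
  have "b\<^sup>2 \<le> a * c"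
  proof (cases "c = 0")
    case True
    have "b = 0"
    proof (rule ccontr)
      assume "b \<noteq> 0"
      \<comment> \<open>For \<open>c = 0\<close> the nonnegative quadratic degenerates to an affine
        function of \<open>s\<close>; at this \<open>s\<close> it would equal -1.\<close>
      have "a + 2 * (- (a + 1) / (2 * b)) * b = -1" using \<open>b \<noteq> 0\<close> by (simp add: field_simps)
      then show False using pos[of "- (a + 1) / (2 * b)"] True by simp
    qed
    then show ?thesis using True by simp
  next
    case False
    then have "0 < c" using \<open>0 \<le> c\<close> by simp
    have "a + 2 * (- b / c) * b + (- b / c)\<^sup>2 * c = a - b\<^sup>2 / c"
      using \<open>0 < c\<close> by (simp add: field_simps power2_eq_square)
    then have "b\<^sup>2 / c \<le> a" using pos[of "- b / c"] by simp
    then show ?thesis using \<open>0 < c\<close> by (simp add: field_simps)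
  qed
  then show ?thesis by (simp add: a_def b_def c_def)
qed

lemma (in finite_measure) L2_integrable:
  fixes f :: "'a \<Rightarrow> 'b::euclidean_space"
  assumes "f \<in> L2 M"
  shows "integrable M f"
proof (rule Bochner_Integration.integrable_bound)
  show "integrable M (\<lambda>x. 1 + (norm (f x))\<^sup>2)" using assms by (auto simp: L2_def)
  have "norm (f x) \<le> 1 + (norm (f x))\<^sup>2" for x
    using sum_squares_bound[of 1 "norm (f x)"] norm_ge_zero[of "f x"] unfolding power_one mult_1_right
    by linarith
  then show "AE x in M. norm (f x) \<le> norm (1 + (norm (f x))\<^sup>2)"
    by (intro AE_I2) (auto intro: order_trans[OF _ abs_ge_self])
qed (use assms in \<open>auto simp: L2_def\<close>)

lemma L2_sum:
  fixes f :: "'i \<Rightarrow> 'a \<Rightarrow> 'b::euclidean_space"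
  assumes "\<And>i. i \<in> I \<Longrightarrow> f i \<in> L2 M"
  shows "(\<lambda>x. \<Sum>i\<in>I. f i x) \<in> L2 M"
  using assms
proof (induction I rule: infinite_finite_induct)
  case (insert i I)
  then show ?case using L2_add[of "f i" M "\<lambda>x. \<Sum>i\<in>I. f i x"] by simp
qed (auto simp: L2_def)

lemma L2_cmult: "f \<in> L2 M \<Longrightarrow> (\<lambda>x. c * f x :: real) \<in> L2 M"
  using L2_scaleR[of f M c] by simp

lemma L2_inner_const:
  fixes f :: "'a \<Rightarrow> 'b::euclidean_space"
  assumes "f \<in> L2 M"
  shows "(\<lambda>x. f x \<bullet> c) \<in> L2 M"
proof (rule L2_bound[OF assms])
  show "(\<lambda>x. f x \<bullet> c) \<in> borel_measurable M" using L2_measurable[OF assms] by simp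
  show "AE x in M. norm (f x \<bullet> c) \<le> norm c * norm (f x)"
    by (intro AE_I2) (metis Cauchy_Schwarz_ineq2 mult.commute real_norm_def)
qed

text \<open>Makes the derivatives chosen by \<open>SOME\<close> unique up to null sets: the
  generators in \<omega> and the partial derivatives in \<open>x\<close> of maps with values in
  \<open>L2 M\<close>.\<close>

lemma L2_limit_unique:
  fixes q :: "real \<Rightarrow> 'a \<Rightarrow> 'b::euclidean_space"
  assumes q: "\<And>t. q t \<in> L2 M" and g: "g \<in> L2 M" "g' \<in> L2 M"
    and lim: "((\<lambda>t. LINT x|M. (norm (q t x - g x))\<^sup>2) \<longlongrightarrow> 0) (at 0)"
      "((\<lambda>t. LINT x|M. (norm (q t x - g' x))\<^sup>2) \<longlongrightarrow> 0) (at 0)"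
  shows "AE x in M. g x = g' x"
proof -
  have int: "integrable M (\<lambda>x. (norm (h x))\<^sup>2)" if "h \<in> L2 M" for h :: "'a \<Rightarrow> 'b"
    using that by (simp add: L2_def)
  have le: "(LINT x|M. (norm (g x - g' x))\<^sup>2) \<le> 2 * (LINT x|M. (norm (q t x - g x))\<^sup>2) + 2 * (LINT x|M. (norm (q t x - g' x))\<^sup>2)" for t
  proof -
    have "(LINT x|M. (norm (g x - g' x))\<^sup>2) \<le> (LINT x|M. 2 * (norm (q t x - g x))\<^sup>2 + 2 * (norm (q t x - g' x))\<^sup>2)"
    proof (rule integral_mono)
      fix x
      \<comment> \<open>Parallelogram identity for \<open>q t x - g x\<close> and
        \<open>q t x - g' x\<close>.\<close>
      have "(norm (g x - g' x))\<^sup>2 + (norm ((q t x - g x) + (q t x - g' x)))\<^sup>2 = 2 * (norm (q t x - g x))\<^sup>2 + 2 * (norm (q t x - g' x))\<^sup>2"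
        by (simp add: power2_norm_eq_inner inner_add inner_diff inner_commute)
      then show "(norm (g x - g' x))\<^sup>2 \<le> 2 * (norm (q t x - g x))\<^sup>2 + 2 * (norm (q t x - g' x))\<^sup>2"
        by (metis le_add_same_cancel1 zero_le_power2)
    qed (auto intro!: int L2_diff q g)
    also have "\<dots> = 2 * (LINT x|M. (norm (q t x - g x))\<^sup>2) + 2 * (LINT x|M. (norm (q t x - g' x))\<^sup>2)"
      by (subst Bochner_Integration.integral_add) (auto intro!: int L2_diff q g)
    finally show ?thesis .
  qed
  have "((\<lambda>t. 2 * (LINT x|M. (norm (q t x - g x))\<^sup>2) + 2 * (LINT x|M. (norm (q t x - g' x))\<^sup>2)) \<longlongrightarrow> 2 * 0 + 2 * 0) (at 0)"
    by (intro tendsto_intros lim)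
  then have "(LINT x|M. (norm (g x - g' x))\<^sup>2) \<le> 0"
    using le by (intro tendsto_lowerbound) auto
  then have "(LINT x|M. (norm (g x - g' x))\<^sup>2) = 0"
    by (simp add: antisym)
  then have "AE x in M. (norm (g x - g' x))\<^sup>2 = 0"
    by (subst (asm) integral_nonneg_eq_0_iff_AE) (auto intro!: int L2_diff g)
  then show ?thesis by auto
qed

text \<open>Pairing a jointly measurable field with a fixed function of \<omega> leaves a square
  integrable function of \<open>x\<close>, by Fubini and Cauchy-Schwarz. The terms of the two-scale
  problem are brought to this shape before they are integrated in \<open>x\<close>.\<close>

lemma L2_partial_inner:
  fixes U :: "'x \<Rightarrow> 'w \<Rightarrow> 'b::euclidean_space"
  assumes N: "finite_measure N" and R: "finite_measure R"
    and U: "(\<lambda>(x, \<omega>). U x \<omega>) \<in> L2 (N \<Otimes>\<^sub>M R)" and w: "w \<in> L2 R"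
  shows "(\<lambda>x. LINT \<omega>|R. U x \<omega> \<bullet> w \<omega>) \<in> L2 N" and "AE x in N. U x \<in> L2 R"
proof -
  interpret N: finite_measure N by fact
  interpret R: finite_measure R by fact
  interpret P: pair_sigma_finite N R ..
  have m: "(\<lambda>(x, \<omega>). U x \<omega>) \<in> borel_measurable (N \<Otimes>\<^sub>M R)"
    and i: "integrable (N \<Otimes>\<^sub>M R) (\<lambda>(x, \<omega>). (norm (U x \<omega>))\<^sup>2)"
    using U by (auto simp: L2_def case_prod_beta')
  have mx: "U x \<in> borel_measurable R" if "x \<in> space N" for x
    using measurable_compose[OF measurable_Pair1'[OF that] m] by simp
  show ae: "AE x in N. U x \<in> L2 R"
    using P.AE_integrable_fst'[OF i] AE_space by eventually_elim (auto simp: L2_def mx)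
  have iU: "integrable N (\<lambda>x. LINT \<omega>|R. (norm (U x \<omega>))\<^sup>2)"
    using P.integrable_fst'[OF i] by simp
  have wm: "w \<in> borel_measurable R" using w by (simp add: L2_def)
  have m2: "(\<lambda>x. LINT \<omega>|R. U x \<omega> \<bullet> w \<omega>) \<in> borel_measurable N"
  proof (rule R.borel_measurable_lebesgue_integral)
    have "(\<lambda>p. (case p of (x, \<omega>) \<Rightarrow> U x \<omega>) \<bullet> w (snd p)) \<in> borel_measurable (N \<Otimes>\<^sub>M R)"
      using m by (intro borel_measurable_inner measurable_compose[OF measurable_snd wm]) auto
    then show "(\<lambda>(x, \<omega>). U x \<omega> \<bullet> w \<omega>) \<in> borel_measurable (N \<Otimes>\<^sub>M R)"
      by (simp add: case_prod_beta')
  qed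
  have "integrable N (\<lambda>x. (LINT \<omega>|R. U x \<omega> \<bullet> w \<omega>)\<^sup>2)"
  proof (rule Bochner_Integration.integrable_bound)
    show "integrable N (\<lambda>x. (LINT \<omega>|R. (norm (U x \<omega>))\<^sup>2) * (LINT \<omega>|R. (norm (w \<omega>))\<^sup>2))"
      using iU by simp
    show "(\<lambda>x. (LINT \<omega>|R. U x \<omega> \<bullet> w \<omega>)\<^sup>2) \<in> borel_measurable N"
      using m2 by simp
    show "AE x in N. norm ((LINT \<omega>|R. U x \<omega> \<bullet> w \<omega>)\<^sup>2) \<le> norm ((LINT \<omega>|R. (norm (U x \<omega>))\<^sup>2) * (LINT \<omega>|R. (norm (w \<omega>))\<^sup>2))"
      using ae by eventually_elim (use L2_Cauchy_Schwarz[OF _ w] in \<open>auto intro: order_trans[OF _ abs_ge_self]\<close>)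
  qed
  then show "(\<lambda>x. LINT \<omega>|R. U x \<omega> \<bullet> w \<omega>) \<in> L2 N" using m2 by (simp add: L2_def)
qed

text \<open>The flow is jointly measurable for the Lebesgue \<sigma>-algebra, so Fubini and
  translation invariance have to be available for \<open>lebesgue\<close> and not just for
  \<open>lborel\<close>.\<close>

lemma sigma_finite_lebesgue: "sigma_finite_measure (lebesgue :: 'a::euclidean_space measure)"
proof
  obtain A :: "'a set set" where A: "countable A" "A \<subseteq> sets lborel" "\<Union>A = space lborel" "\<forall>a\<in>A. emeasure lborel a \<noteq> \<infinity>"
    using lborel.sigma_finite_countable by blast
  then show "\<exists>A::'a set set. countable A \<and> A \<subseteq> sets lebesgue \<and> \<Union>A = space lebesgue \<and> (\<forall>a\<in>A. emeasure lebesgue a \<noteq> \<infinity>)"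
    by (intro exI[of _ A]) (auto simp: subset_iff)
qed

lemma lebesgue_translation: "distr lebesgue lebesgue ((+) a) = (lebesgue :: 'a::euclidean_space measure)"
  and measurable_lebesgue_translation: "(+) a \<in> (lebesgue :: 'a::euclidean_space measure) \<rightarrow>\<^sub>M lebesgue"
proof -
  have eq: "(\<lambda>x. a + (\<Sum>j\<in>Basis. (1 * (x \<bullet> j)) *\<^sub>R j)) = (+) a"
    by (auto simp: euclidean_representation)
  show "distr lebesgue lebesgue ((+) a) = (lebesgue :: 'a measure)"
    using lebesgue_affine_euclidean[of "\<lambda>_. 1" a] unfolding eq by (simp add: density_1)
  show "(+) a \<in> (lebesgue :: 'a measure) \<rightarrow>\<^sub>M lebesgue"
    using lebesgue_affine_measurable[of "\<lambda>_. 1" a] unfolding eq by simp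
qed

lemma measurable_lebesgue_uminus: "uminus \<in> (lebesgue :: 'a::euclidean_space measure) \<rightarrow>\<^sub>M lebesgue"
proof -
  have eq: "(\<lambda>x::'a. 0 + (\<Sum>j\<in>Basis. (- 1 * (x \<bullet> j)) *\<^sub>R j)) = uminus"
    by (auto simp: euclidean_representation sum_negf)
  show ?thesis using lebesgue_affine_measurable[of "\<lambda>_. -1" "0::'a"] unfolding eq by simp
qed

section \<open>The measure preserving flow, its generators, and scaling in the spaces built on
  them\<close>

locale stationary_flow = prob_space M for M :: "'w measure" +
  fixes T :: "real^'n \<Rightarrow> 'w \<Rightarrow> 'w" and F :: "'w set"
  assumes ergodic: "ergodic_system M T" and F[measurable]: "F \<in> sets M"
begin

lemma T_measurable[measurable]: "T x \<in> M \<rightarrow>\<^sub>M M"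
  using ergodic unfolding ergodic_system_def by blast

lemma T_space: "\<omega> \<in> space M \<Longrightarrow> T x \<omega> \<in> space M"
  using T_measurable[of x] by (rule measurable_space)

lemma T_zero: "\<omega> \<in> space M \<Longrightarrow> T 0 \<omega> = \<omega>"
  using ergodic unfolding ergodic_system_def by blast

lemma T_add: "\<omega> \<in> space M \<Longrightarrow> T x (T y \<omega>) = T (x + y) \<omega>"
  using ergodic unfolding ergodic_system_def by simp

lemma distr_T: "distr M M (T x) = M"
proof (rule measure_eqI)
  fix A assume "A \<in> sets (distr M M (T x))"
  then show "emeasure (distr M M (T x)) A = emeasure M A"
    using ergodic unfolding ergodic_system_def by (simp add: emeasure_distr)
qed simp

lemma integral_T:
  fixes f :: "'w \<Rightarrow> 'b::euclidean_space"
  assumes "f \<in> borel_measurable M"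
  shows "(LINT \<omega>|M. f (T x \<omega>)) = (LINT \<omega>|M. f \<omega>)"
  using integral_distr[OF T_measurable[of x] assms] distr_T by simp

lemma integrable_T:
  fixes f :: "'w \<Rightarrow> 'b::euclidean_space"
  assumes "integrable M f"
  shows "integrable M (\<lambda>\<omega>. f (T x \<omega>))"
  using integrable_distr[OF T_measurable[of x], of f] assms distr_T by simp

lemma L2_T: "f \<in> L2 M \<Longrightarrow> (\<lambda>\<omega>. f (T x \<omega>)) \<in> L2 M"
  using integrable_T[of "\<lambda>\<omega>. (norm (f \<omega>))\<^sup>2" x] by (auto simp: L2_def)

lemma T_joint[measurable]: "(\<lambda>(x, \<omega>). T x \<omega>) \<in> lebesgue \<Otimes>\<^sub>M M \<rightarrow>\<^sub>M M"
proof (rule measurableI)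
  show "(case p of (x, \<omega>) \<Rightarrow> T x \<omega>) \<in> space M" if "p \<in> space (lebesgue \<Otimes>\<^sub>M M)" for p
    using that by (auto simp: space_pair_measure T_space)
  fix E assume "E \<in> sets M"
  then have "{(x, \<omega>). \<omega> \<in> space M \<and> T x \<omega> \<in> E} \<in> sets (lebesgue \<Otimes>\<^sub>M M)"
    using ergodic unfolding ergodic_system_def by blast
  moreover have "{(x, \<omega>). \<omega> \<in> space M \<and> T x \<omega> \<in> E} = (\<lambda>(x, \<omega>). T x \<omega>) -` E \<inter> space (lebesgue \<Otimes>\<^sub>M M)"
    by (auto simp: space_pair_measure)
  ultimately show "(\<lambda>(x, \<omega>). T x \<omega>) -` E \<inter> space (lebesgue \<Otimes>\<^sub>M M) \<in> sets (lebesgue \<Otimes>\<^sub>M M)" by simp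
qed

lemma T_neg_joint: "(\<lambda>(x, \<omega>). T (- x) \<omega>) \<in> lebesgue \<Otimes>\<^sub>M M \<rightarrow>\<^sub>M M"
proof -
  have "(\<lambda>p. (- fst p, snd p)) \<in> lebesgue \<Otimes>\<^sub>M M \<rightarrow>\<^sub>M (lebesgue \<Otimes>\<^sub>M M :: ((real^'n) \<times> 'w) measure)"
    by (intro measurable_Pair measurable_compose[OF measurable_fst measurable_lebesgue_uminus] measurable_snd)
  from measurable_compose[OF this T_joint] show ?thesis by (simp add: case_prod_beta')
qed

lemma T_neg_measurable_fst: "\<omega> \<in> space M \<Longrightarrow> (\<lambda>x. T (- x) \<omega>) \<in> lebesgue \<rightarrow>\<^sub>M M"
  using measurable_compose[OF measurable_Pair2' T_neg_joint] by simp

lemma is_generator_unique: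
  assumes "is_generator M T j f g" "is_generator M T j f g'"
  shows "AE \<omega> in M. g \<omega> = g' \<omega>"
proof (rule L2_limit_unique)
  have f: "f \<in> L2 M" using assms unfolding is_generator_def by auto
  show "(\<lambda>\<omega>. (f (T (t *\<^sub>R axis j 1) \<omega>) - f \<omega>) / t) \<in> L2 M" for t
    using L2_scaleR[OF L2_diff[OF L2_T[OF f, of "t *\<^sub>R axis j 1"] f], of "1 / t"] by simp
qed (use assms in \<open>auto simp: is_generator_def\<close>)

text \<open>The constant \<open>a\<close> is included because the velocity fields constructed later
  are a unit vector minus a curl.\<close>

lemma is_generator_affine:
  assumes "is_generator M T j f g"
  shows "is_generator M T j (\<lambda>\<omega>. a + c * f \<omega>) (\<lambda>\<omega>. c * g \<omega>)"
proof -
  have f: "f \<in> L2 M" and g: "g \<in> L2 M"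
    using assms unfolding is_generator_def by auto
  have const: "(\<lambda>\<omega>. a) \<in> L2 M" by (simp add: L2_def)
  have "((\<lambda>t. c\<^sup>2 * (LINT \<omega>|M. ((f (T (t *\<^sub>R axis j 1) \<omega>) - f \<omega>) / t - g \<omega>)\<^sup>2)) \<longlongrightarrow> c\<^sup>2 * 0) (at 0)"
    using assms unfolding is_generator_def by (intro tendsto_intros) auto
  moreover have "c\<^sup>2 * (LINT \<omega>|M. ((f (T (t *\<^sub>R axis j 1) \<omega>) - f \<omega>) / t - g \<omega>)\<^sup>2) =
    (LINT \<omega>|M. ((a + c * f (T (t *\<^sub>R axis j 1) \<omega>) - (a + c * f \<omega>)) / t - c * g \<omega>)\<^sup>2)" for t
    by (subst integral_mult_right_zero[symmetric], rule Bochner_Integration.integral_cong)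
       (auto simp: power_mult_distrib[symmetric] algebra_simps diff_divide_distrib)
  ultimately show ?thesis
    using L2_add[OF const L2_scaleR[OF f, of c]] L2_scaleR[OF g, of c] unfolding is_generator_def by simp
qed

lemma gen_is_generator: "is_generator M T j f g \<Longrightarrow> is_generator M T j f (gen M T j f)"
  unfolding gen_def by (rule someI[of "is_generator M T j f"])

lemma gen_eq: "is_generator M T j f g \<Longrightarrow> AE \<omega> in M. gen M T j f \<omega> = g \<omega>"
  by (rule is_generator_unique[OF gen_is_generator])

lemma stoch_D_gen: "f \<in> stoch_D M T \<Longrightarrow> is_generator M T j f (gen M T j f)"
  unfolding stoch_D_def by (auto intro: gen_is_generator)

lemma gen_affine:
  assumes "f \<in> stoch_D M T"
  shows "(\<lambda>\<omega>. a + c * f \<omega>) \<in> stoch_D M T" and "AE \<omega> in M. gen M T j (\<lambda>\<omega>. a + c * f \<omega>) \<omega> = c * gen M T j f \<omega>"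
proof -
  have *: "is_generator M T j (\<lambda>\<omega>. a + c * f \<omega>) (\<lambda>\<omega>. c * gen M T j f \<omega>)" for j
    by (rule is_generator_affine[OF stoch_D_gen[OF assms]])
  show "(\<lambda>\<omega>. a + c * f \<omega>) \<in> stoch_D M T"
    using * unfolding stoch_D_def by (blast dest: is_generator_def[THEN iffD1])
  show "AE \<omega> in M. gen M T j (\<lambda>\<omega>. a + c * f \<omega>) \<omega> = c * gen M T j f \<omega>"
    by (rule gen_eq[OF *])
qed

lemma stoch_D_vec_L2:
  assumes "z \<in> stoch_D_vec M T"
  shows "z \<in> L2 M" "stoch_jac M T z \<in> L2 M"
proof -
  have "(\<lambda>\<omega>. z \<omega> $ i) \<in> L2 M" for i
    using assms unfolding stoch_D_vec_def stoch_D_def by auto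
  from L2_vec_lambda[of "\<lambda>i \<omega>. z \<omega> $ i", OF this] show "z \<in> L2 M" by simp
  have "gen M T j (\<lambda>\<omega>. z \<omega> $ i) \<in> L2 M" for i j
    using stoch_D_gen assms unfolding stoch_D_vec_def is_generator_def by blast
  then show "stoch_jac M T z \<in> L2 M"
    unfolding stoch_jac_def by (intro L2_vec_lambda) auto
qed

lemma stoch_jac_scale:
  assumes "z \<in> stoch_D_vec M T"
  shows "(\<lambda>\<omega>. c *\<^sub>R z \<omega>) \<in> stoch_D_vec M T"
    and "AE \<omega> in M. stoch_jac M T (\<lambda>\<omega>. c *\<^sub>R z \<omega>) \<omega> = c *\<^sub>R stoch_jac M T z \<omega>"
proof -
  have zi: "(\<lambda>\<omega>. z \<omega> $ i) \<in> stoch_D M T" for i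
    using assms unfolding stoch_D_vec_def by auto
  show "(\<lambda>\<omega>. c *\<^sub>R z \<omega>) \<in> stoch_D_vec M T"
    using gen_affine(1)[OF zi, of 0 c] unfolding stoch_D_vec_def by simp
  have "AE \<omega> in M. \<forall>i\<in>UNIV. \<forall>j\<in>UNIV. gen M T j (\<lambda>\<omega>. c * z \<omega> $ i) \<omega> = c * gen M T j (\<lambda>\<omega>. z \<omega> $ i) \<omega>"
    using gen_affine(2)[OF zi, of _ 0 c] by (intro AE_finite_allI) auto
  then show "AE \<omega> in M. stoch_jac M T (\<lambda>\<omega>. c *\<^sub>R z \<omega>) \<omega> = c *\<^sub>R stoch_jac M T z \<omega>"
    by eventually_elim (auto simp: stoch_jac_def vec_eq_iff)
qed

lemma stoch_div_jac: "stoch_div M T z \<omega> = (\<Sum>i\<in>UNIV. stoch_jac M T z \<omega> $ i $ i)"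
  by (simp add: stoch_div_def stoch_jac_def)

lemma graph_norm_sq_scale:
  assumes "z \<in> stoch_D_vec M T"
  shows "graph_norm_sq M T (\<lambda>\<omega>. c *\<^sub>R z \<omega>) = c\<^sup>2 * graph_norm_sq M T z"
proof -
  have "(LINT \<omega>|M. (norm (stoch_jac M T (\<lambda>\<omega>. c *\<^sub>R z \<omega>) \<omega>))\<^sup>2) = (LINT \<omega>|M. c\<^sup>2 * (norm (stoch_jac M T z \<omega>))\<^sup>2)"
    using stoch_D_vec_L2(2)[THEN L2_measurable, OF stoch_jac_scale(1)[OF assms, of c]] stoch_D_vec_L2(2)[THEN L2_measurable, OF assms]
    by (intro integral_cong_AE eventually_mono[OF stoch_jac_scale(2)[OF assms, of c]])
       (auto simp: power_mult_distrib)
  then show ?thesis by (simp add: graph_norm_sq_def power_mult_distrib algebra_simps)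
qed

lemma W_space_scale:
  assumes "z \<in> W_space M T F"
  shows "(\<lambda>\<omega>. c *\<^sub>R z \<omega>) \<in> W_space M T F"
proof -
  have z: "z \<in> stoch_D_vec M T" "AE \<omega> in M. \<omega> \<in> F \<longrightarrow> stoch_div M T z \<omega> = 0"
    "AE \<omega> in M. \<omega> \<in> space M - F \<longrightarrow> z \<omega> = 0"
    using assms unfolding W_space_def by auto
  have "AE \<omega> in M. \<omega> \<in> F \<longrightarrow> stoch_div M T (\<lambda>\<omega>. c *\<^sub>R z \<omega>) \<omega> = 0"
    using z(2) stoch_jac_scale(2)[OF z(1), of c]
    by eventually_elim (auto simp: stoch_div_jac sum_distrib_left[symmetric])
  moreover have "AE \<omega> in M. \<omega> \<in> space M - F \<longrightarrow> c *\<^sub>R z \<omega> = 0"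
    using z(3) by eventually_elim auto
  ultimately show ?thesis using stoch_jac_scale(1)[OF z(1), of c] unfolding W_space_def by auto
qed

lemma V_pot_scale:
  assumes "f \<in> V_pot M T"
  shows "(\<lambda>\<omega>. c *\<^sub>R f \<omega>) \<in> V_pot M T"
proof -
  have "potential_field g \<Longrightarrow> potential_field (\<lambda>x. c *\<^sub>R g x)" for g :: "real^'n \<Rightarrow> real^'n"
    unfolding potential_field_def using has_weak_grad_scale by blast
  moreover have "AE \<omega> in M. potential_field (\<lambda>x. f (T x \<omega>))" using assms unfolding V_pot_def by auto
  ultimately have "AE \<omega> in M. potential_field (\<lambda>x. c *\<^sub>R f (T x \<omega>))" by (auto elim: eventually_mono)
  then show ?thesis using assms L2_scaleR[of f M c] unfolding V_pot_def by auto
qed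

lemma X_space_scale:
  assumes \<theta>: "\<theta> \<in> X_space M T F"
  shows "(\<lambda>\<omega>. c *\<^sub>R \<theta> \<omega>) \<in> X_space M T F"
proof -
  have "\<exists>f\<in>V_pot M T. (LINT \<omega>|restrict_space M F. (norm (c *\<^sub>R \<theta> \<omega> - f \<omega>))\<^sup>2) < e" if e: "0 < e" for e
  proof -
    \<comment> \<open>Adding 1 keeps the denominator positive when \<open>c = 0\<close>.\<close>
    have "0 < e / (c\<^sup>2 + 1)" using e by (intro divide_pos_pos) (auto intro: add_nonneg_pos)
    then obtain f where f: "f \<in> V_pot M T" "(LINT \<omega>|restrict_space M F. (norm (\<theta> \<omega> - f \<omega>))\<^sup>2) < e / (c\<^sup>2 + 1)"
      using \<theta> unfolding X_space_def by blast
    define I where "I = (LINT \<omega>|restrict_space M F. (norm (\<theta> \<omega> - f \<omega>))\<^sup>2)"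
    have "(LINT \<omega>|restrict_space M F. (norm (c *\<^sub>R \<theta> \<omega> - c *\<^sub>R f \<omega>))\<^sup>2) = c\<^sup>2 * I"
      by (simp add: I_def scaleR_diff_right[symmetric] power_mult_distrib del: scaleR_diff_right)
    also have "\<dots> \<le> (c\<^sup>2 + 1) * I"
      by (intro mult_right_mono) (auto simp: I_def)
    also have "\<dots> < e" using f(2) unfolding I_def[symmetric]
      by (subst (asm) less_divide_eq) (simp add: add_nonneg_pos mult.commute)
    finally show ?thesis using V_pot_scale[OF f(1), of c] by (intro bexI[where x = "\<lambda>\<omega>. c *\<^sub>R f \<omega>"])
  qed
  then show ?thesis using \<theta> L2_scaleR[of \<theta> _ c] unfolding X_space_def by auto
qed

end

section \<open>Mollification along the flow\<close>

text \<open>Uniform continuity of the derivative on a compact ball. For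
  \<open>\<bar>t\<bar> < 1\<close> the quotient is supported in a ball of radius
  \<open>R + 1\<close>, so the uniform bound is also integrable.\<close>

lemma difference_quotient_uniform:
  fixes \<rho> \<rho>' :: "real^'n \<Rightarrow> real"
  assumes cont: "continuous_on UNIV \<rho>'"
    and der: "\<And>x. ((\<lambda>t. \<rho> (x + t *\<^sub>R axis j 1)) has_real_derivative \<rho>' x) (at 0)"
    and supp: "\<And>x. x \<notin> cball 0 R \<Longrightarrow> \<rho> x = 0" "\<And>x. x \<notin> cball 0 R \<Longrightarrow> \<rho>' x = 0"
    and e: "0 < e"
  shows "\<exists>d>0. \<forall>t y. 0 < \<bar>t\<bar> \<and> \<bar>t\<bar> < d \<longrightarrow>
    \<bar>(\<rho> (y + t *\<^sub>R axis j 1) - \<rho> y) / t - \<rho>' y\<bar> \<le> e * indicator (cball 0 (R + 1)) y"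
proof -
  \<comment> \<open>Points of the ball of radius \<open>R + 1\<close> are moved by less than 1 along
    the axis, which the radius \<open>R + 2\<close> accommodates.\<close>
  have "uniformly_continuous_on (cball 0 (R + 2)) \<rho>'"
    using cont by (intro compact_uniformly_continuous continuous_on_subset[OF cont]) auto
  then obtain d where d: "0 < d" "\<And>y y'. y \<in> cball 0 (R + 2) \<Longrightarrow> y' \<in> cball 0 (R + 2) \<Longrightarrow> dist y' y < d \<Longrightarrow> dist (\<rho>' y') (\<rho>' y) < e"
    using e unfolding uniformly_continuous_on_def by metis
  have "\<bar>(\<rho> (y + t *\<^sub>R axis j 1) - \<rho> y) / t - \<rho>' y\<bar> \<le> e * indicator (cball 0 (R + 1)) y"
    if t: "0 < \<bar>t\<bar>" "\<bar>t\<bar> < min d 1" for t y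
  proof (cases "y \<in> cball 0 (R + 1)")
    case False
    have "norm y \<le> norm (y + t *\<^sub>R axis j 1) + norm (t *\<^sub>R axis j (1::real))"
      using norm_triangle_ineq4[of "y + t *\<^sub>R axis j 1" "t *\<^sub>R axis j 1"] by simp
    then have "y + t *\<^sub>R axis j 1 \<notin> cball 0 R" using False t by auto
    then show ?thesis using supp[of y] supp[of "y + t *\<^sub>R axis j 1"] False by auto
  next
    case True
    define g where "g s = \<rho> (y + s *\<^sub>R axis j 1) - s * \<rho>' y" for s
    have gder: "(g has_real_derivative \<rho>' (y + s *\<^sub>R axis j 1) - \<rho>' y) (at s)" for s
      unfolding g_def by (auto intro!: derivative_eq_intros DERIV_line der)
    have "norm (g t - g 0) \<le> e * norm (t - 0)"
    proof (rule field_differentiable_bound[where S = "cball 0 \<bar>t\<bar>" and f' = "\<lambda>s. \<rho>' (y + s *\<^sub>R axis j 1) - \<rho>' y"])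
      show "norm (\<rho>' (y + s *\<^sub>R axis j 1) - \<rho>' y) \<le> e" if s: "s \<in> cball 0 \<bar>t\<bar>" for s
      proof -
        have "norm (y + s *\<^sub>R axis j 1) \<le> norm y + norm (s *\<^sub>R axis j (1::real))"
          by (rule norm_triangle_ineq)
        then have "y + s *\<^sub>R axis j 1 \<in> cball 0 (R + 2)" "y \<in> cball 0 (R + 2)"
          using s t True by auto
        then show ?thesis using d(2)[of y "y + s *\<^sub>R axis j 1"] s t by (auto simp: dist_norm)
      qed
    qed (use gder in \<open>auto intro: has_field_derivative_at_within\<close>)
    then have "\<bar>\<rho> (y + t *\<^sub>R axis j 1) - \<rho> y - t * \<rho>' y\<bar> \<le> e * \<bar>t\<bar>" by (simp add: g_def)
    moreover have "(\<rho> (y + t *\<^sub>R axis j 1) - \<rho> y) / t - \<rho>' y = (\<rho> (y + t *\<^sub>R axis j 1) - \<rho> y - t * \<rho>' y) / t"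
      using t by (simp add: field_simps)
    ultimately show ?thesis using True t by (simp add: abs_divide divide_le_eq)
  qed
  then show ?thesis using d(1) by (intro exI[of _ "min d 1"]) auto
qed

lemma integrable_compact_support:
  fixes \<rho> :: "real^'n \<Rightarrow> real"
  assumes "continuous_on UNIV \<rho>" "\<And>x. x \<notin> cball 0 R \<Longrightarrow> \<rho> x = 0"
  shows "integrable lebesgue \<rho>"
proof -
  obtain a where a: "cball 0 R \<subseteq> cbox (- a) (a::real^'n)"
    using bounded_subset_cbox_symmetric[OF bounded_cball] by blast
  have "set_integrable lebesgue (cbox (- a) a) \<rho>"
    by (rule absolutely_integrable_continuous) (rule continuous_on_subset[OF assms(1) subset_UNIV])
  moreover have "(\<lambda>x. indicat_real (cbox (- a) a) x *\<^sub>R \<rho> x) = \<rho>"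
  proof
    fix x show "indicat_real (cbox (- a) a) x *\<^sub>R \<rho> x = \<rho> x"
      using assms(2)[of x] subsetD[OF a, of x] by (cases "x \<in> cbox (- a) a") auto
  qed
  ultimately show ?thesis by (simp add: set_integrable_def)
qed

context stationary_flow
begin

text \<open>Convolution of the realization \<open>\<lambda>x. h (T x \<omega>)\<close> with \<rho>,
  evaluated at the origin. The sign in \<open>T (- y)\<close> turns a shift of \<omega> into a shift
  of \<rho>, so that derivatives along the flow fall on the smooth kernel.\<close>

definition conv :: "(real^'n \<Rightarrow> real) \<Rightarrow> ('w \<Rightarrow> real) \<Rightarrow> 'w \<Rightarrow> real" where
  "conv \<rho> h \<omega> = (LINT y|lebesgue. \<rho> y * h (T (- y) \<omega>))"

lemma conv_kernel_integrable:
  fixes h :: "'w \<Rightarrow> real"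
  assumes \<rho>: "integrable lebesgue \<rho>" and h: "h \<in> borel_measurable M" "\<And>\<omega>. \<bar>h \<omega>\<bar> \<le> K" and \<omega>: "\<omega> \<in> space M"
  shows "integrable lebesgue (\<lambda>y. \<rho> y * h (T (- y) \<omega>))"
proof (rule Bochner_Integration.integrable_bound)
  show "integrable lebesgue (\<lambda>y. K * \<rho> y)" using \<rho> by simp
  show "(\<lambda>y. \<rho> y * h (T (- y) \<omega>)) \<in> borel_measurable lebesgue"
    using \<rho> measurable_compose[OF T_neg_measurable_fst[OF \<omega>] h(1)]
    by (intro borel_measurable_times) auto
  show "AE y in lebesgue. norm (\<rho> y * h (T (- y) \<omega>)) \<le> norm (K * \<rho> y)"
    using mult_right_mono[OF order_trans[OF h(2) abs_ge_self] abs_ge_zero]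
    by (intro AE_I2) (simp add: abs_mult mult.commute[of "\<bar>\<rho> _\<bar>"])
qed

lemma conv_T:
  assumes \<rho>: "integrable lebesgue \<rho>" and h: "h \<in> borel_measurable M" and \<omega>: "\<omega> \<in> space M"
  shows "conv \<rho> h (T x \<omega>) = (LINT y|lebesgue. \<rho> (y + x) * h (T (- y) \<omega>))"
proof -
  have "conv \<rho> h (T x \<omega>) = (LINT y|distr lebesgue lebesgue ((+) x). \<rho> y * h (T (- y) (T x \<omega>)))"
    unfolding conv_def lebesgue_translation ..
  also have "\<dots> = (LINT y|lebesgue. \<rho> (x + y) * h (T (- (x + y)) (T x \<omega>)))"
    by (rule integral_distr[OF measurable_lebesgue_translation])
       (use \<rho> measurable_compose[OF T_neg_measurable_fst[OF T_space[OF \<omega>]] h] in \<open>auto intro!: borel_measurable_times\<close>)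
  finally show ?thesis using \<omega> by (simp add: T_add add.commute)
qed

lemma conv_measurable:
  assumes \<rho>: "integrable lebesgue \<rho>" and h: "h \<in> borel_measurable M"
  shows "conv \<rho> h \<in> borel_measurable M"
proof -
  have "(\<lambda>p. (snd p, fst p)) \<in> M \<Otimes>\<^sub>M lebesgue \<rightarrow>\<^sub>M (lebesgue \<Otimes>\<^sub>M M :: ((real^'n) \<times> 'w) measure)"
    by (intro measurable_Pair measurable_fst measurable_snd)
  from measurable_compose[OF measurable_compose[OF this T_neg_joint] h]
  have "(\<lambda>p. h (T (- snd p) (fst p))) \<in> borel_measurable (M \<Otimes>\<^sub>M lebesgue)" by simp
  then have "(\<lambda>(\<omega>, y). \<rho> y * h (T (- y) \<omega>)) \<in> borel_measurable (M \<Otimes>\<^sub>M lebesgue)"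
    using measurable_compose[OF measurable_snd borel_measurable_integrable[OF \<rho>], of M]
    unfolding case_prod_beta' by (intro borel_measurable_times)
  from sigma_finite_measure.borel_measurable_lebesgue_integral[OF sigma_finite_lebesgue this]
  show ?thesis unfolding conv_def .
qed

lemma conv_bounded:
  assumes \<rho>: "integrable lebesgue \<rho>" and h: "h \<in> borel_measurable M" "\<And>\<omega>. \<bar>h \<omega>\<bar> \<le> K" and \<omega>: "\<omega> \<in> space M"
  shows "\<bar>conv \<rho> h \<omega>\<bar> \<le> K * (LINT y|lebesgue. \<bar>\<rho> y\<bar>)"
proof -
  have "\<bar>conv \<rho> h \<omega>\<bar> \<le> (LINT y|lebesgue. \<bar>\<rho> y * h (T (- y) \<omega>)\<bar>)"
    unfolding conv_def by (rule integral_abs_bound)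
  also have "\<dots> \<le> (LINT y|lebesgue. K * \<bar>\<rho> y\<bar>)"
  proof (rule integral_mono)
    show "\<bar>\<rho> y * h (T (- y) \<omega>)\<bar> \<le> K * \<bar>\<rho> y\<bar>" for y
      using mult_left_mono[OF h(2) abs_ge_zero[of "\<rho> y"]] by (simp add: abs_mult mult.commute)
  qed (use \<rho> conv_kernel_integrable[OF assms] in auto)
  finally show ?thesis by simp
qed

lemma conv_L2:
  assumes \<rho>: "integrable lebesgue \<rho>" and h: "h \<in> borel_measurable M" "\<And>\<omega>. \<bar>h \<omega>\<bar> \<le> K"
  shows "conv \<rho> h \<in> L2 M"
proof (rule L2_bound[of "\<lambda>\<omega>. 1::real"])
  show "AE \<omega> in M. norm (conv \<rho> h \<omega>) \<le> (K * (LINT y|lebesgue. \<bar>\<rho> y\<bar>)) * norm (1::real)"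
    using conv_bounded[OF assms] by (intro AE_I2) auto
qed (use conv_measurable[OF assms(1,2)] in \<open>auto simp: L2_def\<close>)

text \<open>Boundedness of \<open>h\<close> makes the convergence uniform in \<omega>. It is used
  twice: averaged, for the generator in \<open>L2 M\<close>, and pointwise, for the value of the
  derivative on the inclusions.\<close>

lemma conv_difference_quotient:
  assumes cont: "continuous_on UNIV \<rho>" "continuous_on UNIV \<rho>'"
    and der: "\<And>x. ((\<lambda>t. \<rho> (x + t *\<^sub>R axis j 1)) has_real_derivative \<rho>' x) (at 0)"
    and supp: "\<And>x. x \<notin> cball 0 R \<Longrightarrow> \<rho> x = 0" "\<And>x. x \<notin> cball 0 R \<Longrightarrow> \<rho>' x = 0"
    and h: "h \<in> borel_measurable M" "\<And>\<omega>. \<bar>h \<omega>\<bar> \<le> K" and e: "0 < e"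
  shows "\<exists>d>0. \<forall>t. 0 < \<bar>t\<bar> \<and> \<bar>t\<bar> < d \<longrightarrow> (\<forall>\<omega>\<in>space M.
    \<bar>(conv \<rho> h (T (t *\<^sub>R axis j 1) \<omega>) - conv \<rho> h \<omega>) / t - conv \<rho>' h \<omega>\<bar> \<le> e)"
proof -
  have i: "integrable lebesgue \<rho>" "integrable lebesgue \<rho>'"
    using integrable_compact_support[OF cont(1) supp(1)] integrable_compact_support[OF cont(2) supp(2)] by auto
  define V where "V = measure lebesgue (cball (0::real^'n) (R + 1))"
  have K: "0 \<le> K" using h(2) abs_ge_zero order_trans by blast
  \<comment> \<open>The final estimate is \<open>e' * K * V\<close>; the added 1 covers the case
    \<open>K * V = 0\<close>.\<close>
  define e' where "e' = e / (K * V + 1)"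
  have pos: "0 < K * V + 1" using K by (auto simp: V_def intro!: add_nonneg_pos)
  then have e': "0 < e'" using e by (simp add: e'_def)
  obtain d where d: "0 < d" "\<And>t y. 0 < \<bar>t\<bar> \<Longrightarrow> \<bar>t\<bar> < d \<Longrightarrow>
    \<bar>(\<rho> (y + t *\<^sub>R axis j 1) - \<rho> y) / t - \<rho>' y\<bar> \<le> e' * indicator (cball 0 (R + 1)) y"
    using difference_quotient_uniform[OF cont(2) der supp e'] by metis
  have "\<bar>(conv \<rho> h (T (t *\<^sub>R axis j 1) \<omega>) - conv \<rho> h \<omega>) / t - conv \<rho>' h \<omega>\<bar> \<le> e"
    if t: "0 < \<bar>t\<bar>" "\<bar>t\<bar> < d" and \<omega>: "\<omega> \<in> space M" for t \<omega>
  proof -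
    define a where "a = t *\<^sub>R axis j (1::real)"
    have it: "integrable lebesgue (\<lambda>y. \<rho> (y + a))"
    proof -
      have "integrable (distr lebesgue lebesgue ((+) a)) \<rho>" unfolding lebesgue_translation by (rule i)
      from integrable_distr[OF measurable_lebesgue_translation this] show ?thesis by (simp add: add.commute)
    qed
    note I = conv_kernel_integrable[OF it h \<omega>] conv_kernel_integrable[OF i(1) h \<omega>] conv_kernel_integrable[OF i(2) h \<omega>]
    have "(conv \<rho> h (T a \<omega>) - conv \<rho> h \<omega>) / t - conv \<rho>' h \<omega> =
      (LINT y|lebesgue. (\<rho> (y + a) * h (T (- y) \<omega>) - \<rho> y * h (T (- y) \<omega>)) / t - \<rho>' y * h (T (- y) \<omega>))"
      unfolding conv_T[OF i(1) h(1) \<omega>] unfolding conv_def using I by simp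
    also have "\<dots> = (LINT y|lebesgue. ((\<rho> (y + a) - \<rho> y) / t - \<rho>' y) * h (T (- y) \<omega>))" (is "_ = integral\<^sup>L _ ?g")
      by (intro Bochner_Integration.integral_cong) (auto simp: algebra_simps diff_divide_distrib)
    finally have eq: "(conv \<rho> h (T a \<omega>) - conv \<rho> h \<omega>) / t - conv \<rho>' h \<omega> = integral\<^sup>L lebesgue ?g" .
    have "integrable lebesgue (\<lambda>y. (\<rho> (y + a) * h (T (- y) \<omega>) - \<rho> y * h (T (- y) \<omega>)) / t - \<rho>' y * h (T (- y) \<omega>))"
      using I by simp
    then have ig: "integrable lebesgue ?g"
      by (simp add: algebra_simps diff_divide_distrib)
    have "\<bar>integral\<^sup>L lebesgue ?g\<bar> \<le> (LINT y|lebesgue. \<bar>?g y\<bar>)"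
      by (rule integral_abs_bound)
    also have "\<dots> \<le> (LINT y|lebesgue. (e' * K) * indicator (cball (0::real^'n) (R + 1)) y)"
    proof (rule integral_mono)
      show "integrable lebesgue (\<lambda>y. (e' * K) * indicator (cball (0::real^'n) (R + 1)) y)"
        using emeasure_bounded_finite[of "cball (0::real^'n) (R + 1)"]
        by (intro integrable_mult_right integrable_real_indicator) auto
      show "\<bar>?g y\<bar> \<le> (e' * K) * indicator (cball 0 (R + 1)) y" for y
        using mult_mono[OF d(2)[OF t, of y] h(2)[of "T (- y) \<omega>"]] e' unfolding a_def
        by (simp add: abs_mult mult.assoc mult.commute mult.left_commute)
    qed (use ig in auto)
    also have "\<dots> = e' * K * V" by (simp add: V_def)
    also have "\<dots> \<le> e" using e pos by (simp add: e'_def field_simps)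
    finally show ?thesis unfolding eq[unfolded a_def] a_def .
  qed
  then show ?thesis using d(1) by blast
qed

lemma conv_is_generator:
  assumes cont: "continuous_on UNIV \<rho>" "continuous_on UNIV \<rho>'"
    and der: "\<And>x. ((\<lambda>t. \<rho> (x + t *\<^sub>R axis j 1)) has_real_derivative \<rho>' x) (at 0)"
    and supp: "\<And>x. x \<notin> cball 0 R \<Longrightarrow> \<rho> x = 0" "\<And>x. x \<notin> cball 0 R \<Longrightarrow> \<rho>' x = 0"
    and h: "h \<in> borel_measurable M" "\<And>\<omega>. \<bar>h \<omega>\<bar> \<le> K"
  shows "is_generator M T j (conv \<rho> h) (conv \<rho>' h)"
proof -
  have i: "integrable lebesgue \<rho>" "integrable lebesgue \<rho>'"
    using integrable_compact_support[OF cont(1) supp(1)] integrable_compact_support[OF cont(2) supp(2)] by auto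
  define q where "q t \<omega> = (conv \<rho> h (T (t *\<^sub>R axis j 1) \<omega>) - conv \<rho> h \<omega>) / t - conv \<rho>' h \<omega>" for t \<omega>
  have c: "conv \<rho> h \<in> L2 M" "conv \<rho>' h \<in> L2 M" using conv_L2[OF _ h] i by auto
  have q: "q t \<in> L2 M" for t
    using L2_diff[OF L2_scaleR[OF L2_diff[OF L2_T[OF c(1), of "t *\<^sub>R axis j 1"] c(1)], of "1 / t"] c(2)]
    unfolding q_def[abs_def] by simp
  have "((\<lambda>t. LINT \<omega>|M. (q t \<omega>)\<^sup>2) \<longlongrightarrow> 0) (at 0)"
    unfolding tendsto_iff
  proof (intro allI impI)
    fix e :: real assume e: "0 < e"
    obtain d where d: "0 < d" "\<And>t \<omega>. 0 < \<bar>t\<bar> \<Longrightarrow> \<bar>t\<bar> < d \<Longrightarrow> \<omega> \<in> space M \<Longrightarrow> \<bar>q t \<omega>\<bar> \<le> sqrt (e / 2)"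
      using conv_difference_quotient[OF cont der supp h real_sqrt_gt_zero[OF half_gt_zero[OF e]]] unfolding q_def by blast
    have "(LINT \<omega>|M. (q t \<omega>)\<^sup>2) < e" if t: "t \<noteq> 0" "dist t 0 < d" for t
    proof -
      have "(LINT \<omega>|M. (q t \<omega>)\<^sup>2) \<le> e / 2"
      proof (rule integral_le_const)
        show "integrable M (\<lambda>\<omega>. (q t \<omega>)\<^sup>2)" using q[of t] by (simp add: L2_def)
        show "AE \<omega> in M. (q t \<omega>)\<^sup>2 \<le> e / 2"
        proof (intro AE_I2 sqrt_ge_absD)
          show "\<bar>q t \<omega>\<bar> \<le> sqrt (e / 2)" if "\<omega> \<in> space M" for \<omega>
            using d(2)[of t \<omega>] t that by simp
        qed
      qed
      then show ?thesis using e by simp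
    qed
    then show "\<forall>\<^sub>F t in at 0. dist (LINT \<omega>|M. (q t \<omega>)\<^sup>2) 0 < e"
      unfolding eventually_at using d(1) by (intro exI[of _ d]) (auto simp: dist_norm)
  qed
  then show ?thesis unfolding is_generator_def using c by (simp add: q_def)
qed

text \<open>For \<open>\<bar>t\<bar> < r - R\<close> the shifted kernel sees \<open>h\<close> only
  where it is affine, and the kernel has mass 1. The difference quotient therefore already equals
  its limit, which is thus known at the given \<omega> and not merely almost everywhere.\<close>

lemma conv_derivative_affine:
  assumes cont: "continuous_on UNIV \<rho>" "continuous_on UNIV \<rho>'"
    and der: "\<And>x. ((\<lambda>t. \<rho> (x + t *\<^sub>R axis j 1)) has_real_derivative \<rho>' x) (at 0)"
    and supp: "\<And>x. x \<notin> cball 0 R \<Longrightarrow> \<rho> x = 0" "\<And>x. x \<notin> cball 0 R \<Longrightarrow> \<rho>' x = 0"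
    and one: "(LINT y|lebesgue. \<rho> y) = 1"
    and h: "h \<in> borel_measurable M" "\<And>\<omega>. \<bar>h \<omega>\<bar> \<le> K" and \<omega>: "\<omega> \<in> space M"
    and R: "R < r" and affine: "\<And>x. norm x < r \<Longrightarrow> h (T x \<omega>) = x $ l + c"
  shows "conv \<rho>' h \<omega> = (if l = j then 1 else 0)"
proof -
  have i: "integrable lebesgue \<rho>" "integrable lebesgue \<rho>'"
    using integrable_compact_support[OF cont(1) supp(1)] integrable_compact_support[OF cont(2) supp(2)] by auto
  have quot: "(conv \<rho> h (T (t *\<^sub>R axis j 1) \<omega>) - conv \<rho> h \<omega>) / t = (if l = j then 1 else 0)"
    if t: "0 < \<bar>t\<bar>" "\<bar>t\<bar> < r - R" for t
  proof -
    have "conv \<rho> h (T (t *\<^sub>R axis j 1) \<omega>) - conv \<rho> h \<omega> =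
      (LINT y|lebesgue. \<rho> y * h (T (- y) (T (t *\<^sub>R axis j 1) \<omega>)) - \<rho> y * h (T (- y) \<omega>))"
      unfolding conv_def by (intro Bochner_Integration.integral_diff[symmetric] conv_kernel_integrable[OF i(1) h] \<omega> T_space)
    also have "\<dots> = (LINT y|lebesgue. \<rho> y * (t * (if l = j then 1 else 0)))"
    proof (intro Bochner_Integration.integral_cong refl)
      fix y
      show "\<rho> y * h (T (- y) (T (t *\<^sub>R axis j 1) \<omega>)) - \<rho> y * h (T (- y) \<omega>) = \<rho> y * (t * (if l = j then 1 else 0))"
      proof (cases "y \<in> cball 0 R")
        case True
        have "norm (- y + t *\<^sub>R axis j 1) \<le> norm (- y) + norm (t *\<^sub>R axis j (1::real))"
          by (rule norm_triangle_ineq)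
        then have "norm (- y + t *\<^sub>R axis j 1) < r" "norm (- y) < r"
          using True t R by auto
        then show ?thesis using \<omega> affine by (simp add: T_add axis_def algebra_simps)
      qed (simp add: supp)
    qed
    also have "\<dots> = t * (if l = j then 1 else 0)" using one by simp
    finally show ?thesis using t by simp
  qed
  have "\<bar>(if l = j then 1 else 0) - conv \<rho>' h \<omega>\<bar> \<le> 0 + e" if e: "0 < e" for e
  proof -
    obtain d where d: "0 < d" "\<And>t. 0 < \<bar>t\<bar> \<Longrightarrow> \<bar>t\<bar> < d \<Longrightarrow>
      \<bar>(conv \<rho> h (T (t *\<^sub>R axis j 1) \<omega>) - conv \<rho> h \<omega>) / t - conv \<rho>' h \<omega>\<bar> \<le> e"
      using conv_difference_quotient[OF cont der supp h e] \<omega> by blast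
    define t where "t = min d (r - R) / 2"
    have "0 < \<bar>t\<bar>" "\<bar>t\<bar> < d" "\<bar>t\<bar> < r - R" using d(1) R by (auto simp: t_def)
    then show ?thesis using d(2)[of t] quot[of t] by simp
  qed
  then have "\<bar>(if l = j then 1 else 0) - conv \<rho>' h \<omega>\<bar> \<le> 0" by (rule field_le_epsilon)
  then show ?thesis by simp
qed

text \<open>Stationarity moves the mollifier onto the other factor.\<close>

lemma conv_adjoint:
  fixes f h :: "'w \<Rightarrow> real"
  assumes \<rho>: "integrable lebesgue \<rho>" and h: "h \<in> borel_measurable M" "\<And>\<omega>. \<bar>h \<omega>\<bar> \<le> K"
    and f: "integrable M f"
  shows "integrable M (\<lambda>\<omega>. h \<omega> * (LINT y|lebesgue. \<rho> y * f (T y \<omega>))) \<and> (LINT \<omega>|M. f \<omega> * conv \<rho> h \<omega>) = (LINT \<omega>|M. h \<omega> * (LINT y|lebesgue. \<rho> y * f (T y \<omega>)))"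
proof -
  interpret L: sigma_finite_measure "lebesgue :: (real^'n) measure" by (rule sigma_finite_lebesgue)
  interpret P: pair_sigma_finite "lebesgue :: (real^'n) measure" M ..
  have \<rho>m: "(\<lambda>p. \<rho> (fst p)) \<in> borel_measurable (lebesgue \<Otimes>\<^sub>M M)"
    by (rule measurable_compose[OF measurable_fst borel_measurable_integrable[OF \<rho>]])
  have K: "\<bar>h \<omega>\<bar> \<le> \<bar>K\<bar>" for \<omega> using h(2)[of \<omega>] by simp
  have A: "integrable (lebesgue \<Otimes>\<^sub>M M) (\<lambda>(y, \<omega>). \<rho> y * f \<omega> * h (T (- y) \<omega>))"
  proof (rule Bochner_Integration.integrable_bound)
    show "integrable (lebesgue \<Otimes>\<^sub>M M) (\<lambda>(y, \<omega>). (K * \<rho> y) * f \<omega>)"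
    proof (rule P.Fubini_integrable)
      show "(\<lambda>(y, \<omega>). (K * \<rho> y) * f \<omega>) \<in> borel_measurable (lebesgue \<Otimes>\<^sub>M M)"
        unfolding case_prod_beta' using \<rho>m measurable_compose[OF measurable_snd borel_measurable_integrable[OF f]]
        by (intro borel_measurable_times borel_measurable_const) auto
    qed (use \<rho> f in \<open>auto simp: abs_mult\<close>)
    show "(\<lambda>(y, \<omega>). \<rho> y * f \<omega> * h (T (- y) \<omega>)) \<in> borel_measurable (lebesgue \<Otimes>\<^sub>M M)"
      unfolding case_prod_beta' using \<rho>m measurable_compose[OF measurable_snd borel_measurable_integrable[OF f]]
        measurable_compose[OF T_neg_joint h(1)]
      by (intro borel_measurable_times) (auto simp: case_prod_beta')
    show "AE p in lebesgue \<Otimes>\<^sub>M M. norm (case p of (y, \<omega>) \<Rightarrow> \<rho> y * f \<omega> * h (T (- y) \<omega>)) \<le> norm (case p of (y, \<omega>) \<Rightarrow> (K * \<rho> y) * f \<omega>)"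
      using K by (intro AE_I2) (auto simp: abs_mult mult.assoc mult.left_commute[of "\<bar>K\<bar>"] mult.commute[of "\<bar>K\<bar>"] intro!: mult_left_mono)
  qed
  have B: "integrable (lebesgue \<Otimes>\<^sub>M M) (\<lambda>(y, \<omega>). \<rho> y * f (T y \<omega>) * h \<omega>)"
  proof (rule Bochner_Integration.integrable_bound)
    have fT: "integrable M (\<lambda>\<omega>. \<bar>f (T y \<omega>)\<bar>)" "(LINT \<omega>|M. \<bar>f (T y \<omega>)\<bar>) = (LINT \<omega>|M. \<bar>f \<omega>\<bar>)" for y
      using f by (auto intro!: integrable_T[of "\<lambda>\<omega>. \<bar>f \<omega>\<bar>"] integral_T[of "\<lambda>\<omega>. \<bar>f \<omega>\<bar>"])
    have mT: "(\<lambda>p. f (T (fst p) (snd p))) \<in> borel_measurable (lebesgue \<Otimes>\<^sub>M M)"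
      using measurable_compose[OF T_joint borel_measurable_integrable[OF f]] by (simp add: case_prod_beta')
    show "integrable (lebesgue \<Otimes>\<^sub>M M) (\<lambda>(y, \<omega>). (K * \<rho> y) * f (T y \<omega>))"
    proof (rule P.Fubini_integrable)
      show "(\<lambda>(y, \<omega>). (K * \<rho> y) * f (T y \<omega>)) \<in> borel_measurable (lebesgue \<Otimes>\<^sub>M M)"
        unfolding case_prod_beta' using \<rho>m mT by (intro borel_measurable_times borel_measurable_const) auto
      show "AE y in lebesgue. integrable M (\<lambda>\<omega>. case (y, \<omega>) of (y, \<omega>) \<Rightarrow> (K * \<rho> y) * f (T y \<omega>))"
        using integrable_T[OF f] by simp
    qed (use \<rho> fT in \<open>auto simp: abs_mult\<close>)
    show "(\<lambda>(y, \<omega>). \<rho> y * f (T y \<omega>) * h \<omega>) \<in> borel_measurable (lebesgue \<Otimes>\<^sub>M M)"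
      unfolding case_prod_beta' using \<rho>m mT measurable_compose[OF measurable_snd h(1)]
      by (intro borel_measurable_times) auto
    show "AE p in lebesgue \<Otimes>\<^sub>M M. norm (case p of (y, \<omega>) \<Rightarrow> \<rho> y * f (T y \<omega>) * h \<omega>) \<le> norm (case p of (y, \<omega>) \<Rightarrow> (K * \<rho> y) * f (T y \<omega>))"
      using K by (intro AE_I2) (auto simp: abs_mult mult.assoc mult.left_commute[of "\<bar>K\<bar>"] mult.commute[of "\<bar>K\<bar>"] intro!: mult_left_mono)
  qed
  have swapB: "(\<lambda>\<omega>. LINT y|lebesgue. \<rho> y * f (T y \<omega>) * h \<omega>) = (\<lambda>\<omega>. h \<omega> * (LINT y|lebesgue. \<rho> y * f (T y \<omega>)))"
    by (simp add: mult.commute)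
  have int: "integrable M (\<lambda>\<omega>. h \<omega> * (LINT y|lebesgue. \<rho> y * f (T y \<omega>)))"
    using P.integrable_snd[OF B] by (simp only: swapB)
  have "(LINT \<omega>|M. f \<omega> * conv \<rho> h \<omega>) = (LINT \<omega>|M. LINT y|lebesgue. \<rho> y * f \<omega> * h (T (- y) \<omega>))"
    unfolding conv_def by (subst integral_mult_right_zero[symmetric]) (simp add: algebra_simps)
  also have "\<dots> = (LINT y|lebesgue. LINT \<omega>|M. \<rho> y * f \<omega> * h (T (- y) \<omega>))"
    by (rule P.Fubini_integral[OF A])
  \<comment> \<open>For fixed \<open>y\<close> the measure is invariant under \<open>T y\<close>,
    and \<open>T (- y)\<close> undoes that shift inside \<open>h\<close>.\<close>
  also have "\<dots> = (LINT y|lebesgue. LINT \<omega>|M. \<rho> y * f (T y \<omega>) * h \<omega>)"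
  proof (rule Bochner_Integration.integral_cong[OF refl])
    fix y
    have "(LINT \<omega>|M. \<rho> y * f \<omega> * h (T (- y) \<omega>)) = (LINT \<omega>|M. \<rho> y * f (T y \<omega>) * h (T (- y) (T y \<omega>)))"
      using f h by (intro integral_T[symmetric, of "\<lambda>\<omega>. \<rho> y * f \<omega> * h (T (- y) \<omega>)"]) auto
    also have "\<dots> = (LINT \<omega>|M. \<rho> y * f (T y \<omega>) * h \<omega>)"
      by (intro Bochner_Integration.integral_cong) (auto simp: T_add T_zero)
    finally show "(LINT \<omega>|M. \<rho> y * f \<omega> * h (T (- y) \<omega>)) = (LINT \<omega>|M. \<rho> y * f (T y \<omega>) * h \<omega>)" .
  qed
  also have "\<dots> = (LINT \<omega>|M. LINT y|lebesgue. \<rho> y * f (T y \<omega>) * h \<omega>)"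
    by (rule P.Fubini_integral[OF B, symmetric])
  also have "\<dots> = (LINT \<omega>|M. h \<omega> * (LINT y|lebesgue. \<rho> y * f (T y \<omega>)))"
    unfolding swapB ..
  finally show ?thesis using int by (intro conjI)
qed

end

section \<open>Solenoidal fields around the inclusions\<close>

text \<open>All derivatives are provided at once, because the curl uses first derivatives of the
  kernel and its divergence the second ones.\<close>

lemma mollifier_exists:
  assumes "0 < r"
  obtains D :: "'n list \<Rightarrow> real^'n \<Rightarrow> real" where
    "\<And>\<alpha>. continuous_on UNIV (D \<alpha>)"
    "\<And>\<alpha> i x. ((\<lambda>t. D \<alpha> (x + t *\<^sub>R axis i 1)) has_real_derivative D (i # \<alpha>) x) (at 0)"
    "\<And>\<alpha> x. x \<notin> cball 0 r \<Longrightarrow> D \<alpha> x = 0"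
    "(LINT x|lebesgue. D [] x) = 1"
proof -
  obtain a b where ab: "cbox a b \<subseteq> ball (0::real^'n) r" "0 \<in> box a b"
    by (rule open_contains_cbox[OF open_ball, of 0 0 r]) (use assms that in auto)
  define I where "I = (LINT x|lebesgue. bump 1 a b x)"
  have "bump 1 a b \<in> test_fun (ball 0 r)" by (rule bump_test_fun) (use ab in auto)
  then obtain D :: "'n list \<Rightarrow> real^'n \<Rightarrow> real" and K where D: "D [] = bump 1 a b"
    "\<And>\<alpha>. continuous_on UNIV (D \<alpha>)"
    "\<And>\<alpha> i x. ((\<lambda>t. D \<alpha> (x + t *\<^sub>R axis i 1)) has_real_derivative D (i # \<alpha>) x) (at 0)"
    "K \<subseteq> ball 0 r" "\<And>\<alpha> x. x \<notin> K \<Longrightarrow> D \<alpha> x = 0"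
    by (rule test_funE) (rule that)
  have supp: "D \<alpha> x = 0" if "x \<notin> cball 0 r" for \<alpha> x
    using that D(4) by (intro D(5)) auto
  have int: "integrable lebesgue (bump 1 a b)"
    using integrable_compact_support[OF D(2) supp] unfolding D(1)[symmetric] .
  have "I \<noteq> 0"
  proof
    assume "I = 0"
    then have "AE x in lebesgue. bump 1 a b x = 0"
      unfolding I_def using int by (subst (asm) integral_nonneg_eq_0_iff_AE) (auto intro!: AE_I2 bump_nonneg)
    then have "AE x in lebesgue. x \<notin> box a b"
    proof eventually_elim
      case (elim x)
      moreover have "bump 1 a b x > 0" if "x \<in> box a b"
        using that unfolding bump_def by (intro prod_pos) (auto simp: flat_1 mem_box_cart)
      ultimately show ?case by force
    qed
    then have "negligible (box a b)"
      by (simp add: negligible_iff_null_sets AE_iff_null_sets)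
    then show False using ab(2) by (auto simp: negligible_interval)
  qed
  show thesis
  proof (rule that[of "\<lambda>\<alpha> x. D \<alpha> x * (1 / I)"])
    show "continuous_on UNIV (\<lambda>x. D \<alpha> x * (1 / I))" for \<alpha>
      by (intro continuous_intros D(2))
    show "((\<lambda>t. D \<alpha> (x + t *\<^sub>R axis i 1) * (1 / I)) has_real_derivative D (i # \<alpha>) x * (1 / I)) (at 0)" for \<alpha> i x
      by (rule DERIV_cmult_right[OF D(3)])
    show "D \<alpha> x * (1 / I) = 0" if "x \<notin> cball 0 r" for \<alpha> x
      using supp[OF that] by simp
    show "(LINT x|lebesgue. D [] x * (1 / I)) = 1"
      using \<open>I \<noteq> 0\<close> unfolding D(1) by (simp add: I_def[symmetric])
  qed
qed

context stationary_flow
begin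

text \<open>Difference quotients along the flow have mean zero by invariance, and on a probability
  space the mean is continuous for convergence in \<open>L2 M\<close>.\<close>

lemma integral_generator_zero:
  assumes "is_generator M T j f g"
  shows "(LINT \<omega>|M. g \<omega>) = 0"
proof -
  define q where "q t \<omega> = (f (T (t *\<^sub>R axis j 1) \<omega>) - f \<omega>) / t" for t \<omega>
  have f: "f \<in> L2 M" and g: "g \<in> L2 M"
    using assms unfolding is_generator_def by auto
  have one: "(\<lambda>\<omega>. 1::real) \<in> L2 M" by (simp add: L2_def)
  have q: "q t \<in> L2 M" for t
    using L2_scaleR[OF L2_diff[OF L2_T[OF f, of "t *\<^sub>R axis j 1"] f], of "1 / t"]
    unfolding q_def[abs_def] by simp
  have "(LINT \<omega>|M. q t \<omega>) = 0" for t
    using L2_integrable[OF f] integral_T[OF L2_measurable[OF f]] integrable_T[OF L2_integrable[OF f]]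
    unfolding q_def by simp
  then have "(LINT \<omega>|M. q t \<omega> - g \<omega>) = - (LINT \<omega>|M. g \<omega>)" for t
    using L2_integrable[OF q] L2_integrable[OF g] by simp
  moreover have "(LINT \<omega>|M. q t \<omega> - g \<omega>)\<^sup>2 \<le> (LINT \<omega>|M. (q t \<omega> - g \<omega>)\<^sup>2)" for t
    using L2_Cauchy_Schwarz[OF L2_diff[OF q g] one] prob_space by simp
  ultimately have "(LINT \<omega>|M. g \<omega>)\<^sup>2 \<le> (LINT \<omega>|M. (q t \<omega> - g \<omega>)\<^sup>2)" for t
    by (metis power2_minus)
  then have "(LINT \<omega>|M. g \<omega>)\<^sup>2 \<le> 0"
    using assms unfolding is_generator_def q_def by (intro tendsto_lowerbound) auto
  then show ?thesis by simp
qed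

text \<open>
  With \<open>g\<close> a mollification of \<open>h\<close> the field is \<open>e\<^sub>k - D\<^sub>l g e\<^sub>k + D\<^sub>k g e\<^sub>l\<close>: it is solenoidal because
  \<open>D\<^sub>k\<close> and \<open>D\<^sub>l\<close> commute, and it vanishes on the inclusions because the gradient of \<open>g\<close> is \<open>e\<^sub>l\<close> there.
\<close>

lemma solenoidal_field_exists:
  assumes h: "h \<in> borel_measurable M" "\<And>\<omega>. \<bar>h \<omega>\<bar> \<le> K" and r: "0 < r" and kl: "k \<noteq> l"
    and affine: "AE \<omega> in M. \<omega> \<in> space M - F \<longrightarrow> (\<exists>c. \<forall>x. norm x < r \<longrightarrow> h (T x \<omega>) = x $ l + c)"
  shows "\<exists>w\<in>W_space M T F. (LINT \<omega>|M. w \<omega>) = axis k 1 \<and> (\<forall>f\<in>V_pot M T. (LINT \<omega>|M. w \<omega> \<bullet> f \<omega>) = 0)"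
proof -
  obtain D :: "'n list \<Rightarrow> real^'n \<Rightarrow> real" where
    cont: "\<And>\<alpha>. continuous_on UNIV (D \<alpha>)" and
    der: "\<And>\<alpha> i x. ((\<lambda>t. D \<alpha> (x + t *\<^sub>R axis i 1)) has_real_derivative D (i # \<alpha>) x) (at 0)" and
    supp: "\<And>\<alpha> x. x \<notin> cball 0 (r / 2) \<Longrightarrow> D \<alpha> x = 0" and
    one: "(LINT x|lebesgue. D [] x) = 1"
    using mollifier_exists[of "r / 2"] r by auto
  have Dint: "integrable lebesgue (D \<alpha>)" for \<alpha>
    by (rule integrable_compact_support[OF cont supp])
  define g where "g \<alpha> = conv (D \<alpha>) h" for \<alpha>
  have g: "is_generator M T j (g \<alpha>) (g (j # \<alpha>))" for j \<alpha>
    unfolding g_def by (rule conv_is_generator[OF cont cont der supp supp h])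
  have gD: "g \<alpha> \<in> stoch_D M T" for \<alpha>
    unfolding stoch_D_def using g[of _ \<alpha>] is_generator_def by blast
  have gL2: "g \<alpha> \<in> L2 M" for \<alpha> using gD unfolding stoch_D_def by auto
  have gkl: "g [k, l] = g [l, k]"
  proof -
    have "D [k, l] = D [l, k]" using mixed_partials_commute[OF cont der, where i = k and j = l] by auto
    then show ?thesis by (simp add: g_def)
  qed
  \<comment> \<open>Component \<open>k\<close> is \<open>1 - g [l]\<close>, component
    \<open>l\<close> is \<open>g [k]\<close>, and the others are zero through
    \<open>c i = 0\<close>, with \<open>[k]\<close> as a dummy word.\<close>
  define a c \<beta> where "a i = (if i = k then 1 else 0 :: real)" and
    "c i = (if i = k then -1 else if i = l then 1 else 0 :: real)" and
    "\<beta> i = (if i = k then [l] else [k])" for i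
  define w where "w \<omega> = (\<chi> i. a i + c i * g (\<beta> i) \<omega>)" for \<omega>
  have wi: "(\<lambda>\<omega>. w \<omega> $ i) = (\<lambda>\<omega>. a i + c i * g (\<beta> i) \<omega>)" for i by (simp add: w_def)
  have wD: "w \<in> stoch_D_vec M T"
    using gen_affine(1)[OF gD] by (simp add: stoch_D_vec_def wi)
  have "AE \<omega> in M. \<forall>i\<in>UNIV. gen M T i (\<lambda>\<omega>. w \<omega> $ i) \<omega> = c i * g (i # \<beta> i) \<omega>"
    unfolding wi using gen_eq[OF is_generator_affine[OF g]] by (intro AE_finite_allI) auto
  then have div: "AE \<omega> in M. stoch_div M T w \<omega> = 0"
  proof eventually_elim
    case (elim \<omega>)
    then have "stoch_div M T w \<omega> = (\<Sum>i\<in>UNIV. c i * g (i # \<beta> i) \<omega>)"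
      unfolding stoch_div_def by simp
    also have "\<dots> = (\<Sum>i\<in>UNIV. (if i = k then - g [k, l] \<omega> else 0) + (if i = l then g [l, k] \<omega> else 0))"
      using kl by (intro sum.cong) (auto simp: c_def \<beta>_def)
    also have "\<dots> = 0" by (simp add: sum.distrib gkl)
    finally show ?case .
  qed
  have zero: "AE \<omega> in M. \<omega> \<in> space M - F \<longrightarrow> w \<omega> = 0"
    using affine
  proof eventually_elim
    case (elim \<omega>)
    show ?case
    proof
      assume \<omega>: "\<omega> \<in> space M - F"
      then obtain b where b: "\<And>x. norm x < r \<Longrightarrow> h (T x \<omega>) = x $ l + b" using elim by blast
      \<comment> \<open>The kernel has radius \<open>r / 2\<close>, while \<open>h\<close> is affine
        along the flow up to distance \<open>r\<close>. Hence \<open>1 - g [l]\<close> and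
        \<open>g [k]\<close> both vanish.\<close>
      have "g [j] \<omega> = (if l = j then 1 else 0)" for j
        unfolding g_def
        by (rule conv_derivative_affine[where R = "r / 2", OF cont cont der supp supp one h _ _ b]) (use r \<omega> in auto)
      then show "w \<omega> = 0" using kl by (auto simp: w_def vec_eq_iff a_def c_def \<beta>_def)
    qed
  qed
  have W: "w \<in> W_space M T F"
    unfolding W_space_def using wD div zero by auto
  have gint: "integrable M (g \<alpha>)" for \<alpha> by (rule L2_integrable[OF gL2])
  have mean: "(LINT \<omega>|M. w \<omega>) = axis k 1"
  proof -
    have "integrable M w" by (rule L2_integrable[OF stoch_D_vec_L2(1)[OF wD]])
    then have "(LINT \<omega>|M. w \<omega>) $ i = (LINT \<omega>|M. w \<omega> $ i)" for i
      by (intro integral_bounded_linear[symmetric] bounded_linear_vec_nth)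
    moreover have "(LINT \<omega>|M. w \<omega> $ i) = a i + c i * (LINT \<omega>|M. g (\<beta> i) \<omega>)" for i
      unfolding wi using gint prob_space by simp
    moreover have "(LINT \<omega>|M. g (\<beta> i) \<omega>) = 0" for i
      using integral_generator_zero[OF g[of _ "[]"]] by (simp add: \<beta>_def)
    ultimately show ?thesis by (auto simp: vec_eq_iff a_def axis_def)
  qed
  have orth: "(LINT \<omega>|M. w \<omega> \<bullet> f \<omega>) = 0" if f: "f \<in> V_pot M T" for f
  proof -
    have fL2: "f \<in> L2 M" and f0: "(LINT \<omega>|M. f \<omega>) = 0"
      and pot: "AE \<omega> in M. potential_field (\<lambda>x. f (T x \<omega>))"
      using f unfolding V_pot_def by auto
    have fi: "(\<lambda>\<omega>. f \<omega> $ i) \<in> L2 M" for i by (rule L2_nth[OF fL2])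
    have fint: "integrable M (\<lambda>\<omega>. f \<omega> $ i)" for i by (rule L2_integrable[OF fi])
    have "integrable M f" by (rule L2_integrable[OF fL2])
    then have fi0: "(LINT \<omega>|M. f \<omega> $ i) = 0" for i
      using integral_bounded_linear[OF bounded_linear_vec_nth, of M f i] f0 by simp
    have fg: "integrable M (\<lambda>\<omega>. f \<omega> $ i * g \<alpha> \<omega>)" for i \<alpha>
      using L2_integrable_inner[OF fi gL2] by simp
    \<comment> \<open>For a realization with potential \<phi>, both sides are minus the integral of
      \<phi> against a mixed second derivative of the kernel, so they agree by its symmetry.\<close>
    have "AE \<omega> in M. (LINT y|lebesgue. D [l] y * f (T y \<omega>) $ k) = (LINT y|lebesgue. D [k] y * f (T y \<omega>) $ l)"
      using pot
    proof eventually_elim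
      case (elim \<omega>)
      then obtain \<phi> where \<phi>: "has_weak_grad UNIV \<phi> (\<lambda>x. f (T x \<omega>))"
        unfolding potential_field_def by blast
      have "D [j] \<in> test_fun UNIV" for j
        unfolding test_fun_def smooth_fun_def
        by (intro CollectI conjI exI[of _ "\<lambda>\<alpha>. D (\<alpha> @ [j])"] exI[of _ "cball 0 (r / 2)"])
           (use cont der supp in auto)
      then have *: "(LINT x|lebesgue. \<phi> x * grad (D [j]) x $ i) = - (LINT x|lebesgue. f (T x \<omega>) $ i * D [j] x)" for i j
        using \<phi> unfolding has_weak_grad_def lebesgue_on_UNIV_eq by blast
      have gr: "grad (D [j]) x $ i = D [i, j] x" for i j x
        by (rule grad_partials[of "\<lambda>i. D [i, j]"]) (use cont der in auto)
      have "D [k, l] = D [l, k]" using mixed_partials_commute[OF cont der, where i = k and j = l] by auto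
      then show ?case using *[of l k] *[of k l] unfolding gr by (simp add: mult.commute)
    qed
    then have ae: "AE \<omega> in M. h \<omega> * (LINT y|lebesgue. D [l] y * f (T y \<omega>) $ k) = h \<omega> * (LINT y|lebesgue. D [k] y * f (T y \<omega>) $ l)"
      by eventually_elim simp
    note A = conv_adjoint[OF Dint h fint]
    have "(LINT \<omega>|M. f \<omega> $ k * g [l] \<omega>) = (LINT \<omega>|M. f \<omega> $ l * g [k] \<omega>)"
      unfolding g_def A[THEN conjunct2]
      by (rule integral_cong_AE[OF _ _ ae]) (use A[THEN conjunct1] in auto)
    moreover have "w \<omega> \<bullet> f \<omega> = f \<omega> $ k - f \<omega> $ k * g [l] \<omega> + f \<omega> $ l * g [k] \<omega>" for \<omega>
    proof -
      have "w \<omega> \<bullet> f \<omega> = (\<Sum>i\<in>UNIV. (if i = k then (1 - g [l] \<omega>) * f \<omega> $ k else 0) + (if i = l then g [k] \<omega> * f \<omega> $ l else 0))"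
        unfolding inner_vec_def using kl by (intro sum.cong) (auto simp: w_def a_def c_def \<beta>_def)
      also have "\<dots> = (1 - g [l] \<omega>) * f \<omega> $ k + g [k] \<omega> * f \<omega> $ l" by (simp add: sum.distrib)
      finally show ?thesis by (simp add: algebra_simps)
    qed
    ultimately show ?thesis using fint fg fi0 by simp
  qed
  show ?thesis using W mean orth by blast
qed

end

section \<open>Geometry of the inclusions and a measurable stream function\<close>

lemma connected_subset_separated:
  fixes C :: "nat \<Rightarrow> (real^'n) set"
  assumes S: "connected S" "S \<subseteq> (\<Union>j. C j)" "a \<in> S" "a \<in> C i"
    and \<delta>: "0 < \<delta>" and sep: "\<And>i j. i \<noteq> j \<Longrightarrow> \<delta> < setdist (C i) (C j)"
  shows "S \<subseteq> C i"
proof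
  fix b assume "b \<in> S"
  show "b \<in> C i"
  proof (rule connected_induction_simple[where P = "\<lambda>x. x \<in> C i", OF S(1,3) \<open>b \<in> S\<close> S(4)])
    fix x assume "x \<in> S"
    show "\<exists>T. openin (top_of_set S) T \<and> x \<in> T \<and> (\<forall>y\<in>T. \<forall>z\<in>T. y \<in> C i \<longrightarrow> z \<in> C i)"
    \<comment> \<open>Two points of this ball are closer than \<delta>, hence lie in the same set of
      the family: membership in \<open>C i\<close> is locally constant on \<open>S\<close>.\<close>
    proof (intro exI[of _ "S \<inter> ball x (\<delta> / 2)"] conjI ballI impI)
      show "openin (top_of_set S) (S \<inter> ball x (\<delta> / 2))" by (intro openin_open_Int) auto
      show "x \<in> S \<inter> ball x (\<delta> / 2)" using \<open>x \<in> S\<close> \<delta> by simp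
      fix y z assume yz: "y \<in> S \<inter> ball x (\<delta> / 2)" "z \<in> S \<inter> ball x (\<delta> / 2)" "y \<in> C i"
      then obtain j where j: "z \<in> C j" using S(2) by blast
      have "dist y z < \<delta>" using yz by (auto intro: dist_triangle_half_r[of x])
      then show "z \<in> C i" using sep[of i j] setdist_le_dist[OF yz(3) j] j by (cases "i = j") auto
    qed
  qed
qed

text \<open>Excludes dimension one. A connected subset of the line is an interval, and density of
  the complement puts a point outside \<open>A\<close> to the right of any point of
  \<open>A\<close>. A whole ray is then outside, and being connected it lies in a single bounded
  \<open>C j\<close>.\<close>

lemma no_bounded_separated_cover_of_line_complement:
  fixes A :: "(real^'n) set" and C :: "nat \<Rightarrow> (real^'n) set"
  assumes one: "\<And>i::'n. i = k" and A: "connected A" and C: "UNIV - A = (\<Union>j. C j)" "\<And>j. bounded (C j)"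
    and \<delta>: "0 < \<delta>" and sep: "\<And>i j. i \<noteq> j \<Longrightarrow> \<delta> < setdist (C i) (C j)"
    and r: "0 < r" "\<And>c. ball c r \<inter> (UNIV - A) \<noteq> {}"
  shows False
proof -
  define v :: "real \<Rightarrow> real^'n" where "v c = (\<chi> i. c)" for c
  have vk: "v (x $ k) = x" for x using one by (auto simp: v_def vec_eq_iff) (metis one)
  have ray: "\<exists>c0. \<forall>c\<ge>c0. v c \<notin> A"
  proof (cases "A = {}")
    case False
    then obtain p where p: "p \<in> A" by blast
    \<comment> \<open>All points of this ball lie strictly to the right of \<open>p\<close>.\<close>
    obtain q where q: "q \<in> ball (v (p $ k + r)) r" "q \<notin> A" using r(2) by blast
    have "\<bar>(v (p $ k + r) - q) $ k\<bar> < r"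
      using q(1) component_le_norm_cart[of "v (p $ k + r) - q" k] by (simp add: dist_norm)
    then have pq: "p $ k < q $ k" by (simp add: v_def)
    have "v c \<notin> A" if "q $ k \<le> c" for c
    proof
      assume c: "v c \<in> A"
      have "continuous_on A (\<lambda>x. x $ k)" by (intro continuous_intros)
      then have "connected ((\<lambda>x. x $ k) ` A)" using A by (rule connected_continuous_image)
      moreover have "p $ k \<in> (\<lambda>x. x $ k) ` A" using p by (rule imageI)
      moreover have "v c $ k \<in> (\<lambda>x. x $ k) ` A" using c by (rule imageI)
      ultimately have "{p $ k..v c $ k} \<subseteq> (\<lambda>x. x $ k) ` A"
        by (rule connected_contains_Icc)
      moreover have "q $ k \<in> {p $ k..v c $ k}" using pq that by (simp add: v_def)
      ultimately have "q $ k \<in> (\<lambda>x. x $ k) ` A" by (rule subsetD)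
      then obtain x where x: "x \<in> A" "x $ k = q $ k" by auto
      have "x = q" using vk x(2) by metis
      then show False using x(1) q(2) by simp
    qed
    then show ?thesis by blast
  qed simp
  then obtain c0 where c0: "\<And>c. c0 \<le> c \<Longrightarrow> v c \<notin> A" by blast
  have "v c0 \<in> (\<Union>j. C j)" using C(1) c0[of c0] by auto
  then obtain j where j: "v c0 \<in> C j" by blast
  have "v ` {c0..} \<subseteq> C j"
  proof (rule connected_subset_separated[where C = C and a = "v c0", OF _ _ _ j \<delta> sep])
    show "connected (v ` {c0..})"
    proof (rule connected_continuous_image[OF _ connected_Ici])
      show "continuous_on {c0..} v" unfolding v_def[abs_def] by (rule continuous_on_vec_lambda) simp
    qed
    show "v ` {c0..} \<subseteq> (\<Union>j. C j)" using C(1) c0 by auto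
  qed auto
  then obtain B where B: "\<And>c. c0 \<le> c \<Longrightarrow> norm (v c) \<le> B"
    using C(2)[of j] unfolding bounded_iff by (auto simp: subset_iff)
  define c where "c = max c0 (\<bar>B\<bar> + 1)"
  have "\<bar>v c $ k\<bar> \<le> B" using component_le_norm_cart[of "v c" k] B[of c] by (simp only: c_def) linarith
  then show False by (auto simp: v_def c_def)
qed


context stationary_flow
begin

text \<open>
  Points of the countable dense set \<open>Q\<close> joined to the origin by a chain of points of \<open>Q\<close> outside the
  fluid with steps below \<open>r\<close>: a measurable description of the inclusion close to the origin.
\<close>

primrec reach :: "(real^'n) set \<Rightarrow> real \<Rightarrow> nat \<Rightarrow> real^'n \<Rightarrow> 'w set" where
  "reach Q r 0 q = {\<omega> \<in> space M. norm q < r \<and> T q \<omega> \<notin> F}"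
| "reach Q r (Suc i) q = {\<omega> \<in> space M. T q \<omega> \<notin> F} \<inter> (\<Union>q'\<in>{q'\<in>Q. dist q' q < r}. reach Q r i q')"

lemma reach_sets:
  assumes "countable Q"
  shows "reach Q r i q \<in> sets M"
proof (induction i arbitrary: q)
  case 0
  show ?case by simp
next
  case (Suc i)
  have "countable {q'\<in>Q. dist q' q < r}" by (rule countable_subset[OF _ assms]) auto
  then show ?case using Suc by (auto intro!: sets.Int sets.countable_UN')
qed

text \<open>Stands for the supremum of \<open>- y $ l\<close> over the inclusion at the origin. Seen
  from a point shifted by \<open>x\<close> the inclusion moves by \<open>- x\<close>, so the
  supremum gains \<open>x $ l\<close>. Clamping to \<open>[-K, K]\<close> keeps it bounded at every
  \<omega>, as mollification requires.\<close>

definition extent :: "(real^'n) set \<Rightarrow> real \<Rightarrow> real \<Rightarrow> 'n \<Rightarrow> 'w \<Rightarrow> real" where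
  "extent Q r K l \<omega> = (SUP q\<in>Q. if \<exists>i. \<omega> \<in> reach Q r i q then max (- K) (min K (- q $ l)) else - K)"

lemma extent_bdd: "0 \<le> K \<Longrightarrow> bdd_above ((\<lambda>q. if \<exists>i. \<omega> \<in> reach Q r i q then max (- K) (min K (- q $ l)) else - K) ` Q)"
  by (rule bdd_aboveI2[where M = K]) auto

lemma extent_measurable:
  assumes "countable Q" "Q \<noteq> {}" "0 \<le> K"
  shows "extent Q r K l \<in> borel_measurable M"
proof -
  have "(\<Union>i. reach Q r i q) \<in> sets M" for q
    by (intro sets.countable_UN) (auto intro: reach_sets[OF assms(1)])
  then have "(\<lambda>\<omega>. if \<omega> \<in> (\<Union>i. reach Q r i q) then max (- K) (min K (- q $ l)) else - K) \<in> borel_measurable M" for q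
    by (intro measurable_If_set) auto
  then have "(\<lambda>\<omega>. if \<exists>i. \<omega> \<in> reach Q r i q then max (- K) (min K (- q $ l)) else - K) \<in> borel_measurable M" for q
    by simp
  then show ?thesis
    unfolding extent_def[abs_def]
    using extent_bdd[OF assms(3)] assms by (intro borel_measurable_cSUP) auto
qed

lemma extent_abs_le:
  assumes "Q \<noteq> {}" "0 \<le> K"
  shows "\<bar>extent Q r K l \<omega>\<bar> \<le> K"
proof -
  obtain q where q: "q \<in> Q" using assms by blast
  have "extent Q r K l \<omega> \<le> K"
    unfolding extent_def using assms by (intro cSUP_least) auto
  moreover have "- K \<le> extent Q r K l \<omega>"
    unfolding extent_def using assms by (intro cSUP_upper2[OF extent_bdd q]) auto
  ultimately show ?thesis by simp
qed

text \<open>Steps below \<open>r\<close> cannot cross a gap larger than \<delta>, so chains never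
  leave the inclusion. Conversely, a connected inclusion is traversed by such chains, because it
  contains points of the translate of \<open>Q\<close> by \<open>x\<close> near each of its points.
  The second condition in \<open>C\<close>, met by closures of open sets, guarantees this:
  \<open>Q\<close> need not be dense in a thin set.\<close>

lemma reach_iff:
  fixes C :: "nat \<Rightarrow> (real^'n) set"
  assumes Q: "\<And>U. open U \<Longrightarrow> U \<noteq> {} \<Longrightarrow> \<exists>q\<in>Q. q \<in> U"
    and r: "0 < r" "2 * r \<le> \<delta>" and \<omega>: "\<omega> \<in> space M"
    and cover: "UNIV - fluid_region T F \<omega> = (\<Union>j. C j)"
    and sep: "\<And>i j. i \<noteq> j \<Longrightarrow> \<delta> < setdist (C i) (C j)"
    and C: "connected (C j)" "\<And>y e. y \<in> C j \<Longrightarrow> 0 < e \<Longrightarrow> \<exists>U. open U \<and> U \<noteq> {} \<and> U \<subseteq> C j \<and> U \<subseteq> ball y e"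
    and zero: "0 \<in> C j" and x: "norm x < r" and q: "q \<in> Q"
  shows "(\<exists>i. T x \<omega> \<in> reach Q r i q) \<longleftrightarrow> q + x \<in> C j"
proof -
  have notF: "T p (T x \<omega>) \<notin> F \<longleftrightarrow> p + x \<in> (\<Union>j. C j)" for p
    using cover \<omega> by (auto simp: T_add fluid_region_def)
  have near: "b \<in> C j" if ab: "a \<in> C j" "b \<in> (\<Union>j. C j)" "dist a b < \<delta>" for a b
  proof -
    obtain j' where j': "b \<in> C j'" using ab(2) by blast
    then show ?thesis using sep[of j j'] setdist_le_dist[OF ab(1) j'] ab(3) by (cases "j = j'") auto
  qed
  have to: "T x \<omega> \<in> reach Q r i p \<Longrightarrow> p + x \<in> C j" for i p
  proof (induction i arbitrary: p)
    case 0
    have "dist 0 (p + x) < \<delta>"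
      using 0 x r norm_triangle_ineq[of p x] unfolding dist_norm by (simp only: diff_0 norm_minus_cancel) simp
    then show ?case using 0 notF zero near by auto
  next
    case (Suc i)
    then obtain p' where p': "p' \<in> Q" "dist p' p < r" "T x \<omega> \<in> reach Q r i p'" by auto
    have "dist (p' + x) (p + x) < \<delta>" using p'(2) r by simp
    then show ?case using near[OF Suc.IH[OF p'(3)]] Suc.prems notF by auto
  qed
  have dense: "\<exists>p\<in>Q. p + x \<in> C j \<and> dist (p + x) y < e" if ye: "y \<in> C j" "0 < e" for y e
  proof -
    obtain U where U: "open U" "U \<noteq> {}" "U \<subseteq> C j" "U \<subseteq> ball y e" using C(2)[OF ye] by blast
    have "open ((\<lambda>p. p + x) -` U)" using U(1) by (intro open_vimage continuous_intros)
    moreover have "(\<lambda>p. p + x) -` U \<noteq> {}"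
    proof -
      obtain u where "u \<in> U" using U(2) by blast
      then have "u - x \<in> (\<lambda>p. p + x) -` U" by simp
      then show ?thesis by blast
    qed
    ultimately obtain p where "p \<in> Q" "p + x \<in> U" using Q by blast
    then show ?thesis using U by (auto simp: dist_commute subset_iff)
  qed
  \<comment> \<open>Some reached point lies within \<open>r / 4\<close> of \<open>y\<close>. On
    balls of radius \<open>r / 8\<close> this property is locally constant: three distances below
    \<open>r / 4\<close> add up to less than one step \<open>r\<close>.\<close>
  define P where "P y \<longleftrightarrow> (\<exists>p\<in>Q. p + x \<in> C j \<and> dist (p + x) y < r / 4 \<and> (\<exists>i. T x \<omega> \<in> reach Q r i p))" for y
  have step: "\<exists>i. T x \<omega> \<in> reach Q r i p" if "p + x \<in> C j" "p' \<in> Q" "dist (p' + x) (p + x) < r" "T x \<omega> \<in> reach Q r i p'" for p p' i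
  proof (intro exI[of _ "Suc i"])
    have "T p (T x \<omega>) \<notin> F" using that(1) notF by blast
    then show "T x \<omega> \<in> reach Q r (Suc i) p" using that T_space[OF \<omega>] by auto
  qed
  have "P y" if "y \<in> C j" for y
  proof (rule connected_induction_simple[where P = P, OF C(1) zero that])
    \<comment> \<open>The bound \<open>r - norm x\<close> ensures \<open>norm p < r\<close>, so that
      \<open>p\<close> can start a chain from the shifted origin.\<close>
    obtain p where p: "p \<in> Q" "p + x \<in> C j" "dist (p + x) 0 < min (r / 4) (r - norm x)"
      using dense[OF zero, of "min (r / 4) (r - norm x)"] r x by auto
    have "norm p \<le> norm (p + x) + norm x" using norm_triangle_ineq4[of "p + x" x] by simp
    then have "norm p < r" using p(3) by simp
    moreover have "T p (T x \<omega>) \<notin> F" using notF p(2) by blast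
    ultimately have "T x \<omega> \<in> reach Q r 0 p" using T_space[OF \<omega>] by simp
    then show "P 0" unfolding P_def using p by (intro bexI[of _ p] conjI exI[of _ 0]) auto
    fix a assume "a \<in> C j"
    show "\<exists>T. openin (top_of_set (C j)) T \<and> a \<in> T \<and> (\<forall>y\<in>T. \<forall>z\<in>T. P y \<longrightarrow> P z)"
    proof (intro exI[of _ "C j \<inter> ball a (r / 8)"] conjI ballI impI)
      show "openin (top_of_set (C j)) (C j \<inter> ball a (r / 8))" by (intro openin_open_Int) auto
      show "a \<in> C j \<inter> ball a (r / 8)" using \<open>a \<in> C j\<close> r by simp
      fix y z assume yz: "y \<in> C j \<inter> ball a (r / 8)" "z \<in> C j \<inter> ball a (r / 8)" and "P y"
      then obtain p i where p: "p \<in> Q" "dist (p + x) y < r / 4" "T x \<omega> \<in> reach Q r i p"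
        unfolding P_def by blast
      obtain p' where p': "p' \<in> Q" "p' + x \<in> C j" "dist (p' + x) z < r / 4"
        using dense[of z "r / 4"] yz r by auto
      have "dist y z < r / 4" using yz dist_triangle2[of y z a] by (auto simp: dist_commute)
      moreover have "dist (p + x) (p' + x) \<le> dist (p + x) y + dist y z + dist (p' + x) z"
        by (metis add_right_mono dist_commute dist_triangle dist_triangle_le order_trans)
      ultimately have "dist (p + x) (p' + x) < r" using p p' r by linarith
      then have "\<exists>i. T x \<omega> \<in> reach Q r i p'" using step[OF p'(2) p(1) _ p(3)] by blast
      then show "P z" unfolding P_def using p' by blast
    qed
  qed
  then have "\<exists>i. T x \<omega> \<in> reach Q r i q" if qC: "q + x \<in> C j"
  proof -
    obtain p i where p: "p \<in> Q" "dist (p + x) (q + x) < r / 4" "T x \<omega> \<in> reach Q r i p"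
      using \<open>\<And>y. y \<in> C j \<Longrightarrow> P y\<close>[OF qC] unfolding P_def by blast
    then show ?thesis using step[OF qC p(1) _ p(3)] r by auto
  qed
  then show ?thesis using to by blast
qed

text \<open>The constant \<open>c\<close> is the supremum of \<open>- y $ l\<close> over
  \<open>C j\<close>. It does not depend on \<open>x\<close> because \<open>reach_iff\<close>
  identifies the same inclusion from every origin within \<open>r\<close>, including origins
  slightly outside it.\<close>

lemma extent_affine:
  fixes C :: "nat \<Rightarrow> (real^'n) set"
  assumes Q: "\<And>U. open U \<Longrightarrow> U \<noteq> {} \<Longrightarrow> \<exists>q\<in>Q. q \<in> U"
    and r: "0 < r" "2 * r \<le> \<delta>" and \<omega>: "\<omega> \<in> space M"
    and cover: "UNIV - fluid_region T F \<omega> = (\<Union>j. C j)"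
    and sep: "\<And>i j. i \<noteq> j \<Longrightarrow> \<delta> < setdist (C i) (C j)"
    and C: "connected (C j)" "\<And>y e. y \<in> C j \<Longrightarrow> 0 < e \<Longrightarrow> \<exists>U. open U \<and> U \<noteq> {} \<and> U \<subseteq> C j \<and> U \<subseteq> ball y e"
    and zero: "0 \<in> C j" and bound: "\<And>y. y \<in> C j \<Longrightarrow> norm y \<le> d"
  shows "\<exists>c. \<forall>x. norm x < r \<longrightarrow> extent Q r (d + r) l (T x \<omega>) = x $ l + c"
proof (intro exI allI impI)
  fix x :: "real^'n" assume x: "norm x < r"
  define c where "c = (SUP y\<in>C j. - y $ l)"
  define e where "e = extent Q r (d + r) l (T x \<omega>)"
  have d: "0 \<le> d" using bound[OF zero] by simp
  have comp: "\<bar>y $ l\<bar> \<le> d" if "y \<in> C j" for y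
    using bound[OF that] component_le_norm_cart[of y l] by linarith
  have bdd: "bdd_above ((\<lambda>y. - y $ l) ` C j)"
    using comp by (intro bdd_aboveI2[where M = d]) (force simp: abs_le_iff)
  have xl: "\<bar>x $ l\<bar> < r" using x component_le_norm_cart[of x l] by linarith
  \<comment> \<open>The clamping level \<open>d + r\<close> is never active: coordinates in the
    inclusion are at most \<open>d\<close>, and the shift of the origin adds less than
    \<open>r\<close>.\<close>
  have clamp: "max (- (d + r)) (min (d + r) (- q $ l)) = - q $ l" if "q + x \<in> C j" for q
    using comp[OF that] xl by (auto simp: abs_le_iff abs_less_iff max_def min_def)
  have iff: "(\<exists>i. T x \<omega> \<in> reach Q r i q) \<longleftrightarrow> q + x \<in> C j" if "q \<in> Q" for q
    by (rule reach_iff[OF Q r \<omega> cover sep C zero x that])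
  have "Q \<noteq> {}" using Q[OF open_UNIV] by auto
  have le: "e \<le> x $ l + c"
    unfolding e_def extent_def
  proof (rule cSUP_least[OF \<open>Q \<noteq> {}\<close>])
    fix q assume "q \<in> Q"
    show "(if \<exists>i. T x \<omega> \<in> reach Q r i q then max (- (d + r)) (min (d + r) (- q $ l)) else - (d + r)) \<le> x $ l + c"
    proof (cases "q + x \<in> C j")
      case True
      then have "- (q + x) $ l \<le> c" unfolding c_def by (rule cSUP_upper[OF _ bdd])
      then show ?thesis using True iff[OF \<open>q \<in> Q\<close>] clamp[OF True] by simp
    next
      case False
      \<comment> \<open>Since the origin belongs to \<open>C j\<close>; hence the default value
        \<open>- (d + r)\<close> of unreached points stays below the supremum.\<close>
      have "0 \<le> c" using cSUP_upper[OF zero bdd] by (simp add: c_def)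
      then show ?thesis using False iff[OF \<open>q \<in> Q\<close>] xl d by simp
    qed
  qed
  have "c \<le> (e - x $ l)"
    unfolding c_def
  proof (rule cSUP_least)
    show "C j \<noteq> {}" using zero by blast
    fix y assume y: "y \<in> C j"
    show "- y $ l \<le> e - x $ l"
    proof (rule field_le_epsilon)
      fix \<epsilon> :: real assume "0 < \<epsilon>"
      obtain U where U: "open U" "U \<noteq> {}" "U \<subseteq> C j" "U \<subseteq> ball y \<epsilon>" using C(2)[OF y \<open>0 < \<epsilon>\<close>] by blast
      have "open ((\<lambda>p. p + x) -` U)" using U(1) by (intro open_vimage continuous_intros)
      moreover obtain u where "u \<in> U" using U(2) by blast
      then have "u - x \<in> (\<lambda>p. p + x) -` U" by simp
      then have "(\<lambda>p. p + x) -` U \<noteq> {}" by blast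
      ultimately obtain q where q: "q \<in> Q" "q + x \<in> U" using Q by blast
      then have qC: "q + x \<in> C j" and qy: "norm (y - (q + x)) < \<epsilon>" using U by (auto simp: dist_norm)
      have "- q $ l \<le> e"
        unfolding e_def extent_def
        by (rule cSUP_upper2[OF extent_bdd q(1)]) (use d r iff[OF q(1)] qC clamp[OF qC] in auto)
      moreover have "\<bar>(y - (q + x)) $ l\<bar> < \<epsilon>" using qy component_le_norm_cart[of "y - (q + x)" l] by linarith
      ultimately show "- y $ l \<le> e - x $ l + \<epsilon>" by (simp add: abs_less_iff)
    qed
  qed
  with le show "extent Q r (d + r) l (T x \<omega>) = x $ l + c" unfolding e_def by simp
qed

text \<open>Orthogonality is known over the whole probability space, whereas \<open>X_space\<close>
  is a closure in the norm over \<open>F\<close>. As \<open>w\<close> vanishes off \<open>F\<close>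
  the two integrals against a potential field agree, and Cauchy-Schwarz passes to the
  closure.\<close>

lemma W_space_inner_X_space:
  assumes w: "w \<in> W_space M T F" and orth: "\<And>f. f \<in> V_pot M T \<Longrightarrow> (LINT \<omega>|M. w \<omega> \<bullet> f \<omega>) = 0"
    and \<theta>: "\<theta> \<in> X_space M T F"
  shows "(LINT \<omega>|restrict_space M F. w \<omega> \<bullet> \<theta> \<omega>) = 0"
proof -
  let ?R = "restrict_space M F"
  have F': "F \<inter> space M \<in> sets M" by simp
  have L2R: "f \<in> L2 ?R" if "f \<in> L2 M" for f :: "'w \<Rightarrow> real^'n"
    using that integrable_mult_indicator[OF F, of "\<lambda>\<omega>. (norm (f \<omega>))\<^sup>2"]
    by (auto simp: L2_def integrable_restrict_space intro: measurable_restrict_space1)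
  have wL2: "w \<in> L2 M" using w stoch_D_vec_L2(1) unfolding W_space_def by auto
  have w0: "AE \<omega> in M. \<omega> \<in> space M - F \<longrightarrow> w \<omega> = 0" using w unfolding W_space_def by auto
  define B where "B = (LINT \<omega>|?R. (norm (w \<omega>))\<^sup>2)"
  have B: "0 \<le> B" by (simp add: B_def)
  have "(LINT \<omega>|?R. w \<omega> \<bullet> \<theta> \<omega>)\<^sup>2 \<le> 0 + e" if e: "0 < e" for e
  proof -
    have "0 < e / (B + 1)" using e B by simp
    then obtain f where f: "f \<in> V_pot M T" "(LINT \<omega>|?R. (norm (\<theta> \<omega> - f \<omega>))\<^sup>2) < e / (B + 1)"
      using \<theta> unfolding X_space_def by blast
    have \<theta>L2: "\<theta> \<in> L2 ?R" using \<theta> unfolding X_space_def by auto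
    have fL2: "f \<in> L2 M" using f(1) unfolding V_pot_def by auto
    have "(LINT \<omega>|?R. w \<omega> \<bullet> f \<omega>) = (LINT \<omega>|M. w \<omega> \<bullet> f \<omega>)"
      unfolding integral_restrict_space[OF F']
      by (rule integral_cong_AE) (use w0 L2_integrable_inner[OF wL2 fL2] F in \<open>auto elim!: eventually_mono simp: indicator_def\<close>)
    then have "(LINT \<omega>|?R. w \<omega> \<bullet> \<theta> \<omega>) = (LINT \<omega>|?R. w \<omega> \<bullet> (\<theta> \<omega> - f \<omega>))"
      using orth[OF f(1)] L2_integrable_inner[OF L2R[OF wL2] \<theta>L2] L2_integrable_inner[OF L2R[OF wL2] L2R[OF fL2]]
      by (simp add: inner_diff_right)
    also have "\<dots>\<^sup>2 \<le> B * (LINT \<omega>|?R. (norm (\<theta> \<omega> - f \<omega>))\<^sup>2)"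
      unfolding B_def by (rule L2_Cauchy_Schwarz[OF L2R[OF wL2] L2_diff[OF \<theta>L2 L2R[OF fL2]]])
    also have "\<dots> \<le> (B + 1) * (e / (B + 1))"
      using f(2) B by (intro mult_mono) auto
    also have "\<dots> = 0 + e" using B by simp
    finally show ?thesis .
  qed
  then have "(LINT \<omega>|?R. w \<omega> \<bullet> \<theta> \<omega>)\<^sup>2 \<le> 0" by (rule field_le_epsilon)
  then show ?thesis by simp
qed

text \<open>The geometry of the inclusions acts on the tensor only through this field: its unit mean
  detects coefficients, and its orthogonality makes the correctors disappear.\<close>

theorem inclusions_solenoidal_field:
  assumes incl: "random_inclusions M T F"
  shows "\<exists>w\<in>W_space M T F. (LINT \<omega>|M. w \<omega>) = axis k 1 \<and>
    (\<forall>\<theta>\<in>X_space M T F. (LINT \<omega>|restrict_space M F. w \<omega> \<bullet> \<theta> \<omega>) = 0)"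
proof -
  obtain \<kappa> \<delta> d r\<^sub>0 where pos: "0 < \<delta>" "0 < d" "0 < r\<^sub>0" and ae:
      "AE \<omega> in M. open (fluid_region T F \<omega>) \<and> connected (fluid_region T F \<omega>) \<and>
          (\<exists>D :: nat \<Rightarrow> (real^'n) set.
             UNIV - fluid_region T F \<omega> = (\<Union>j. closure (D j)) \<and>
             (\<forall>j. C2_bounded_domain (D j)) \<and>
             (\<forall>i j. i \<noteq> j \<longrightarrow> closure (D i) \<inter> closure (D j) = {}) \<and>
             (\<forall>j. boundary_curvature_le (D j) \<kappa>) \<and>
             (\<forall>i j. i \<noteq> j \<longrightarrow> \<delta> < setdist (closure (D i)) (closure (D j))) \<and>
             (\<forall>j. diameter (closure (D j)) \<le> d)) \<and>
          (\<forall>c. ball c r\<^sub>0 \<inter> (UNIV - fluid_region T F \<omega>) \<noteq> {})"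
    using incl unfolding random_inclusions_def by blast
  obtain l where l: "k \<noteq> l"
  \<comment> \<open>If \<open>k\<close> were the only coordinate, almost every realization would
    contradict the connectedness of the fluid.\<close>
  proof (rule ccontr)
    assume "\<not> thesis"
    then have one: "\<And>i::'n. i = k" using that by metis
    have "AE \<omega> in M. False"
      using ae
    proof eventually_elim
      case (elim \<omega>)
      from conjunct1[OF conjunct2[OF conjunct2[OF elim]]]
      obtain D :: "nat \<Rightarrow> (real^'n) set" where D: "UNIV - fluid_region T F \<omega> = (\<Union>j. closure (D j))"
        "\<forall>j. C2_bounded_domain (D j)" "\<forall>i j. i \<noteq> j \<longrightarrow> \<delta> < setdist (closure (D i)) (closure (D j))"
        by (elim exE conjE) (rule that)
      note D = D(1) D(2,3)[rule_format]
      have b: "bounded (closure (D j))" for j using D(2) unfolding C2_bounded_domain_def by auto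
      have cn: "connected (fluid_region T F \<omega>)" and r0: "\<And>c. ball c r\<^sub>0 \<inter> (UNIV - fluid_region T F \<omega>) \<noteq> {}"
        using elim by auto
      show False
        by (rule no_bounded_separated_cover_of_line_complement[OF one cn D(1) b pos(1) D(3) pos(3) r0])
    qed
    then show False by simp
  qed
  obtain Q :: "(real^'n) set" where Q: "countable Q" "\<And>U. open U \<Longrightarrow> U \<noteq> {} \<Longrightarrow> \<exists>q\<in>Q. q \<in> U"
    by (rule countable_dense_setE) blast
  have Qne: "Q \<noteq> {}" using Q(2)[OF open_UNIV] by auto
  \<comment> \<open>The shift of the origin and the first point of a chain contribute less than
    \<open>r\<close> each, in total less than the separation.\<close>
  define r where "r = \<delta> / 2"
  have r: "0 < r" "2 * r \<le> \<delta>" using pos by (auto simp: r_def)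
  define h where "h = extent Q r (d + r) l"
  have h: "h \<in> borel_measurable M" "\<bar>h \<omega>\<bar> \<le> d + r" for \<omega>
    unfolding h_def using pos r by (auto intro!: extent_measurable[OF Q(1) Qne] extent_abs_le[OF Qne])
  have "AE \<omega> in M. \<omega> \<in> space M - F \<longrightarrow> (\<exists>c. \<forall>x. norm x < r \<longrightarrow> h (T x \<omega>) = x $ l + c)"
    using ae
  proof eventually_elim
    case (elim \<omega>)
    from conjunct1[OF conjunct2[OF conjunct2[OF elim]]]
    obtain D :: "nat \<Rightarrow> (real^'n) set" where D: "UNIV - fluid_region T F \<omega> = (\<Union>j. closure (D j))"
      "\<forall>j. C2_bounded_domain (D j)" "\<forall>i j. i \<noteq> j \<longrightarrow> \<delta> < setdist (closure (D i)) (closure (D j))"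
      "\<forall>j. diameter (closure (D j)) \<le> d"
      by (elim exE conjE) (rule that)
    note D = D(1) D(2-4)[rule_format]
    show ?case
    proof
      assume \<omega>: "\<omega> \<in> space M - F"
      then have "0 \<in> UNIV - fluid_region T F \<omega>" by (simp add: fluid_region_def T_zero)
      then obtain j where j: "0 \<in> closure (D j)" unfolding D(1) by blast
      have Dj: "open (D j)" "connected (D j)" "bounded (D j)" using D(2) unfolding C2_bounded_domain_def by auto
      show "\<exists>c. \<forall>x. norm x < r \<longrightarrow> h (T x \<omega>) = x $ l + c"
        unfolding h_def
      proof (rule extent_affine[OF Q(2) r _ D(1) D(3) _ _ j])
        show "connected (closure (D j))" using Dj(2) by (rule connected_imp_connected_closure)
        show "\<exists>U. open U \<and> U \<noteq> {} \<and> U \<subseteq> closure (D j) \<and> U \<subseteq> ball y e" if "y \<in> closure (D j)" "0 < e" for y e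
        proof (intro exI[of _ "D j \<inter> ball y e"] conjI)
          show "D j \<inter> ball y e \<noteq> {}"
            using that(1)[unfolded closure_approachable, rule_format, OF that(2)] by (auto simp: dist_commute)
        qed (use Dj closure_subset[of "D j"] in auto)
        show "norm y \<le> d" if "y \<in> closure (D j)" for y
          using diameter_bounded_bound[of "closure (D j)" y 0, OF bounded_closure[OF Dj(3)]] that j D(4)[of j] by simp
      qed (use \<omega> in auto)
    qed
  qed
  from solenoidal_field_exists[OF h r(1) l this]
  obtain w where w: "w \<in> W_space M T F" "(LINT \<omega>|M. w \<omega>) = axis k 1"
    "\<And>f. f \<in> V_pot M T \<Longrightarrow> (LINT \<omega>|M. w \<omega> \<bullet> f \<omega>) = 0"
    by blast
  then show ?thesis using W_space_inner_X_space by blast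
qed

end

section \<open>The effective tensor\<close>

lemma integral_norm_sum_squared:
  fixes f :: "'p::finite \<Rightarrow> 'a \<Rightarrow> 'b::euclidean_space" and \<xi> :: "'p \<Rightarrow> real"
  assumes "\<And>p q. integrable N (\<lambda>x. c x * (f p x \<bullet> f q x))"
  shows "(\<Sum>p\<in>UNIV. \<Sum>q\<in>UNIV. \<xi> p * \<xi> q * (LINT x|N. c x * (f p x \<bullet> f q x)))
     = (LINT x|N. c x * (norm (\<Sum>p\<in>UNIV. \<xi> p *\<^sub>R f p x))\<^sup>2)"
    and "integrable N (\<lambda>x. c x * (norm (\<Sum>p\<in>UNIV. \<xi> p *\<^sub>R f p x))\<^sup>2)"
proof -
  have eq: "c x * (norm (\<Sum>p\<in>UNIV. \<xi> p *\<^sub>R f p x))\<^sup>2 = (\<Sum>p\<in>UNIV. \<Sum>q\<in>UNIV. \<xi> p * \<xi> q * (c x * (f p x \<bullet> f q x)))" for x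
    unfolding power2_norm_eq_inner inner_sum_left inner_sum_right sum_distrib_left
    by (intro sum.cong refl) (simp add: mult.left_commute mult.assoc inner_commute)
  show "integrable N (\<lambda>x. c x * (norm (\<Sum>p\<in>UNIV. \<xi> p *\<^sub>R f p x))\<^sup>2)"
    unfolding eq using assms by (intro Bochner_Integration.integrable_sum integrable_mult_right)
  show "(\<Sum>p\<in>UNIV. \<Sum>q\<in>UNIV. \<xi> p * \<xi> q * (LINT x|N. c x * (f p x \<bullet> f q x)))
     = (LINT x|N. c x * (norm (\<Sum>p\<in>UNIV. \<xi> p *\<^sub>R f p x))\<^sup>2)"
    unfolding eq using assms
    by (subst Bochner_Integration.integral_sum | intro Bochner_Integration.integrable_sum integrable_mult_right sum.cong refl | simp)+
qed

section \<open>The cell form and its loads, with the concentrations as bounded weights that are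
  positive on the fluid and zero outside\<close>

locale electrokinetic_cell = stationary_flow M T F
  for M :: "'w measure" and T :: "real^'n \<Rightarrow> 'w \<Rightarrow> 'w" and F :: "'w set" +
  fixes z :: "'s::finite \<Rightarrow> int" and Pe :: "'s \<Rightarrow> real" and n :: "'s \<Rightarrow> 'w \<Rightarrow> real"
  assumes inclusions: "random_inclusions M T F"
    and Pe: "\<And>j. 0 < Pe j" and z: "\<And>j. z j \<noteq> 0"
    and n_measurable[measurable]: "\<And>j. n j \<in> borel_measurable M"
    and n_bounded: "\<And>j. \<exists>C. AE \<omega> in M. \<bar>n j \<omega>\<bar> \<le> C"
    and n_pos: "\<And>j \<omega>. \<omega> \<in> F \<Longrightarrow> 0 < n j \<omega>" and n_off: "\<And>j \<omega>. \<omega> \<notin> F \<Longrightarrow> n j \<omega> = 0"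
begin

abbreviation R :: "'w measure" where "R \<equiv> restrict_space M F"

lemma F_sets: "F \<inter> space M \<in> sets M" by simp

lemma finite_R: "finite_measure R"
  by (rule finite_measure_restrict_space[OF finite_measure_axioms]) simp

lemma AE_R: "AE \<omega> in M. P \<omega> \<Longrightarrow> AE \<omega> in R. P \<omega>"
  by (subst AE_restrict_space_iff[OF F_sets]) auto

lemma space_R: "\<omega> \<in> space R \<Longrightarrow> \<omega> \<in> F"
  by (simp add: space_restrict_space)

lemma L2_R:
  fixes f :: "'w \<Rightarrow> 'b::euclidean_space"
  shows "f \<in> L2 M \<Longrightarrow> f \<in> L2 R"
  using integrable_mult_indicator[OF F, of "\<lambda>\<omega>. (norm (f \<omega>))\<^sup>2"]
  by (auto simp: L2_def integrable_restrict_space intro: measurable_restrict_space1)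

lemma L2_R_const: "(\<lambda>\<omega>. c :: 'b::euclidean_space) \<in> L2 R"
  by (rule L2_R) (simp add: L2_def)

lemma W_L2: "\<xi> \<in> W_space M T F \<Longrightarrow> \<xi> \<in> L2 M" "\<xi> \<in> W_space M T F \<Longrightarrow> stoch_jac M T \<xi> \<in> L2 M"
  using stoch_D_vec_L2 unfolding W_space_def by auto

lemma W_L2_R: "\<xi> \<in> W_space M T F \<Longrightarrow> \<xi> \<in> L2 R" "\<xi> \<in> W_space M T F \<Longrightarrow> stoch_jac M T \<xi> \<in> L2 R"
  using W_L2 L2_R by blast+

lemma X_L2_R: "\<theta> \<in> X_space M T F \<Longrightarrow> \<theta> \<in> L2 R"
  unfolding X_space_def by auto

lemma weight_L2:
  fixes f :: "'w \<Rightarrow> real^'n"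
  assumes "f \<in> L2 R"
  shows "(\<lambda>\<omega>. n j \<omega> *\<^sub>R f \<omega>) \<in> L2 R"
proof -
  obtain C where "AE \<omega> in M. \<bar>n j \<omega>\<bar> \<le> C" using n_bounded by blast
  then have "AE \<omega> in R. norm (n j \<omega> *\<^sub>R f \<omega>) \<le> C * norm (f \<omega>)"
    by (intro AE_R) (auto elim!: eventually_mono intro!: mult_right_mono)
  moreover have "n j \<in> borel_measurable R" by (rule measurable_restrict_space1) simp
  ultimately show ?thesis
    using L2_measurable[OF assms] by (intro L2_bound[OF assms borel_measurable_scaleR])
qed

lemma weight_integrable:
  fixes f g :: "'w \<Rightarrow> real^'n"
  assumes "f \<in> L2 R" "g \<in> L2 R"
  shows "integrable R (\<lambda>\<omega>. n j \<omega> * (f \<omega> \<bullet> g \<omega>))"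
  using L2_integrable_inner[OF weight_L2[OF assms(1)] assms(2)] by simp

definition pair :: "'s \<Rightarrow> ('w \<Rightarrow> real^'n) \<Rightarrow> ('w \<Rightarrow> real^'n) \<Rightarrow> real" where
  "pair j f g = (LINT \<omega>|R. n j \<omega> * (f \<omega> \<bullet> g \<omega>))"

definition dirichlet :: "('w \<Rightarrow> real^'n) \<Rightarrow> ('w \<Rightarrow> real^'n) \<Rightarrow> real" where
  "dirichlet v \<xi> = (LINT \<omega>|R. stoch_jac M T v \<omega> \<bullet> stoch_jac M T \<xi> \<omega>)"

lemma pair_commute: "pair j f g = pair j g f"
  by (simp add: pair_def inner_commute)

lemma dirichlet_commute: "dirichlet v \<xi> = dirichlet \<xi> v"
  by (simp add: dirichlet_def inner_commute)

lemma pair_add: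
  assumes "f \<in> L2 R" "f' \<in> L2 R" "g \<in> L2 R"
  shows "pair j (\<lambda>\<omega>. f \<omega> + f' \<omega>) g = pair j f g + pair j f' g"
  using weight_integrable[OF assms(1,3)] weight_integrable[OF assms(2,3)]
  by (simp add: pair_def inner_add_left distrib_left)

lemma pair_scale: "pair j (\<lambda>\<omega>. c *\<^sub>R f \<omega>) g = c * pair j f g"
  by (simp add: pair_def mult.left_commute)

lemma pair_minus: "pair j (\<lambda>\<omega>. - f \<omega>) g = - pair j f g" "pair j g (\<lambda>\<omega>. - f \<omega>) = - pair j g f"
  by (simp_all add: pair_def)

text \<open>Displays the structure of the form: the Dirichlet term and the terms with
  \<open>Pe\<close> are symmetric, while the coupling of velocities and potentials is skew.\<close>

lemma cell_form_expand:
  assumes "v \<in> L2 R" "\<xi> \<in> L2 R" "\<And>j. \<Theta> j \<in> L2 R" "\<And>j. \<zeta> j \<in> L2 R"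
  shows "cell_form M T F z Pe n v \<Theta> \<xi> \<zeta> = dirichlet v \<xi>
    + (\<Sum>j\<in>UNIV. real_of_int (z j) * (pair j v (\<zeta> j) - pair j (\<Theta> j) \<xi>) + (real_of_int (z j))\<^sup>2 / Pe j * pair j (\<Theta> j) (\<zeta> j))"
proof -
  have eq: "(LINT \<omega>|R. real_of_int (z j) * n j \<omega> * (\<Theta> j \<omega> \<bullet> (\<xi> \<omega> - (real_of_int (z j) / Pe j) *\<^sub>R \<zeta> j \<omega>)))
     = real_of_int (z j) * pair j (\<Theta> j) \<xi> - (real_of_int (z j))\<^sup>2 / Pe j * pair j (\<Theta> j) (\<zeta> j)" for j
  proof -
    have "(LINT \<omega>|R. real_of_int (z j) * n j \<omega> * (\<Theta> j \<omega> \<bullet> (\<xi> \<omega> - (real_of_int (z j) / Pe j) *\<^sub>R \<zeta> j \<omega>)))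
      = (LINT \<omega>|R. real_of_int (z j) * (n j \<omega> * (\<Theta> j \<omega> \<bullet> \<xi> \<omega>)) - (real_of_int (z j))\<^sup>2 / Pe j * (n j \<omega> * (\<Theta> j \<omega> \<bullet> \<zeta> j \<omega>)))"
      by (intro Bochner_Integration.integral_cong refl) (simp add: inner_diff_right power2_eq_square algebra_simps)
    also have "\<dots> = real_of_int (z j) * pair j (\<Theta> j) \<xi> - (real_of_int (z j))\<^sup>2 / Pe j * pair j (\<Theta> j) (\<zeta> j)"
      unfolding pair_def using weight_integrable[OF assms(3) assms(2)] weight_integrable[OF assms(3) assms(4)]
      by (subst Bochner_Integration.integral_diff) auto
    finally show ?thesis .
  qed
  show ?thesis
    unfolding cell_form_def eq dirichlet_def pair_def[symmetric]
    by (simp add: sum.distrib sum_subtractf right_diff_distrib algebra_simps)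
qed

lemma cell_form_swap:
  assumes "v \<in> L2 R" "\<xi> \<in> L2 R" "\<And>j. \<Theta> j \<in> L2 R" "\<And>j. \<zeta> j \<in> L2 R"
  shows "cell_form M T F z Pe n v \<Theta> \<xi> (\<lambda>j \<omega>. - \<zeta> j \<omega>) = cell_form M T F z Pe n \<xi> \<zeta> v (\<lambda>j \<omega>. - \<Theta> j \<omega>)"
proof -
  show ?thesis
    unfolding cell_form_expand[OF assms(1,2,3) L2_minus[OF assms(4)]] cell_form_expand[OF assms(2,1,4) L2_minus[OF assms(3)]]
      pair_minus pair_commute[of _ \<xi>] pair_commute[of _ v] pair_commute[of _ "\<zeta> _" "\<Theta> _"] dirichlet_commute[of \<xi>]
    by (intro arg_cong2[of _ _ _ _ "(+)"] sum.cong refl) (simp add: algebra_simps)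
qed

text \<open>The constant macroscopic gradient driving species \<open>j\<close> in the cell problem
  \<open>p\<close>, to which \<open>\<Theta>\<close> is the corrector. With it the loads of all
  problems become one formula.\<close>

definition unit :: "'s option \<times> 'n \<Rightarrow> 's \<Rightarrow> real^'n" where
  "unit p j = (if fst p = Some j then axis (snd p) 1 else 0)"

lemma cell_load_expand:
  assumes "\<xi> \<in> L2 R" "\<And>j. \<zeta> j \<in> L2 R"
  shows "cell_load M F z Pe n a k \<xi> \<zeta> = (if a = None then LINT \<omega>|R. \<xi> \<omega> $ k else 0)
    + (\<Sum>j\<in>UNIV. real_of_int (z j) * pair j (\<lambda>_. unit (a, k) j) \<xi> - (real_of_int (z j))\<^sup>2 / Pe j * pair j (\<lambda>_. unit (a, k) j) (\<zeta> j))"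
proof (cases a)
  case None
  then show ?thesis by (simp add: cell_load_def inner_axis' unit_def pair_def)
next
  case (Some i)
  have "cell_load M F z Pe n a k \<xi> \<zeta> = real_of_int (z i) * (LINT \<omega>|R. n i \<omega> * (axis k 1 \<bullet> \<xi> \<omega>) - real_of_int (z i) / Pe i * (n i \<omega> * (axis k 1 \<bullet> \<zeta> i \<omega>)))"
    unfolding cell_load_def Some option.case
    by (intro arg_cong2[of _ _ _ _ "(*)"] Bochner_Integration.integral_cong refl) (simp add: inner_diff_right algebra_simps)
  also have "\<dots> = real_of_int (z i) * pair i (\<lambda>_. axis k 1) \<xi> - (real_of_int (z i))\<^sup>2 / Pe i * pair i (\<lambda>_. axis k 1) (\<zeta> i)"
    unfolding pair_def using weight_integrable[OF L2_R_const assms(1)] weight_integrable[OF L2_R_const assms(2)]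
    by (subst Bochner_Integration.integral_diff) (auto simp: power2_eq_square right_diff_distrib)
  also have "\<dots> = (\<Sum>j\<in>UNIV. if j = i then real_of_int (z i) * pair i (\<lambda>_. axis k 1) \<xi> - (real_of_int (z i))\<^sup>2 / Pe i * pair i (\<lambda>_. axis k 1) (\<zeta> i) else 0)"
    by simp
  also have "\<dots> = (\<Sum>j\<in>UNIV. real_of_int (z j) * pair j (\<lambda>_. unit (a, k) j) \<xi> - (real_of_int (z j))\<^sup>2 / Pe j * pair j (\<lambda>_. unit (a, k) j) (\<zeta> j))"
    by (intro sum.cong refl) (auto simp: Some unit_def pair_def)
  finally show ?thesis by (simp add: Some)
qed

lemma integral_W_R:
  assumes "\<xi> \<in> W_space M T F"
  shows "(LINT \<omega>|R. \<xi> \<omega> \<bullet> c) = (LINT \<omega>|M. \<xi> \<omega>) \<bullet> c"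
proof -
  have cL2: "(\<lambda>\<omega>. c) \<in> L2 M" by (simp add: L2_def)
  have i: "integrable M (\<lambda>\<omega>. \<xi> \<omega> \<bullet> c)" by (rule L2_integrable_inner[OF W_L2(1)[OF assms] cL2])
  have "AE \<omega> in M. \<omega> \<in> space M - F \<longrightarrow> \<xi> \<omega> = 0" using assms unfolding W_space_def by auto
  then have "(LINT \<omega>|R. \<xi> \<omega> \<bullet> c) = (LINT \<omega>|M. \<xi> \<omega> \<bullet> c)"
    unfolding integral_restrict_space[OF F_sets]
    by (intro integral_cong_AE) (use i F in \<open>auto elim!: eventually_mono simp: indicator_def\<close>)
  also have "\<dots> = (LINT \<omega>|M. \<xi> \<omega>) \<bullet> c"
    using L2_integrable[OF W_L2(1)[OF assms]] by simp
  finally show ?thesis .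
qed

lemma integral_weight_R: "(LINT \<omega>|M. n j \<omega> * f \<omega>) = (LINT \<omega>|R. n j \<omega> * f \<omega>)"
  unfolding integral_restrict_space[OF F_sets]
  by (intro Bochner_Integration.integral_cong refl) (auto simp: n_off indicator_def)

end

section \<open>Symmetry and definiteness of the effective tensor\<close>

locale cell_problems = electrokinetic_cell M T F z Pe n
  for M :: "'w measure" and T :: "real^'n \<Rightarrow> 'w \<Rightarrow> 'w" and F :: "'w set"
    and z :: "'s::finite \<Rightarrow> int" and Pe :: "'s \<Rightarrow> real" and n :: "'s \<Rightarrow> 'w \<Rightarrow> real" +
  fixes v :: "'s option \<Rightarrow> 'n \<Rightarrow> 'w \<Rightarrow> real^'n" and \<Theta> :: "'s option \<Rightarrow> 'n \<Rightarrow> 's \<Rightarrow> 'w \<Rightarrow> real^'n"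
  assumes cell: "\<And>a k. cell_solution M T F z Pe n a k (v a k) (\<Theta> a k)"
begin

text \<open>The factors that make the blocks of \<open>B_mat\<close> loads evaluated at cell solutions.\<close>

definition scal :: "'s option \<Rightarrow> real" where
  "scal a = (case a of None \<Rightarrow> 1 | Some i \<Rightarrow> real_of_int (z i))"

lemma scal_nonzero: "scal a \<noteq> 0"
  using z by (auto simp: scal_def split: option.split)

lemma v_W: "v a k \<in> W_space M T F" and \<Theta>_X: "\<Theta> a k j \<in> X_space M T F"
  using cell unfolding cell_solution_def by auto

lemma v_L2: "v a k \<in> L2 R" and \<Theta>_L2: "\<Theta> a k j \<in> L2 R"
  using W_L2_R v_W X_L2_R \<Theta>_X by blast+

lemma X_minus: "\<theta> \<in> X_space M T F \<Longrightarrow> (\<lambda>\<omega>. - \<theta> \<omega>) \<in> X_space M T F"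
  using X_space_scale[of \<theta> "-1"] by simp

lemma cell_test:
  assumes "\<xi> \<in> W_space M T F" "\<And>j. \<zeta> j \<in> X_space M T F"
  shows "cell_form M T F z Pe n (v a k) (\<Theta> a k) \<xi> \<zeta> = cell_load M F z Pe n a k \<xi> \<zeta>"
  using cell[of a k] assms unfolding cell_solution_def by blast

lemma L_mat_entry: "L_mat M z Pe n v \<Theta> j $ l $ k = pair j (\<lambda>_. axis l 1) (v None k) + real_of_int (z j) / Pe j * pair j (\<lambda>_. axis l 1) (\<Theta> None k j)"
proof -
  have "L_mat M z Pe n v \<Theta> j $ l $ k = pair j (\<lambda>\<omega>. v None k \<omega> + (real_of_int (z j) / Pe j) *\<^sub>R \<Theta> None k j \<omega>) (\<lambda>_. axis l 1)"
    by (simp add: L_mat_def integral_weight_R pair_def)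
  also have "\<dots> = pair j (v None k) (\<lambda>_. axis l 1) + real_of_int (z j) / Pe j * pair j (\<Theta> None k j) (\<lambda>_. axis l 1)"
    by (subst pair_add) (auto intro!: v_L2 \<Theta>_L2 L2_scaleR L2_R_const simp only: pair_scale)
  finally show ?thesis by (simp add: pair_commute)
qed

lemma D_mat_entry: "D_mat M z Pe n v \<Theta> j i $ l $ k = pair j (\<lambda>_. axis l 1) (v (Some i) k)
    + real_of_int (z j) / Pe j * (pair j (\<lambda>_. axis l 1) (\<lambda>_. unit (Some i, k) j) + pair j (\<lambda>_. axis l 1) (\<Theta> (Some i) k j))"
proof -
  have "D_mat M z Pe n v \<Theta> j i $ l $ k = pair j (\<lambda>\<omega>. v (Some i) k \<omega> + (real_of_int (z j) / Pe j) *\<^sub>R (unit (Some i, k) j + \<Theta> (Some i) k j \<omega>)) (\<lambda>_. axis l 1)"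
    by (simp add: D_mat_def integral_weight_R pair_def unit_def cong: if_cong)
  also have "\<dots> = pair j (v (Some i) k) (\<lambda>_. axis l 1) + real_of_int (z j) / Pe j * (pair j (\<lambda>_. unit (Some i, k) j) (\<lambda>_. axis l 1) + pair j (\<Theta> (Some i) k j) (\<lambda>_. axis l 1))"
    by (subst pair_add, (intro v_L2 \<Theta>_L2 L2_scaleR L2_add L2_R_const)+, subst pair_scale,
        subst pair_add, (intro v_L2 \<Theta>_L2 L2_R_const)+, simp)
  finally show ?thesis by (simp add: pair_commute)
qed

text \<open>Reversing the potentials produces the sign with which \<open>\<Theta>\<close> enters the
  flux averages. \<open>scal b\<close> undoes the division of the species columns by the valences,
  and \<open>scal a\<close> supplies the valence carried by the load. The Kronecker term of
  \<open>D_mat\<close> is not part of a load and gives the last sum.\<close>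

lemma B_entry:
  "scal a * scal b * (B_mat M z Pe n v \<Theta> $ (a, l) $ (b, k)) = cell_load M F z Pe n a l (v b k) (\<lambda>j \<omega>. - \<Theta> b k j \<omega>)
     + (\<Sum>j\<in>UNIV. (real_of_int (z j))\<^sup>2 / Pe j * pair j (\<lambda>_. unit (a, l) j) (\<lambda>_. unit (b, k) j))"
proof -
  have load: "cell_load M F z Pe n a l (v b k) (\<lambda>j \<omega>. - \<Theta> b k j \<omega>) = (if a = None then LINT \<omega>|R. v b k \<omega> $ l else 0)
    + (\<Sum>j\<in>UNIV. real_of_int (z j) * pair j (\<lambda>_. unit (a, l) j) (v b k) + (real_of_int (z j))\<^sup>2 / Pe j * pair j (\<lambda>_. unit (a, l) j) (\<Theta> b k j))"
    using X_L2_R[OF X_minus[OF \<Theta>_X]] v_L2 by (simp add: cell_load_expand pair_minus)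
  have mean: "(LINT \<omega>|M. v b k \<omega> \<bullet> axis l 1) = (LINT \<omega>|R. v b k \<omega> $ l)"
  proof -
    have "(LINT \<omega>|M. v b k \<omega> \<bullet> axis l 1) = (LINT \<omega>|M. v b k \<omega>) \<bullet> axis l 1"
      by (rule integral_inner_left) (rule L2_integrable[OF W_L2(1)[OF v_W]])
    also have "\<dots> = (LINT \<omega>|R. v b k \<omega> $ l)"
      using integral_W_R[OF v_W, of b k "axis l 1"] by (simp add: inner_axis)
    finally show ?thesis .
  qed
  show ?thesis
  proof (cases a)
    case None
    then have "unit (a, l) j = 0" for j by (simp add: unit_def)
    then show ?thesis using None mean z unfolding load
      by (cases b) (auto simp: B_mat_def K_mat_def J_mat_def scal_def pair_def)
  next
    case (Some j)
    have sum: "(\<Sum>i\<in>UNIV. f i) = f j" if "\<And>i. i \<noteq> j \<Longrightarrow> f i = 0" for f :: "'s \<Rightarrow> real"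
      using that by (subst sum.remove[of UNIV j]) auto
    have unit: "unit (Some j, l) j = axis l 1" "i \<noteq> j \<Longrightarrow> unit (Some j, l) i = 0" for i by (auto simp: unit_def)
    have "cell_load M F z Pe n a l (v b k) (\<lambda>j \<omega>. - \<Theta> b k j \<omega>)
     + (\<Sum>j\<in>UNIV. (real_of_int (z j))\<^sup>2 / Pe j * pair j (\<lambda>_. unit (a, l) j) (\<lambda>_. unit (b, k) j))
     = real_of_int (z j) * pair j (\<lambda>_. axis l 1) (v b k) + (real_of_int (z j))\<^sup>2 / Pe j * pair j (\<lambda>_. axis l 1) (\<Theta> b k j)
       + (real_of_int (z j))\<^sup>2 / Pe j * pair j (\<lambda>_. axis l 1) (\<lambda>_. unit (b, k) j)"
      unfolding load by (subst (1 2) sum) (auto simp: unit Some pair_def)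
    moreover have "scal a * scal b * (B_mat M z Pe n v \<Theta> $ (a, l) $ (b, k)) =
       real_of_int (z j) * (if b = None then L_mat M z Pe n v \<Theta> j $ l $ k else D_mat M z Pe n v \<Theta> j (the b) $ l $ k)"
      using z by (cases b) (auto simp: B_mat_def scal_def Some)
    moreover have "pair j (\<lambda>_. axis l 1) (\<lambda>_. unit (None, k) j) = 0" by (simp add: unit_def pair_def)
    ultimately show ?thesis
      by (cases b) (auto simp: L_mat_entry D_mat_entry algebra_simps power2_eq_square)
  qed
qed

text \<open>Reciprocity of Onsager type: each load is the form at its own solution, and
  \<open>cell_form_swap\<close> exchanges the two solutions.\<close>

lemma cell_load_symmetric:
  "cell_load M F z Pe n a l (v b k) (\<lambda>j \<omega>. - \<Theta> b k j \<omega>) = cell_load M F z Pe n b k (v a l) (\<lambda>j \<omega>. - \<Theta> a l j \<omega>)"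
proof -
  have "cell_form M T F z Pe n (v a l) (\<Theta> a l) (v b k) (\<lambda>j \<omega>. - \<Theta> b k j \<omega>)
    = cell_form M T F z Pe n (v b k) (\<Theta> b k) (v a l) (\<lambda>j \<omega>. - \<Theta> a l j \<omega>)"
    by (rule cell_form_swap) (intro v_L2 \<Theta>_L2)+
  then show ?thesis by (simp add: cell_test v_W X_minus \<Theta>_X)
qed

lemma B_symmetric: "transpose (B_mat M z Pe n v \<Theta>) = B_mat M z Pe n v \<Theta>"
proof -
  have "B_mat M z Pe n v \<Theta> $ (a, l) $ (b, k) = B_mat M z Pe n v \<Theta> $ (b, k) $ (a, l)" for a b l k
  proof -
    have "scal a * scal b * (B_mat M z Pe n v \<Theta> $ (a, l) $ (b, k)) = scal a * scal b * (B_mat M z Pe n v \<Theta> $ (b, k) $ (a, l))"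
      using B_entry[where a = a and b = b and l = l and k = k] B_entry[where a = b and b = a and l = k and k = l]
        cell_load_symmetric[of a l b k]
      by (simp add: mult.commute mult.left_commute pair_commute)
    then show ?thesis using scal_nonzero by simp
  qed
  then show ?thesis by (simp add: transpose_def vec_eq_iff split_paired_all)
qed

text \<open>Averaging the two equal expressions for the scaled entry removes the skew part of the
  form. What remains are the four products in
  \<open>(\<Theta> + unit) \<bullet> (\<Theta> + unit)\<close>: \<open>t\<close>, two cross terms
  \<open>e\<close>, and \<open>u\<close>.\<close>

lemma B_gram:
  "scal a * scal b * (B_mat M z Pe n v \<Theta> $ (a, l) $ (b, k)) = dirichlet (v a l) (v b k)
    + (\<Sum>j\<in>UNIV. (real_of_int (z j))\<^sup>2 / Pe j * pair j (\<lambda>\<omega>. \<Theta> a l j \<omega> + unit (a, l) j) (\<lambda>\<omega>. \<Theta> b k j \<omega> + unit (b, k) j))"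
proof -
  define e where "e a l b k = (\<Sum>j\<in>UNIV. (real_of_int (z j))\<^sup>2 / Pe j * pair j (\<lambda>_. unit (a, l) j) (\<Theta> b k j))" for a l b k
  define t where "t = (\<Sum>j\<in>UNIV. (real_of_int (z j))\<^sup>2 / Pe j * pair j (\<Theta> a l j) (\<Theta> b k j))"
  define u where "u = (\<Sum>j\<in>UNIV. (real_of_int (z j))\<^sup>2 / Pe j * pair j (\<lambda>_. unit (a, l) j) (\<lambda>_. unit (b, k) j))"
  \<comment> \<open>The potentials enter the unreversed load as \<open>- e\<close>, so reversing
    them adds \<open>2 * e\<close>; the unreversed load is the form by the cell problem.\<close>
  have load: "cell_load M F z Pe n a l (v b k) (\<lambda>j \<omega>. - \<Theta> b k j \<omega>) = cell_form M T F z Pe n (v a l) (\<Theta> a l) (v b k) (\<Theta> b k) + 2 * e a l b k" for a l b k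
    unfolding cell_test[OF v_W \<Theta>_X] e_def
    using X_L2_R[OF X_minus[OF \<Theta>_X]] v_L2 \<Theta>_L2
    by (simp add: cell_load_expand pair_minus sum_distrib_left sum.distrib sum_subtractf algebra_simps)
  have form: "cell_form M T F z Pe n (v a l) (\<Theta> a l) (v b k) (\<Theta> b k) + cell_form M T F z Pe n (v b k) (\<Theta> b k) (v a l) (\<Theta> a l)
     = 2 * dirichlet (v a l) (v b k) + 2 * t"
    unfolding t_def cell_form_expand[OF v_L2 v_L2 \<Theta>_L2 \<Theta>_L2]
    by (simp add: pair_commute[of _ "v b k"] pair_commute[of _ "\<Theta> b k _"] dirichlet_commute[of "v b k"]
        sum.distrib[symmetric] sum_distrib_left algebra_simps)
  have "2 * (scal a * scal b * (B_mat M z Pe n v \<Theta> $ (a, l) $ (b, k))) =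
     cell_load M F z Pe n a l (v b k) (\<lambda>j \<omega>. - \<Theta> b k j \<omega>) + cell_load M F z Pe n b k (v a l) (\<lambda>j \<omega>. - \<Theta> a l j \<omega>) + 2 * u"
    using B_entry[where a = a and b = b and l = l and k = k] cell_load_symmetric[of a l b k] by (simp add: u_def)
  also have "\<dots> = 2 * (dirichlet (v a l) (v b k) + t + e a l b k + e b k a l + u)"
    using load[of a l b k] load[of b k a l] form by simp
  finally have "scal a * scal b * (B_mat M z Pe n v \<Theta> $ (a, l) $ (b, k)) = dirichlet (v a l) (v b k) + (t + e a l b k + e b k a l + u)" by simp
  moreover have "pair j (\<lambda>\<omega>. \<Theta> a l j \<omega> + unit (a, l) j) (\<lambda>\<omega>. \<Theta> b k j \<omega> + unit (b, k) j) =
      pair j (\<Theta> a l j) (\<Theta> b k j) + pair j (\<lambda>_. unit (a, l) j) (\<Theta> b k j) + pair j (\<lambda>_. unit (b, k) j) (\<Theta> a l j) + pair j (\<lambda>_. unit (a, l) j) (\<lambda>_. unit (b, k) j)" for j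
  proof -
    have "pair j (\<lambda>\<omega>. \<Theta> a l j \<omega> + unit (a, l) j) (\<lambda>\<omega>. \<Theta> b k j \<omega> + unit (b, k) j) =
      pair j (\<Theta> a l j) (\<lambda>\<omega>. \<Theta> b k j \<omega> + unit (b, k) j) + pair j (\<lambda>_. unit (a, l) j) (\<lambda>\<omega>. \<Theta> b k j \<omega> + unit (b, k) j)"
      by (rule pair_add) (intro \<Theta>_L2 L2_add L2_R_const)+
    moreover have "pair j f (\<lambda>\<omega>. \<Theta> b k j \<omega> + unit (b, k) j) = pair j f (\<Theta> b k j) + pair j f (\<lambda>_. unit (b, k) j)" if "f \<in> L2 R" for f
      unfolding pair_commute[of j f] by (rule pair_add[OF \<Theta>_L2 L2_R_const that])
    ultimately show ?thesis by (simp add: \<Theta>_L2 L2_R_const pair_commute[of j "\<Theta> a l j" "\<lambda>_. unit (b, k) j"])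
  qed
  ultimately show ?thesis
    unfolding t_def e_def u_def by (simp add: sum.distrib distrib_left algebra_simps)
qed

text \<open>Dividing the components of \<eta> by \<open>scal\<close> cancels the factors of
  \<open>B_gram\<close>, which leaves the Gram matrix itself.\<close>

lemma B_quadratic_form:
  fixes \<xi> :: "'s option \<times> 'n \<Rightarrow> real"
  assumes \<xi>: "\<And>p. \<xi> p = \<eta> $ p / scal (fst p)"
  shows "\<eta> \<bullet> (B_mat M z Pe n v \<Theta> *v \<eta>) =
    (LINT \<omega>|R. (norm (\<Sum>p\<in>UNIV. \<xi> p *\<^sub>R stoch_jac M T (v (fst p) (snd p)) \<omega>))\<^sup>2)
    + (\<Sum>j\<in>UNIV. (real_of_int (z j))\<^sup>2 / Pe j *
        (LINT \<omega>|R. n j \<omega> * (norm (\<Sum>p\<in>UNIV. \<xi> p *\<^sub>R (\<Theta> (fst p) (snd p) j \<omega> + unit p j)))\<^sup>2))"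
    and "integrable R (\<lambda>\<omega>. (norm (\<Sum>p\<in>UNIV. \<xi> p *\<^sub>R stoch_jac M T (v (fst p) (snd p)) \<omega>))\<^sup>2)"
    and "integrable R (\<lambda>\<omega>. n j \<omega> * (norm (\<Sum>p\<in>UNIV. \<xi> p *\<^sub>R (\<Theta> (fst p) (snd p) j \<omega> + unit p j)))\<^sup>2)"
proof -
  define \<theta> where "\<theta> j p \<omega> = \<Theta> (fst p) (snd p) j \<omega> + unit p j" for j p \<omega>
  have \<theta>: "\<theta> j p \<in> L2 R" for j p
    unfolding \<theta>_def by (intro L2_add \<Theta>_L2 L2_R_const)
  note gram1 = integral_norm_sum_squared[where N = R and c = "\<lambda>_. 1" and \<xi> = \<xi> and f = "\<lambda>p. stoch_jac M T (v (fst p) (snd p))",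
      unfolded mult_1_left, OF L2_integrable_inner[OF W_L2_R(2)[OF v_W] W_L2_R(2)[OF v_W]]]
  note gram2 = integral_norm_sum_squared[where N = R and c = "n j" and \<xi> = \<xi> and f = "\<theta> j" for j,
      OF weight_integrable[OF \<theta> \<theta>]]
  show "integrable R (\<lambda>\<omega>. (norm (\<Sum>p\<in>UNIV. \<xi> p *\<^sub>R stoch_jac M T (v (fst p) (snd p)) \<omega>))\<^sup>2)"
    by (rule gram1(2))
  show "integrable R (\<lambda>\<omega>. n j \<omega> * (norm (\<Sum>p\<in>UNIV. \<xi> p *\<^sub>R (\<Theta> (fst p) (snd p) j \<omega> + unit p j)))\<^sup>2)"
    using gram2(2)[of j] unfolding \<theta>_def .
  have entry: "\<eta> $ p * (B_mat M z Pe n v \<Theta> $ p $ q * \<eta> $ q) = \<xi> p * \<xi> q * dirichlet (v (fst p) (snd p)) (v (fst q) (snd q))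
     + (\<Sum>j\<in>UNIV. (real_of_int (z j))\<^sup>2 / Pe j * (\<xi> p * \<xi> q * pair j (\<theta> j p) (\<theta> j q)))" for p q
  proof -
    have "\<eta> $ p = scal (fst p) * \<xi> p" for p using scal_nonzero[of "fst p"] by (simp add: \<xi>)
    then have "\<eta> $ p * (B_mat M z Pe n v \<Theta> $ p $ q * \<eta> $ q) = \<xi> p * \<xi> q * (scal (fst p) * scal (fst q) * (B_mat M z Pe n v \<Theta> $ p $ q))"
      by simp
    also have "\<dots> = \<xi> p * \<xi> q * (dirichlet (v (fst p) (snd p)) (v (fst q) (snd q))
      + (\<Sum>j\<in>UNIV. (real_of_int (z j))\<^sup>2 / Pe j * pair j (\<theta> j p) (\<theta> j q)))"
      using B_gram[where a = "fst p" and b = "fst q" and l = "snd p" and k = "snd q"] unfolding \<theta>_def by simp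
    finally show ?thesis by (simp add: distrib_left sum_distrib_left mult.left_commute)
  qed
  have "\<eta> \<bullet> (B_mat M z Pe n v \<Theta> *v \<eta>) = (\<Sum>p\<in>UNIV. \<Sum>q\<in>UNIV. \<eta> $ p * (B_mat M z Pe n v \<Theta> $ p $ q * \<eta> $ q))"
    by (simp add: inner_vec_def matrix_vector_mult_def sum_distrib_left)
  also have "\<dots> = (\<Sum>p\<in>UNIV. \<Sum>q\<in>UNIV. \<xi> p * \<xi> q * dirichlet (v (fst p) (snd p)) (v (fst q) (snd q)))
    + (\<Sum>p\<in>UNIV. \<Sum>q\<in>UNIV. \<Sum>j\<in>UNIV. (real_of_int (z j))\<^sup>2 / Pe j * (\<xi> p * \<xi> q * pair j (\<theta> j p) (\<theta> j q)))"
    unfolding entry by (simp add: sum.distrib)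
  also have "(\<Sum>p\<in>UNIV. \<Sum>q\<in>UNIV. \<Sum>j\<in>UNIV. (real_of_int (z j))\<^sup>2 / Pe j * (\<xi> p * \<xi> q * pair j (\<theta> j p) (\<theta> j q)))
    = (\<Sum>p\<in>UNIV. \<Sum>j\<in>UNIV. \<Sum>q\<in>UNIV. (real_of_int (z j))\<^sup>2 / Pe j * (\<xi> p * \<xi> q * pair j (\<theta> j p) (\<theta> j q)))"
    by (intro sum.cong[OF refl] sum.swap)
  also have "\<dots> = (\<Sum>j\<in>UNIV. \<Sum>p\<in>UNIV. \<Sum>q\<in>UNIV. (real_of_int (z j))\<^sup>2 / Pe j * (\<xi> p * \<xi> q * pair j (\<theta> j p) (\<theta> j q)))"
    by (rule sum.swap)
  also have "\<dots> = (\<Sum>j\<in>UNIV. (real_of_int (z j))\<^sup>2 / Pe j * (\<Sum>p\<in>UNIV. \<Sum>q\<in>UNIV. \<xi> p * \<xi> q * pair j (\<theta> j p) (\<theta> j q)))"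
    by (simp add: sum_distrib_left)
  finally show "\<eta> \<bullet> (B_mat M z Pe n v \<Theta> *v \<eta>) =
    (LINT \<omega>|R. (norm (\<Sum>p\<in>UNIV. \<xi> p *\<^sub>R stoch_jac M T (v (fst p) (snd p)) \<omega>))\<^sup>2)
    + (\<Sum>j\<in>UNIV. (real_of_int (z j))\<^sup>2 / Pe j *
        (LINT \<omega>|R. n j \<omega> * (norm (\<Sum>p\<in>UNIV. \<xi> p *\<^sub>R (\<Theta> (fst p) (snd p) j \<omega> + unit p j)))\<^sup>2))"
    unfolding dirichlet_def pair_def gram1(1) gram2(1) unfolding \<theta>_def .
qed

lemma B_kernel:
  fixes \<xi> :: "'s option \<times> 'n \<Rightarrow> real"
  assumes jac: "AE \<omega> in R. (\<Sum>p\<in>UNIV. \<xi> p *\<^sub>R stoch_jac M T (v (fst p) (snd p)) \<omega>) = 0"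
    and pot: "\<And>j. AE \<omega> in R. (\<Sum>p\<in>UNIV. \<xi> p *\<^sub>R (\<Theta> (fst p) (snd p) j \<omega> + unit p j)) = 0"
  shows "\<xi> p = 0"
proof -
  obtain w where w: "\<And>k. w k \<in> W_space M T F" "\<And>k. (LINT \<omega>|M. w k \<omega>) = axis k 1"
    "\<And>k \<theta>. \<theta> \<in> X_space M T F \<Longrightarrow> (LINT \<omega>|R. w k \<omega> \<bullet> \<theta> \<omega>) = 0"
    using inclusions_solenoidal_field[OF inclusions] by metis
  have wL2: "w k \<in> L2 R" for k by (rule W_L2_R(1)[OF w(1)])
  have wR: "(LINT \<omega>|R. w k \<omega> \<bullet> c) = c $ k" for k c
    by (simp add: integral_W_R[OF w(1)] w(2) inner_axis')
  have sum_axis: "(\<Sum>p\<in>UNIV. \<xi> p * (unit p j $ k)) = \<xi> (Some j, k)" for j k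
  proof -
    have "(\<Sum>p\<in>UNIV. \<xi> p * (unit p j $ k)) = (\<Sum>p\<in>UNIV. if p = (Some j, k) then \<xi> p else 0)"
      by (intro sum.cong refl) (auto simp: unit_def axis_def prod_eq_iff)
    then show ?thesis by simp
  qed
  have some: "\<xi> (Some j, k) = 0" for j k
  proof -
    have "0 = (LINT \<omega>|R. w k \<omega> \<bullet> (\<Sum>p\<in>UNIV. \<xi> p *\<^sub>R (\<Theta> (fst p) (snd p) j \<omega> + unit p j)))"
    proof (rule integral_eq_zero_AE[symmetric])
      show "AE \<omega> in R. w k \<omega> \<bullet> (\<Sum>p\<in>UNIV. \<xi> p *\<^sub>R (\<Theta> (fst p) (snd p) j \<omega> + unit p j)) = 0"
        using pot[of j] by eventually_elim simp
    qed
    also have "\<dots> = (LINT \<omega>|R. (\<Sum>p\<in>UNIV. \<xi> p * (w k \<omega> \<bullet> \<Theta> (fst p) (snd p) j \<omega> + w k \<omega> \<bullet> unit p j)))"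
      by (simp add: inner_sum_right inner_add_right)
    also have "\<dots> = (\<Sum>p\<in>UNIV. \<xi> p * ((LINT \<omega>|R. w k \<omega> \<bullet> \<Theta> (fst p) (snd p) j \<omega>) + (LINT \<omega>|R. w k \<omega> \<bullet> unit p j)))"
      using L2_integrable_inner[OF wL2 \<Theta>_L2] L2_integrable_inner[OF wL2 L2_R_const] by simp
    also have "\<dots> = \<xi> (Some j, k)" using w(3)[OF \<Theta>_X] sum_axis by (simp add: wR)
    finally show ?thesis by simp
  qed
  \<comment> \<open>The coefficients of all nonzero unit vectors are already known to
    vanish.\<close>
  have \<Theta>0: "AE \<omega> in R. (\<Sum>p\<in>UNIV. \<xi> p *\<^sub>R \<Theta> (fst p) (snd p) j \<omega>) = 0" for j
    using pot[of j]
  proof eventually_elim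
    case (elim \<omega>)
    have unit0: "\<xi> p *\<^sub>R unit p j = 0" for p
      using some by (cases p; cases "fst p") (auto simp: unit_def)
    have "(\<Sum>p\<in>UNIV. \<xi> p *\<^sub>R \<Theta> (fst p) (snd p) j \<omega>) = (\<Sum>p\<in>UNIV. \<xi> p *\<^sub>R (\<Theta> (fst p) (snd p) j \<omega> + unit p j))"
      by (intro sum.cong refl) (simp only: scaleR_add_right unit0 add_0_right)
    then show ?case using elim by simp
  qed
  have zeroX: "(\<lambda>\<omega>. 0) \<in> X_space M T F"
    using X_space_scale[OF \<Theta>_X, of 0] by simp
  have none: "\<xi> (None, k) = 0" for k
  proof -
    \<comment> \<open>The cell problem tested with \<open>w k\<close> and zero potentials; the mean
      of \<open>w k\<close> appears only in the load of the fluid problems.\<close>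
    have test: "dirichlet (v a l) (w k) - (\<Sum>j\<in>UNIV. real_of_int (z j) * pair j (\<Theta> a l j) (w k)) =
       (if a = None \<and> l = k then 1 else 0) + (\<Sum>j\<in>UNIV. real_of_int (z j) * pair j (\<lambda>_. unit (a, l) j) (w k))" for a l
    proof -
      have p0: "pair j f (\<lambda>\<omega>. 0) = 0" for j f by (simp add: pair_def)
      have wl: "(LINT \<omega>|R. w k \<omega> $ l) = (if l = k then 1 else 0)" for l
        using wR[of k "axis l 1"] unfolding inner_axis by (simp add: axis_def eq_commute)
      show ?thesis
        using cell_test[of "w k" "\<lambda>j \<omega>. 0" a l, OF w(1) zeroX]
        by (simp add: cell_form_expand[OF v_L2 wL2 \<Theta>_L2 X_L2_R[OF zeroX]] cell_load_expand[OF wL2 X_L2_R[OF zeroX]] p0 wl sum_negf)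
    qed
    have dirichlet0: "(\<Sum>p\<in>UNIV. \<xi> p * dirichlet (v (fst p) (snd p)) (w k)) = 0"
    proof -
      have "(\<Sum>p\<in>UNIV. \<xi> p * dirichlet (v (fst p) (snd p)) (w k)) =
         (LINT \<omega>|R. (\<Sum>p\<in>UNIV. \<xi> p *\<^sub>R stoch_jac M T (v (fst p) (snd p)) \<omega>) \<bullet> stoch_jac M T (w k) \<omega>)"
        unfolding dirichlet_def using L2_integrable_inner[OF W_L2_R(2)[OF v_W] W_L2_R(2)[OF w(1)]]
        by (simp add: inner_sum_left)
      also have "\<dots> = 0"
        by (rule integral_eq_zero_AE) (use jac in \<open>eventually_elim, simp\<close>)
      finally show ?thesis .
    qed
    have pair0: "(\<Sum>p\<in>UNIV. \<xi> p * pair j (\<Theta> (fst p) (snd p) j) (w k)) = 0" for j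
    proof -
      have "(\<Sum>p\<in>UNIV. \<xi> p * pair j (\<Theta> (fst p) (snd p) j) (w k)) =
         (LINT \<omega>|R. n j \<omega> * ((\<Sum>p\<in>UNIV. \<xi> p *\<^sub>R \<Theta> (fst p) (snd p) j \<omega>) \<bullet> w k \<omega>))"
        unfolding pair_def using weight_integrable[OF \<Theta>_L2 wL2]
        by (simp add: inner_sum_left sum_distrib_left mult.left_commute)
      also have "\<dots> = 0"
        by (rule integral_eq_zero_AE) (use \<Theta>0[of j] in \<open>eventually_elim, simp\<close>)
      finally show ?thesis .
    qed
    have "(\<Sum>p\<in>UNIV. \<xi> p * (\<Sum>j\<in>UNIV. real_of_int (z j) * pair j (\<Theta> (fst p) (snd p) j) (w k)))
      = (\<Sum>p\<in>UNIV. \<Sum>j\<in>UNIV. real_of_int (z j) * (\<xi> p * pair j (\<Theta> (fst p) (snd p) j) (w k)))"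
      by (simp add: sum_distrib_left mult.left_commute)
    also have "\<dots> = (\<Sum>j\<in>UNIV. \<Sum>p\<in>UNIV. real_of_int (z j) * (\<xi> p * pair j (\<Theta> (fst p) (snd p) j) (w k)))"
      by (rule sum.swap)
    also have "\<dots> = 0" by (simp add: sum_distrib_left[symmetric] pair0)
    finally have drift0: "(\<Sum>p\<in>UNIV. \<xi> p * (\<Sum>j\<in>UNIV. real_of_int (z j) * pair j (\<Theta> (fst p) (snd p) j) (w k))) = 0" .
    have load0: "\<xi> p * (\<Sum>j\<in>UNIV. real_of_int (z j) * pair j (\<lambda>_. unit p j) (w k)) = 0" for p
      using some by (cases p; cases "fst p") (auto simp: unit_def pair_def)
    have "\<xi> p * (if fst p = None \<and> snd p = k then 1 else 0) = \<xi> p * dirichlet (v (fst p) (snd p)) (w k)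
      - \<xi> p * (\<Sum>j\<in>UNIV. real_of_int (z j) * pair j (\<Theta> (fst p) (snd p) j) (w k))" for p
    proof -
      have "\<xi> p * dirichlet (v (fst p) (snd p)) (w k) - \<xi> p * (\<Sum>j\<in>UNIV. real_of_int (z j) * pair j (\<Theta> (fst p) (snd p) j) (w k))
        = \<xi> p * ((if fst p = None \<and> snd p = k then 1 else 0) + (\<Sum>j\<in>UNIV. real_of_int (z j) * pair j (\<lambda>_. unit p j) (w k)))"
        using test[of "fst p" "snd p"] unfolding right_diff_distrib[symmetric] prod.collapse by (simp only:)
      then show ?thesis using load0[of p] by (simp only: distrib_left)
    qed
    then have "(\<Sum>p\<in>UNIV. \<xi> p * (if fst p = None \<and> snd p = k then 1 else 0)) = 0"
      by (simp only: sum_subtractf dirichlet0 drift0 diff_self)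
    moreover have "(\<Sum>p\<in>UNIV. \<xi> p * (if fst p = None \<and> snd p = k then 1 else 0)) = (\<Sum>p\<in>UNIV. if p = (None, k) then \<xi> p else 0)"
      by (intro sum.cong refl) (auto simp: prod_eq_iff)
    ultimately show ?thesis by simp
  qed
  show ?thesis using some none by (cases p; cases "fst p") auto
qed

theorem B_positive:
  assumes \<eta>: "\<eta> \<noteq> 0"
  shows "0 < \<eta> \<bullet> (B_mat M z Pe n v \<Theta> *v \<eta>)"
proof -
  define \<xi> where "\<xi> p = \<eta> $ p / scal (fst p)" for p
  note Q = B_quadratic_form[of \<xi> \<eta>, OF \<xi>_def]
  define A where "A = (LINT \<omega>|R. (norm (\<Sum>p\<in>UNIV. \<xi> p *\<^sub>R stoch_jac M T (v (fst p) (snd p)) \<omega>))\<^sup>2)"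
  define H where "H j = (real_of_int (z j))\<^sup>2 / Pe j *
        (LINT \<omega>|R. n j \<omega> * (norm (\<Sum>p\<in>UNIV. \<xi> p *\<^sub>R (\<Theta> (fst p) (snd p) j \<omega> + unit p j)))\<^sup>2)" for j
  have n0: "AE \<omega> in R. 0 < n j \<omega>" for j by (intro AE_I2) (auto intro: n_pos space_R)
  have A: "0 \<le> A" by (simp add: A_def)
  have H: "0 \<le> H j" for j
    unfolding H_def using Pe[of j] n0[of j]
    by (intro mult_nonneg_nonneg integral_nonneg_AE divide_nonneg_pos) (auto elim!: eventually_mono)
  have "A + (\<Sum>j\<in>UNIV. H j) \<noteq> 0"
  proof
    assume "A + (\<Sum>j\<in>UNIV. H j) = 0"
    then have zero: "A = 0" "(\<Sum>j\<in>UNIV. H j) = 0"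
      using A sum_nonneg[of UNIV H, OF H] by linarith+
    then have Hz: "H j = 0" for j using H by (simp add: sum_nonneg_eq_0_iff)
    have "AE \<omega> in R. (norm (\<Sum>p\<in>UNIV. \<xi> p *\<^sub>R stoch_jac M T (v (fst p) (snd p)) \<omega>))\<^sup>2 = 0"
      using zero(1) Q(2) unfolding A_def by (subst (asm) integral_nonneg_eq_0_iff_AE) auto
    then have jac: "AE \<omega> in R. (\<Sum>p\<in>UNIV. \<xi> p *\<^sub>R stoch_jac M T (v (fst p) (snd p)) \<omega>) = 0"
      by eventually_elim simp
    have pot: "AE \<omega> in R. (\<Sum>p\<in>UNIV. \<xi> p *\<^sub>R (\<Theta> (fst p) (snd p) j \<omega> + unit p j)) = 0" for j
    proof -
      have "(LINT \<omega>|R. n j \<omega> * (norm (\<Sum>p\<in>UNIV. \<xi> p *\<^sub>R (\<Theta> (fst p) (snd p) j \<omega> + unit p j)))\<^sup>2) = 0"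
        using Hz[of j] Pe[of j] z[of j] by (simp add: H_def)
      then have "AE \<omega> in R. n j \<omega> * (norm (\<Sum>p\<in>UNIV. \<xi> p *\<^sub>R (\<Theta> (fst p) (snd p) j \<omega> + unit p j)))\<^sup>2 = 0"
        using Q(3)[of j] n0[of j] by (subst (asm) integral_nonneg_eq_0_iff_AE) (auto elim!: eventually_mono)
      then show ?thesis using n0[of j] by eventually_elim simp
    qed
    have "\<eta> $ p = 0" for p
      using B_kernel[OF jac pot, of p] scal_nonzero[of "fst p"] by (simp add: \<xi>_def)
    then show False using \<eta> by (simp add: vec_eq_iff)
  qed
  moreover have "0 \<le> A + (\<Sum>j\<in>UNIV. H j)" using A sum_nonneg[of UNIV H, OF H] by simp
  ultimately show ?thesis unfolding Q(1) A_def H_def by simp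
qed

end

section \<open>The two-scale problem\<close>

context stationary_flow
begin

text \<open>The graph norm of a multiple of \<open>w\<close> scales with the square of the factor,
  so smoothness in the graph norm reduces to that of \<phi>. \<open>div_x\<close> is built from
  chosen representatives, which is why its value is determined only almost everywhere.\<close>

lemma test_W_product:
  assumes \<phi>: "\<phi> \<in> test_fun G" and w: "w \<in> W_space M T F"
  shows "(\<lambda>x \<omega>. \<phi> x *\<^sub>R w \<omega>) \<in> test_W M T F G"
    and "AE \<omega> in M. div_x M (\<lambda>x \<omega>. \<phi> x *\<^sub>R w \<omega>) x \<omega> = grad \<phi> x \<bullet> w \<omega>"
    and "div_x M (\<lambda>x \<omega>. \<phi> x *\<^sub>R w \<omega>) x \<in> borel_measurable M"
proof -
  obtain D :: "'n list \<Rightarrow> real^'n \<Rightarrow> real" and K where D: "D [] = \<phi>"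
    "\<And>\<alpha>. continuous_on UNIV (D \<alpha>)"
    "\<And>\<alpha> i x. ((\<lambda>t. D \<alpha> (x + t *\<^sub>R axis i 1)) has_real_derivative D (i # \<alpha>) x) (at 0)"
    "compact K" "K \<subseteq> G" "\<And>\<alpha> x. x \<notin> K \<Longrightarrow> D \<alpha> x = 0"
    by (rule test_funE[OF \<phi>]) (rule that)
  have wD: "w \<in> stoch_D_vec M T" using w unfolding W_space_def by auto
  have quot: "((\<lambda>t. ((D \<alpha> (x + t *\<^sub>R axis i 1) - D \<alpha> x) / t - D (i # \<alpha>) x)\<^sup>2 * c) \<longlongrightarrow> 0) (at 0)" for \<alpha> i x c
  proof -
    have "((\<lambda>t. (D \<alpha> (x + t *\<^sub>R axis i 1) - D \<alpha> x) / t) \<longlongrightarrow> D (i # \<alpha>) x) (at 0)"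
      using D(3)[of \<alpha> x i] by (simp add: DERIV_def)
    then have "((\<lambda>t. ((D \<alpha> (x + t *\<^sub>R axis i 1) - D \<alpha> x) / t - D (i # \<alpha>) x)\<^sup>2 * c) \<longlongrightarrow> (D (i # \<alpha>) x - D (i # \<alpha>) x)\<^sup>2 * c) (at 0)"
      by (intro tendsto_intros)
    then show ?thesis by simp
  qed
  have dq: "(\<lambda>\<omega>. (D \<alpha> (x + t *\<^sub>R axis i 1) *\<^sub>R w \<omega> - D \<alpha> x *\<^sub>R w \<omega>) /\<^sub>R t - D (i # \<alpha>) x *\<^sub>R w \<omega>)
    = (\<lambda>\<omega>. ((D \<alpha> (x + t *\<^sub>R axis i 1) - D \<alpha> x) / t - D (i # \<alpha>) x) *\<^sub>R w \<omega>)" for \<alpha> x t i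
    by (simp add: fun_eq_iff scaleR_left_diff_distrib[symmetric] divide_inverse mult.commute)
  show "(\<lambda>x \<omega>. \<phi> x *\<^sub>R w \<omega>) \<in> test_W M T F G"
    unfolding test_W_def
  proof (intro CollectI conjI exI[of _ "\<lambda>\<alpha> x \<omega>. D \<alpha> x *\<^sub>R w \<omega>"] exI[of _ K] allI impI D(4,5))
    show "(\<lambda>x \<omega>. D [] x *\<^sub>R w \<omega>) = (\<lambda>x \<omega>. \<phi> x *\<^sub>R w \<omega>)" by (simp add: D(1))
    show "(\<lambda>\<omega>. D \<alpha> x *\<^sub>R w \<omega>) \<in> W_space M T F" for \<alpha> x by (rule W_space_scale[OF w])
    show "((\<lambda>y. graph_norm_sq M T (\<lambda>\<omega>. D \<alpha> y *\<^sub>R w \<omega> - D \<alpha> x *\<^sub>R w \<omega>)) \<longlongrightarrow> 0) (at x)" for \<alpha> x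
    proof -
      have "((\<lambda>y. (D \<alpha> y - D \<alpha> x)\<^sup>2 * graph_norm_sq M T w) \<longlongrightarrow> (D \<alpha> x - D \<alpha> x)\<^sup>2 * graph_norm_sq M T w) (at x)"
        using D(2)[of \<alpha>] by (intro tendsto_intros) (simp add: continuous_on_def)
      then show ?thesis by (simp add: scaleR_left_diff_distrib[symmetric] graph_norm_sq_scale[OF wD])
    qed
    show "((\<lambda>t. graph_norm_sq M T (\<lambda>\<omega>. (D \<alpha> (x + t *\<^sub>R axis i 1) *\<^sub>R w \<omega> - D \<alpha> x *\<^sub>R w \<omega>) /\<^sub>R t - D (i # \<alpha>) x *\<^sub>R w \<omega>)) \<longlongrightarrow> 0) (at 0)" for \<alpha> i x
      unfolding dq graph_norm_sq_scale[OF wD] by (rule quot)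
    show "AE \<omega> in M. \<phi> x *\<^sub>R w \<omega> = 0" if "x \<notin> K" for x
      using D(6)[OF that, of "[]"] by (simp add: D(1))
  qed
  have wL2: "w \<in> L2 M" by (rule stoch_D_vec_L2(1)[OF wD])
  have grad: "grad \<phi> x $ i = D [i] x" for i
    using grad_partials[of "\<lambda>i. D [i]" \<phi>] D(2,3) unfolding D(1)[symmetric] by blast
  have pd: "pderiv_x M i (\<lambda>x \<omega>. \<phi> x *\<^sub>R w \<omega>) x \<in> L2 M \<and>
    (AE \<omega> in M. pderiv_x M i (\<lambda>x \<omega>. \<phi> x *\<^sub>R w \<omega>) x \<omega> = D [i] x *\<^sub>R w \<omega>)" for i
  proof -
    define q where "q t \<omega> = (\<phi> (x + t *\<^sub>R axis i 1) *\<^sub>R w \<omega> - \<phi> x *\<^sub>R w \<omega>) /\<^sub>R t" for t \<omega>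
    have q: "q t \<in> L2 M" for t
      unfolding q_def[abs_def] by (intro L2_scaleR L2_diff wL2)
    have lim: "((\<lambda>t. LINT \<omega>|M. (norm (q t \<omega> - D [i] x *\<^sub>R w \<omega>))\<^sup>2) \<longlongrightarrow> 0) (at 0)"
    proof -
      have "q t \<omega> - D [i] x *\<^sub>R w \<omega> = ((D [] (x + t *\<^sub>R axis i 1) - D [] x) / t - D [i] x) *\<^sub>R w \<omega>" for t \<omega>
        by (simp add: q_def D(1) scaleR_left_diff_distrib[symmetric] divide_inverse mult.commute)
      then have "(LINT \<omega>|M. (norm (q t \<omega> - D [i] x *\<^sub>R w \<omega>))\<^sup>2) = ((D [] (x + t *\<^sub>R axis i 1) - D [] x) / t - D [i] x)\<^sup>2 * (LINT \<omega>|M. (norm (w \<omega>))\<^sup>2)" for t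
        by (simp add: power_mult_distrib)
      then show ?thesis using quot by simp
    qed
    have ex: "(\<lambda>\<omega>. D [i] x *\<^sub>R w \<omega>) \<in> L2 M \<and> ((\<lambda>t. LINT \<omega>|M. (norm (q t \<omega> - D [i] x *\<^sub>R w \<omega>))\<^sup>2) \<longlongrightarrow> 0) (at 0)"
      using lim L2_scaleR[OF wL2] by blast
    then have "pderiv_x M i (\<lambda>x \<omega>. \<phi> x *\<^sub>R w \<omega>) x \<in> L2 M \<and>
      ((\<lambda>t. LINT \<omega>|M. (norm (q t \<omega> - pderiv_x M i (\<lambda>x \<omega>. \<phi> x *\<^sub>R w \<omega>) x \<omega>))\<^sup>2) \<longlongrightarrow> 0) (at 0)"
      unfolding pderiv_x_def q_def
      by (rule someI[where P = "\<lambda>\<eta>. \<eta> \<in> L2 M \<and> ((\<lambda>t. LINT \<omega>|M. (norm ((\<phi> (x + t *\<^sub>R axis i 1) *\<^sub>R w \<omega> - \<phi> x *\<^sub>R w \<omega>) /\<^sub>R t - \<eta> \<omega>))\<^sup>2) \<longlongrightarrow> 0) (at 0)"])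
    then show ?thesis using L2_limit_unique[OF q _ _ _ lim] ex by blast
  qed
  have "AE \<omega> in M. \<forall>i\<in>UNIV. pderiv_x M i (\<lambda>x \<omega>. \<phi> x *\<^sub>R w \<omega>) x \<omega> = D [i] x *\<^sub>R w \<omega>"
    using pd by (intro AE_finite_allI) auto
  then show "AE \<omega> in M. div_x M (\<lambda>x \<omega>. \<phi> x *\<^sub>R w \<omega>) x \<omega> = grad \<phi> x \<bullet> w \<omega>"
    by eventually_elim (simp add: div_x_def inner_vec_def grad)
  show "div_x M (\<lambda>x \<omega>. \<phi> x *\<^sub>R w \<omega>) x \<in> borel_measurable M"
    unfolding div_x_def[abs_def] using pd L2_measurable[OF L2_nth] by (intro borel_measurable_sum) blast
qed

end

context electrokinetic_cell
begin

lemma L2_M_extend: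
  assumes "w \<in> L2 R"
  shows "(\<lambda>\<omega>. indicator F \<omega> *\<^sub>R w \<omega>) \<in> L2 M"
proof -
  have "(norm (indicat_real F \<omega> *\<^sub>R w \<omega>))\<^sup>2 = indicat_real F \<omega> *\<^sub>R (norm (w \<omega>))\<^sup>2" for \<omega>
    by (simp add: indicator_def)
  then show ?thesis
    using assms by (simp add: L2_def integrable_restrict_space borel_measurable_restrict_space_iff)
qed

lemma pair_axis_expand:
  fixes c :: "real^'n"
  assumes "f \<in> L2 R"
  shows "pair j (\<lambda>_. c) f = (\<Sum>k\<in>UNIV. c $ k * pair j (\<lambda>_. axis k 1) f)"
proof -
  have "c \<bullet> f \<omega> = (\<Sum>k\<in>UNIV. c $ k * (axis k 1 \<bullet> f \<omega>))" for \<omega>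
    by (simp add: inner_vec_def[of c] inner_axis')
  then show ?thesis
    unfolding pair_def using weight_integrable[OF L2_R_const assms, of j "axis _ 1"]
    by (simp add: sum_distrib_left mult.left_commute)
qed

end

section \<open>Square integrability in the macroscopic variable and conservation of the ionic
  fluxes\<close>

locale two_scale = cell_problems M T F z Pe n v \<Theta>
  for M :: "'w measure" and T :: "real^'n \<Rightarrow> 'w \<Rightarrow> 'w" and F :: "'w set"
    and z :: "'s::finite \<Rightarrow> int" and Pe :: "'s \<Rightarrow> real" and n :: "'s \<Rightarrow> 'w \<Rightarrow> real"
    and v :: "'s option \<Rightarrow> 'n \<Rightarrow> 'w \<Rightarrow> real^'n" and \<Theta> :: "'s option \<Rightarrow> 'n \<Rightarrow> 's \<Rightarrow> 'w \<Rightarrow> real^'n" +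
  fixes G :: "(real^'n) set" and E f :: "real^'n \<Rightarrow> real^'n" and u :: "real^'n \<Rightarrow> 'w \<Rightarrow> real^'n"
    and P :: "real^'n \<Rightarrow> real" and \<Phi>0 :: "'s \<Rightarrow> real^'n \<Rightarrow> real" and \<Phi>1 :: "'s \<Rightarrow> real^'n \<Rightarrow> 'w \<Rightarrow> real^'n"
  assumes G: "open G" "bounded G" and E: "E \<in> L2 (lebesgue_on G)" and f: "f \<in> L2 (lebesgue_on G)"
    and sol: "two_scale_solution M T F G z Pe n E f u P \<Phi>0 \<Phi>1"
begin

abbreviation N :: "(real^'n) measure" where "N \<equiv> lebesgue_on G"

lemma G_sets: "G \<in> sets lebesgue" using G(1) by auto

lemma finite_N: "finite_measure N"
  using G by (intro finite_measure_lebesgue_on lmeasurable_open)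

lemma u_V: "u \<in> V_space M T F G" and P_L2: "P \<in> L2 N" and \<Phi>0_H10: "\<Phi>0 j \<in> H1_0 G" and \<Phi>1_L2_X: "\<Phi>1 j \<in> L2_X M T F G"
  using sol unfolding two_scale_solution_def L2_zero_mean_def by auto

lemma u_L2: "(\<lambda>(x, \<omega>). u x \<omega>) \<in> L2 (N \<Otimes>\<^sub>M M)"
  using u_V unfolding V_space_def L2_stoch_D_def by auto

lemma \<Phi>1_L2: "(\<lambda>(x, \<omega>). \<Phi>1 j x \<omega>) \<in> L2 (N \<Otimes>\<^sub>M R)"
  using \<Phi>1_L2_X unfolding L2_X_def by auto

lemma AE_W_X: "AE x in N. u x \<in> W_space M T F \<and> (\<forall>j. \<Phi>1 j x \<in> X_space M T F)"
proof -
  have "AE x in N. \<forall>j\<in>UNIV. \<Phi>1 j x \<in> X_space M T F"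
    using \<Phi>1_L2_X unfolding L2_X_def by (intro AE_finite_allI) auto
  moreover have "AE x in N. u x \<in> W_space M T F" using u_V unfolding V_space_def by auto
  ultimately show ?thesis by eventually_elim auto
qed

lemma L2_N_locally_integrable:
  fixes k :: "real^'n \<Rightarrow> 'b::euclidean_space"
  assumes "k \<in> L2 N"
  shows "locally_integrable G k"
  unfolding locally_integrable_def
proof (intro allI impI)
  fix K assume K: "compact K \<and> K \<subseteq> G"
  have "integrable N k" by (rule finite_measure.L2_integrable[OF finite_N assms])
  then have "k absolutely_integrable_on G"
    using G_sets by (simp add: set_integrable_def integrable_restrict_space)
  then show "k absolutely_integrable_on K"
    by (rule set_integrable_subset) (use K in \<open>auto intro: lmeasurable_compact fmeasurableD\<close>)
qed

lemma test_integrable: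
  assumes "\<phi> \<in> test_fun G" "k \<in> L2 N"
  shows "integrable N (\<lambda>x. \<phi> x * k x)" and "integrable N (\<lambda>x. grad \<phi> x $ i * k x)"
  using locally_integrable_test_fun[OF G(1) L2_N_locally_integrable[OF assms(2)] assms(1)] by auto

text \<open>The macroscopic driving field of species \<open>j\<close>: the gradient of the ionic
  potential divided by \<open>- z j\<close>.\<close>

definition field :: "'s \<Rightarrow> real^'n \<Rightarrow> real^'n" where
  "field j x = wgrad G (\<Phi>0 j) x + E x"

lemma \<Phi>0_H1: "\<Phi>0 j \<in> H1 G" using \<Phi>0_H10 unfolding H1_0_def by auto

lemma wgrad_\<Phi>0: "wgrad G (\<Phi>0 j) \<in> L2 N" by (rule H1_wgrad(2)[OF G(1) \<Phi>0_H1])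

lemma field_L2: "field j \<in> L2 N"
  unfolding field_def[abs_def] by (intro L2_add wgrad_\<Phi>0 E)

lemma u_inner_L2: "w \<in> L2 R \<Longrightarrow> (\<lambda>x. LINT \<omega>|R. u x \<omega> \<bullet> w \<omega>) \<in> L2 N"
  using L2_partial_inner(1)[OF finite_N finite_measure_axioms u_L2 L2_M_extend]
  by (simp add: integral_restrict_space[OF F_sets])

lemma pair_u_L2: "w \<in> L2 R \<Longrightarrow> (\<lambda>x. pair j (u x) w) \<in> L2 N"
  using u_inner_L2[OF weight_L2] by (simp add: pair_def mult.left_commute)

lemma pair_\<Phi>1_L2: "w \<in> L2 R \<Longrightarrow> (\<lambda>x. pair j (\<Phi>1 j x) w) \<in> L2 N"
  using L2_partial_inner(1)[OF finite_N finite_R \<Phi>1_L2 weight_L2, of w j j] by (simp add: pair_def)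

lemma pair_const_L2:
  assumes "g \<in> L2 N" "w \<in> L2 R"
  shows "(\<lambda>x. pair j (\<lambda>_. g x) w) \<in> L2 N"
proof -
  have "(\<lambda>x. \<Sum>k\<in>UNIV. pair j (\<lambda>_. axis k 1) w *\<^sub>R g x $ k) \<in> L2 N"
    by (intro L2_sum L2_scaleR L2_nth assms(1))
  moreover have "(\<lambda>x. pair j (\<lambda>_. g x) w) = (\<lambda>x. \<Sum>k\<in>UNIV. pair j (\<lambda>_. axis k 1) w *\<^sub>R g x $ k)"
    by (rule ext, rule trans[OF pair_axis_expand[OF assms(2)]]) (simp only: mult.commute real_scaleR_def)
  ultimately show ?thesis by simp
qed

lemma ionic_flux_inner:
  assumes "u x \<in> W_space M T F" "\<And>j. \<Phi>1 j x \<in> X_space M T F"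
  shows "ionic_flux M G z Pe n E u \<Phi>0 \<Phi>1 j x \<bullet> c = real_of_int (z j) / Pe j * (pair j (\<lambda>_. field j x) (\<lambda>_. c) + pair j (\<Phi>1 j x) (\<lambda>_. c)) + pair j (u x) (\<lambda>_. c)"
proof -
  have uL: "u x \<in> L2 R" and \<Phi>L: "\<Phi>1 j x \<in> L2 R" using assms W_L2_R X_L2_R by auto
  define g where "g \<omega> = field j x + \<Phi>1 j x \<omega> + (Pe j / real_of_int (z j)) *\<^sub>R u x \<omega>" for \<omega>
  have g: "g \<in> L2 R" unfolding g_def[abs_def] by (intro L2_add L2_scaleR uL \<Phi>L L2_R_const)
  have "(LINT \<omega>|M. n j \<omega> *\<^sub>R g \<omega>) = (LINT \<omega>|R. n j \<omega> *\<^sub>R g \<omega>)"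
    unfolding integral_restrict_space[OF F_sets]
  proof (intro Bochner_Integration.integral_cong refl)
    show "n j \<omega> *\<^sub>R g \<omega> = indicator F \<omega> *\<^sub>R (n j \<omega> *\<^sub>R g \<omega>)" for \<omega>
      by (cases "\<omega> \<in> F") (auto simp: n_off)
  qed
  then have "ionic_flux M G z Pe n E u \<Phi>0 \<Phi>1 j x \<bullet> c = real_of_int (z j) / Pe j * ((LINT \<omega>|R. n j \<omega> *\<^sub>R g \<omega>) \<bullet> c)"
    by (simp add: ionic_flux_def g_def field_def)
  also have "(LINT \<omega>|R. n j \<omega> *\<^sub>R g \<omega>) \<bullet> c = pair j g (\<lambda>_. c)"
    unfolding pair_def using finite_measure.L2_integrable[OF finite_R weight_L2[OF g]]
    by (subst integral_inner_left[symmetric]) auto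
  also have "\<dots> = pair j (\<lambda>_. field j x) (\<lambda>_. c) + pair j (\<Phi>1 j x) (\<lambda>_. c) + Pe j / real_of_int (z j) * pair j (u x) (\<lambda>_. c)"
    unfolding g_def[abs_def]
    by (subst pair_add, (intro L2_add L2_scaleR uL \<Phi>L L2_R_const)+, subst pair_add, (intro uL \<Phi>L L2_R_const)+)
       (simp add: pair_scale)
  finally show ?thesis using z[of j] Pe[of j] by (simp add: distrib_left)
qed

lemma ionic_flux_L2: "ionic_flux M G z Pe n E u \<Phi>0 \<Phi>1 j \<in> L2 N"
proof -
  have "(\<lambda>x. ionic_flux M G z Pe n E u \<Phi>0 \<Phi>1 j x $ l) \<in> L2 N" for l
  proof -
    define k where "k x = real_of_int (z j) / Pe j * (pair j (\<lambda>_. field j x) (\<lambda>_. axis l 1) + pair j (\<Phi>1 j x) (\<lambda>_. axis l 1)) + pair j (u x) (\<lambda>_. axis l 1)" for x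
    have k: "k \<in> L2 N"
      unfolding k_def[abs_def] real_scaleR_def[symmetric]
      by (intro L2_add L2_scaleR pair_const_L2 pair_\<Phi>1_L2 pair_u_L2 field_L2 L2_R_const)
    have ae: "AE x in N. k x = ionic_flux M G z Pe n E u \<Phi>0 \<Phi>1 j x $ l"
      using AE_W_X by eventually_elim (use ionic_flux_inner[of _ j "axis l 1"] in \<open>simp add: k_def inner_axis\<close>)
    have m: "(\<lambda>x. ionic_flux M G z Pe n E u \<Phi>0 \<Phi>1 j x $ l) \<in> borel_measurable N"
      by (rule borel_measurable_lebesgue_on_AE[OF L2_measurable[OF k] G_sets ae])
    \<comment> \<open>The flux component equals \<open>k\<close> only where \<open>u x\<close> and
      \<open>\<Phi>1 j x\<close> lie in their spaces, that is almost everywhere.\<close>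
    show ?thesis by (rule L2_bound[OF k m, of 1]) (use ae in \<open>auto elim: eventually_mono\<close>)
  qed
  from L2_vec_lambda[of "\<lambda>l x. ionic_flux M G z Pe n E u \<Phi>0 \<Phi>1 j x $ l", OF this] show ?thesis by simp
qed

lemma weak_form:
  assumes "\<xi> \<in> test_W M T F G" "\<And>j. \<phi> j \<in> test_fun G" "\<And>j. g j \<in> L2_X M T F G"
  shows "int_GF M F G (\<lambda>x \<omega>. stoch_jac M T (u x) \<omega> \<bullet> stoch_jac M T (\<xi> x) \<omega>)
        - int_GF M F G (\<lambda>x \<omega>. P x * div_x M \<xi> x \<omega>)
        + (\<Sum>j\<in>UNIV. int_GF M F G (\<lambda>x \<omega>. of_int (z j) * n j \<omega> *
             (- (\<xi> x \<omega> \<bullet> (wgrad G (\<Phi>0 j) x + \<Phi>1 j x \<omega>))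
              + u x \<omega> \<bullet> (grad (\<phi> j) x + g j x \<omega>))))
        + (\<Sum>j\<in>UNIV. (of_int (z j))\<^sup>2 / Pe j * int_GF M F G (\<lambda>x \<omega>.
             n j \<omega> * ((wgrad G (\<Phi>0 j) x + \<Phi>1 j x \<omega>) \<bullet> (grad (\<phi> j) x + g j x \<omega>))))
        = - (\<Sum>j\<in>UNIV. (of_int (z j))\<^sup>2 / Pe j * int_GF M F G (\<lambda>x \<omega>.
               n j \<omega> * (E x \<bullet> (grad (\<phi> j) x + g j x \<omega>))))
          + (\<Sum>j\<in>UNIV. int_GF M F G (\<lambda>x \<omega>. of_int (z j) * n j \<omega> * (E x \<bullet> \<xi> x \<omega>)))
          - int_GF M F G (\<lambda>x \<omega>. f x \<bullet> \<xi> x \<omega>)"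
  using sol assms unfolding two_scale_solution_def by blast

lemma L2_X_product:
  assumes \<phi>: "\<phi> \<in> test_fun G" and \<theta>: "\<theta> \<in> X_space M T F"
  shows "(\<lambda>x \<omega>. \<phi> x *\<^sub>R \<theta> \<omega>) \<in> L2_X M T F G"
proof -
  interpret N: finite_measure N by (rule finite_N)
  interpret R: finite_measure R by (rule finite_R)
  interpret NR: pair_sigma_finite N R ..
  have one: "(\<lambda>x. 1::real) \<in> L2 N" by (simp add: L2_def)
  have \<phi>m: "\<phi> \<in> borel_measurable N" using test_integrable(1)[OF \<phi> one] by auto
  have \<phi>2: "integrable N (\<lambda>x. (\<phi> x)\<^sup>2)"
  proof -
    obtain D :: "'n list \<Rightarrow> real^'n \<Rightarrow> real" and K where D: "D [] = \<phi>" "\<And>\<alpha>. continuous_on UNIV (D \<alpha>)"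
      "compact K" "K \<subseteq> G" "\<And>\<alpha> x. x \<notin> K \<Longrightarrow> D \<alpha> x = 0"
      by (rule test_funE[OF \<phi>]) (rule that)
    have "integrable N (\<lambda>x. (\<phi> x)\<^sup>2 *\<^sub>R (1 :: real))"
      by (rule locally_integrable_test[where \<phi> = "\<lambda>x. (\<phi> x)\<^sup>2" and h = "\<lambda>_. 1 :: real", OF G(1) L2_N_locally_integrable[OF one] _ D(3,4)])
         (use D(2)[of "[]"] D(5)[of _ "[]"] in \<open>auto simp: D(1) intro!: continuous_intros\<close>)
    then show ?thesis by simp
  qed
  have \<theta>L: "\<theta> \<in> L2 R" by (rule X_L2_R[OF \<theta>])
  have m: "(\<lambda>(x, \<omega>). \<phi> x *\<^sub>R \<theta> \<omega>) \<in> borel_measurable (N \<Otimes>\<^sub>M R)"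
    unfolding case_prod_beta'
    by (intro borel_measurable_scaleR measurable_compose[OF measurable_fst \<phi>m] measurable_compose[OF measurable_snd L2_measurable[OF \<theta>L]])
  have "integrable (N \<Otimes>\<^sub>M R) (\<lambda>(x, \<omega>). (\<phi> x)\<^sup>2 * (norm (\<theta> \<omega>))\<^sup>2)"
  proof (rule NR.Fubini_integrable)
    show "(\<lambda>(x, \<omega>). (\<phi> x)\<^sup>2 * (norm (\<theta> \<omega>))\<^sup>2) \<in> borel_measurable (N \<Otimes>\<^sub>M R)"
      unfolding case_prod_beta'
      by (intro borel_measurable_times borel_measurable_power measurable_compose[OF measurable_fst \<phi>m]
          measurable_compose[OF measurable_compose[OF measurable_snd L2_measurable[OF \<theta>L]] borel_measurable_norm])
  qed (use \<phi>2 \<theta>L in \<open>auto simp: L2_def abs_mult\<close>)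
  then have "(\<lambda>(x, \<omega>). \<phi> x *\<^sub>R \<theta> \<omega>) \<in> L2 (N \<Otimes>\<^sub>M R)"
    using m by (simp add: L2_def case_prod_beta' power_mult_distrib)
  then show ?thesis unfolding L2_X_def using X_space_scale[OF \<theta>] by auto
qed

lemma zero_X: "(\<lambda>\<omega>. 0) \<in> X_space M T F"
  using X_space_scale[OF \<Theta>_X, of 0] by simp

text \<open>Testing with zero velocity, zero microscopic potentials and a single macroscopic
  potential \<psi> leaves the equation of species \<open>i\<close>, which is \<open>z i\<close>
  times the weak divergence of its flux.\<close>

lemma ionic_flux_div: "has_weak_div G (ionic_flux M G z Pe n E u \<Phi>0 \<Phi>1 i) (\<lambda>x. 0)"
  unfolding has_weak_div_def
proof (intro conjI ballI ionic_flux_L2)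
  show "(\<lambda>x. 0) \<in> L2 N" by (simp add: L2_def)
  fix \<psi> assume \<psi>: "\<psi> \<in> test_fun G"
  let ?J = "ionic_flux M G z Pe n E u \<Phi>0 \<Phi>1 i"
  have W0: "(\<lambda>\<omega>. 0 :: real^'n) \<in> W_space M T F" using W_space_scale[OF v_W, of 0] by simp
  \<comment> \<open>Even for the zero field, generators and \<open>x\<close>-derivatives are chosen
    representatives and hence zero only almost everywhere.\<close>
  have jac0: "AE \<omega> in R. stoch_jac M T (\<lambda>\<omega>. 0 :: real^'n) \<omega> = 0"
    using AE_R[OF stoch_jac_scale(2)[of "v None (SOME k. True)" 0]] v_W unfolding W_space_def by auto
  have div0: "AE \<omega> in R. div_x M (\<lambda>x \<omega>. 0 :: real^'n) x \<omega> = 0" for x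
    using AE_R[OF test_W_product(2)[OF test_fun_zero W0, of x]] by (simp add: grad_zero)
  have A: "int_GF M F G (\<lambda>x \<omega>. stoch_jac M T (u x) \<omega> \<bullet> stoch_jac M T (\<lambda>\<omega>. 0 :: real^'n) \<omega>) = 0"
  proof -
    have "(LINT \<omega>|R. stoch_jac M T (u x) \<omega> \<bullet> stoch_jac M T (\<lambda>\<omega>. 0 :: real^'n) \<omega>) = 0" for x
      by (rule integral_eq_zero_AE) (use jac0 in \<open>eventually_elim, simp\<close>)
    then show ?thesis by (simp add: int_GF_def)
  qed
  have B: "int_GF M F G (\<lambda>x \<omega>. P x * div_x M (\<lambda>x \<omega>. 0 :: real^'n) x \<omega>) = 0"
  proof -
    have eq: "(LINT \<omega>|R. P x * div_x M (\<lambda>x \<omega>. 0 :: real^'n) x \<omega>) = 0" for x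
      by (rule integral_eq_zero_AE) (use div0[of x] in \<open>eventually_elim, simp\<close>)
    show ?thesis unfolding int_GF_def eq by simp
  qed
  define \<phi> where "\<phi> j = (if j = i then \<psi> else (\<lambda>x. 0))" for j
  have \<phi>: "\<phi> j \<in> test_fun G" for j by (simp add: \<phi>_def \<psi> test_fun_zero)
  have single: "(\<Sum>j\<in>UNIV. h j) = h i" if "\<And>j. j \<noteq> i \<Longrightarrow> h j = 0" for h :: "'s \<Rightarrow> real"
    using that by (subst sum.remove[of UNIV i]) auto
  have other: "grad (\<phi> j) x = 0" if "j \<noteq> i" for j x using that by (simp add: \<phi>_def grad_zero)
  have g0: "(\<lambda>x \<omega>. 0 :: real^'n) \<in> L2_X M T F G" using L2_X_product[OF test_fun_zero zero_X] by simp
  have \<xi>0: "(\<lambda>x \<omega>. 0 :: real^'n) \<in> test_W M T F G" using test_W_product(1)[OF test_fun_zero W0] by simp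
  have "(\<Sum>j\<in>UNIV. int_GF M F G (\<lambda>x \<omega>. of_int (z j) * n j \<omega> * (u x \<omega> \<bullet> grad (\<phi> j) x)))
     + (\<Sum>j\<in>UNIV. (of_int (z j))\<^sup>2 / Pe j * int_GF M F G (\<lambda>x \<omega>. n j \<omega> * ((wgrad G (\<Phi>0 j) x + \<Phi>1 j x \<omega>) \<bullet> grad (\<phi> j) x)))
     = - (\<Sum>j\<in>UNIV. (of_int (z j))\<^sup>2 / Pe j * int_GF M F G (\<lambda>x \<omega>. n j \<omega> * (E x \<bullet> grad (\<phi> j) x)))"
    using weak_form[OF \<xi>0 \<phi> g0] A B by (simp add: int_GF_def)
  then have eq: "int_GF M F G (\<lambda>x \<omega>. of_int (z i) * n i \<omega> * (u x \<omega> \<bullet> grad \<psi> x))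
     + (of_int (z i))\<^sup>2 / Pe i * int_GF M F G (\<lambda>x \<omega>. n i \<omega> * ((wgrad G (\<Phi>0 i) x + \<Phi>1 i x \<omega>) \<bullet> grad \<psi> x))
     + (of_int (z i))\<^sup>2 / Pe i * int_GF M F G (\<lambda>x \<omega>. n i \<omega> * (E x \<bullet> grad \<psi> x)) = 0"
    by (subst (asm) (1 2 3) single) (auto simp: other int_GF_def \<phi>_def grad_zero)
  \<comment> \<open>Expanding \<open>grad \<psi> x\<close> in coordinates writes each density as a
    sum of derivatives of \<psi> times square integrable functions of \<open>x\<close>.\<close>
  define a b c where "a x = (\<Sum>k\<in>UNIV. grad \<psi> x $ k * (real_of_int (z i) * pair i (u x) (\<lambda>_. axis k 1)))"
    and "b x = (\<Sum>k\<in>UNIV. grad \<psi> x $ k * (pair i (\<lambda>_. wgrad G (\<Phi>0 i) x) (\<lambda>_. axis k 1) + pair i (\<Phi>1 i x) (\<lambda>_. axis k 1)))"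
    and "c x = (\<Sum>k\<in>UNIV. grad \<psi> x $ k * pair i (\<lambda>_. E x) (\<lambda>_. axis k 1))" for x
  have int: "integrable N a" "integrable N b" "integrable N c"
  proof -
    show "integrable N a"
      unfolding a_def by (intro Bochner_Integration.integrable_sum test_integrable(2)[OF \<psi>] L2_cmult pair_u_L2 L2_R_const)
    show "integrable N b"
      unfolding b_def by (intro Bochner_Integration.integrable_sum test_integrable(2)[OF \<psi>] L2_add pair_\<Phi>1_L2 pair_const_L2 wgrad_\<Phi>0 L2_R_const)
    show "integrable N c"
      unfolding c_def by (intro Bochner_Integration.integrable_sum test_integrable(2)[OF \<psi>] pair_const_L2 E L2_R_const)
  qed
  have pax: "pair i g (\<lambda>_. grad \<psi> x) = (\<Sum>k\<in>UNIV. grad \<psi> x $ k * pair i g (\<lambda>_. axis k 1))" if "g \<in> L2 R" for g x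
    unfolding pair_commute[of i g] by (rule pair_axis_expand[OF that])
  have ea: "int_GF M F G (\<lambda>x \<omega>. of_int (z i) * n i \<omega> * (u x \<omega> \<bullet> grad \<psi> x)) = (LINT x|N. a x)"
    unfolding int_GF_def
  proof (rule integral_lebesgue_on_cong_AE[OF G_sets borel_measurable_integrable[OF int(1)]])
    show "AE x in N. (LINT \<omega>|R. of_int (z i) * n i \<omega> * (u x \<omega> \<bullet> grad \<psi> x)) = a x"
      using AE_W_X
    proof eventually_elim
      case (elim x)
      have "(LINT \<omega>|R. of_int (z i) * n i \<omega> * (u x \<omega> \<bullet> grad \<psi> x)) = of_int (z i) * pair i (u x) (\<lambda>_. grad \<psi> x)"
        by (simp add: pair_def mult.assoc)
      then show ?case using pax[of "u x" x] W_L2_R elim by (simp add: a_def sum_distrib_left mult.left_commute)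
    qed
  qed
  have eb: "int_GF M F G (\<lambda>x \<omega>. n i \<omega> * ((wgrad G (\<Phi>0 i) x + \<Phi>1 i x \<omega>) \<bullet> grad \<psi> x)) = (LINT x|N. b x)"
    unfolding int_GF_def
  proof (rule integral_lebesgue_on_cong_AE[OF G_sets borel_measurable_integrable[OF int(2)]])
    show "AE x in N. (LINT \<omega>|R. n i \<omega> * ((wgrad G (\<Phi>0 i) x + \<Phi>1 i x \<omega>) \<bullet> grad \<psi> x)) = b x"
      using AE_W_X
    proof eventually_elim
      case (elim x)
      then have \<Phi>L: "\<Phi>1 i x \<in> L2 R" using X_L2_R by blast
      have "(LINT \<omega>|R. n i \<omega> * ((wgrad G (\<Phi>0 i) x + \<Phi>1 i x \<omega>) \<bullet> grad \<psi> x)) = pair i (\<lambda>\<omega>. wgrad G (\<Phi>0 i) x + \<Phi>1 i x \<omega>) (\<lambda>_. grad \<psi> x)"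
        by (simp add: pair_def)
      also have "\<dots> = b x"
        using pax[OF \<Phi>L] pax[OF L2_R_const] by (subst pair_add[OF L2_R_const \<Phi>L L2_R_const]) (simp add: b_def sum.distrib distrib_left)
      finally show ?case .
    qed
  qed
  have ec: "int_GF M F G (\<lambda>x \<omega>. n i \<omega> * (E x \<bullet> grad \<psi> x)) = (LINT x|N. c x)"
    unfolding int_GF_def c_def using pax[OF L2_R_const] by (simp add: pair_def)
  have "(LINT x|N. ?J x \<bullet> grad \<psi> x) = (LINT x|N. (a x + (of_int (z i))\<^sup>2 / Pe i * b x + (of_int (z i))\<^sup>2 / Pe i * c x) / of_int (z i))"
  proof (rule integral_lebesgue_on_cong_AE[OF G_sets])
    show "(\<lambda>x. (a x + (of_int (z i))\<^sup>2 / Pe i * b x + (of_int (z i))\<^sup>2 / Pe i * c x) / of_int (z i)) \<in> borel_measurable N"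
      using int by auto
    show "AE x in N. ?J x \<bullet> grad \<psi> x = (a x + (of_int (z i))\<^sup>2 / Pe i * b x + (of_int (z i))\<^sup>2 / Pe i * c x) / of_int (z i)"
      using AE_W_X
    proof eventually_elim
      case (elim x)
      then have L: "\<Phi>1 i x \<in> L2 R" "u x \<in> L2 R" using X_L2_R W_L2_R by blast+
      have fe: "pair i (\<lambda>_. field i x) g = pair i (\<lambda>_. wgrad G (\<Phi>0 i) x) g + pair i (\<lambda>_. E x) g" if "g \<in> L2 R" for g
        unfolding field_def by (rule pair_add[OF L2_R_const L2_R_const that])
      have "?J x \<bullet> grad \<psi> x = real_of_int (z i) / Pe i * (pair i (\<lambda>_. wgrad G (\<Phi>0 i) x) (\<lambda>_. grad \<psi> x) + pair i (\<lambda>_. E x) (\<lambda>_. grad \<psi> x) + pair i (\<Phi>1 i x) (\<lambda>_. grad \<psi> x)) + pair i (u x) (\<lambda>_. grad \<psi> x)"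
        using ionic_flux_inner[of x i "grad \<psi> x"] elim fe[OF L2_R_const] by simp
      moreover have "a x = of_int (z i) * pair i (u x) (\<lambda>_. grad \<psi> x)"
        by (simp add: a_def pax[OF L(2)] sum_distrib_left mult.left_commute)
      moreover have "b x = pair i (\<lambda>_. wgrad G (\<Phi>0 i) x) (\<lambda>_. grad \<psi> x) + pair i (\<Phi>1 i x) (\<lambda>_. grad \<psi> x)"
        by (simp add: b_def pax[OF L(1)] pax[OF L2_R_const] sum.distrib distrib_left)
      moreover have "c x = pair i (\<lambda>_. E x) (\<lambda>_. grad \<psi> x)"
        by (simp add: c_def pax[OF L2_R_const])
      ultimately show ?case using z[of i] by (simp add: add_divide_distrib distrib_left power2_eq_square)
    qed
  qed
  also have "\<dots> = 0" using eq int unfolding ea eb ec by simp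
  finally show "(LINT x|N. ?J x \<bullet> grad \<psi> x) = - (LINT x|N. 0 * \<psi> x)" by simp
qed

end

section \<open>Momentum balance, pressure gradient and flux law\<close>

context two_scale
begin

definition mean :: "'s option \<Rightarrow> 'n \<Rightarrow> real^'n" where
  "mean a l = (LINT \<omega>|M. v a l \<omega>)"

text \<open>The load of the cell problem \<open>(a, l)\<close> at the velocity \<open>u x\<close>
  and the reversed potentials \<open>\<Phi>1 j x\<close>, in a form whose square integrability in
  \<open>x\<close> is visible.\<close>

definition load :: "'s option \<Rightarrow> 'n \<Rightarrow> real^'n \<Rightarrow> real" where
  "load a l x = (if a = None then LINT \<omega>|R. u x \<omega> \<bullet> axis l 1 else 0)
    + (\<Sum>j\<in>UNIV. real_of_int (z j) * pair j (u x) (\<lambda>_. unit (a, l) j)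
        + (real_of_int (z j))\<^sup>2 / Pe j * pair j (\<Phi>1 j x) (\<lambda>_. unit (a, l) j))"

text \<open>Collects all terms of the tested momentum balance except the pressure; it will turn out
  to be minus the component of the pressure gradient along \<open>mean a l\<close>.\<close>

definition resid :: "'s option \<Rightarrow> 'n \<Rightarrow> real^'n \<Rightarrow> real" where
  "resid a l x = load a l x + f x \<bullet> mean a l
    - (\<Sum>j\<in>UNIV. real_of_int (z j) * pair j (\<lambda>_. field j x) (v a l)
        + (real_of_int (z j))\<^sup>2 / Pe j * pair j (\<lambda>_. field j x) (\<Theta> a l j))"

lemma load_L2: "load a l \<in> L2 N"
proof -
  have "(\<lambda>x. if a = None then LINT \<omega>|R. u x \<omega> \<bullet> axis l 1 else 0) \<in> L2 N"
    using u_inner_L2[OF L2_R_const, of "axis l 1"] by (cases a) (auto simp: L2_def)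
  then show ?thesis
    unfolding load_def[abs_def] by (rule L2_add) (intro L2_sum L2_add L2_cmult pair_u_L2 pair_\<Phi>1_L2 L2_R_const)
qed

lemma resid_L2: "resid a l \<in> L2 N"
  unfolding resid_def[abs_def]
  by (intro L2_diff L2_add[OF load_L2 L2_inner_const[OF f]] L2_sum L2_add L2_cmult pair_const_L2 field_L2 v_L2 \<Theta>_L2)

text \<open>Expresses \<open>dirichlet (u x) (v a l)\<close>, whose representatives need not be
  jointly measurable in \<open>x\<close> and \<omega>, through pairings that are square integrable
  in \<open>x\<close>. It is the cell problem \<open>(a, l)\<close> tested with the two-scale
  solution, followed by the exchange of arguments.\<close>

lemma load_eq:
  assumes "u x \<in> W_space M T F" "\<And>j. \<Phi>1 j x \<in> X_space M T F"
  shows "load a l x = dirichlet (u x) (v a l)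
    + (\<Sum>j\<in>UNIV. - real_of_int (z j) * (pair j (u x) (\<Theta> a l j) + pair j (\<Phi>1 j x) (v a l))
        - (real_of_int (z j))\<^sup>2 / Pe j * pair j (\<Phi>1 j x) (\<Theta> a l j))"
proof -
  have L: "u x \<in> L2 R" "\<And>j. \<Phi>1 j x \<in> L2 R" using assms W_L2_R X_L2_R by auto
  have "load a l x = cell_load M F z Pe n a l (u x) (\<lambda>j \<omega>. - \<Phi>1 j x \<omega>)"
    unfolding cell_load_expand[OF L(1) L2_minus[OF L(2)]] load_def
    by (simp add: pair_minus inner_axis pair_commute[of _ "u x"] pair_commute[of _ "\<Phi>1 _ x"])
  also have "\<dots> = cell_form M T F z Pe n (v a l) (\<Theta> a l) (u x) (\<lambda>j \<omega>. - \<Phi>1 j x \<omega>)"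
    by (rule cell_test[symmetric, OF assms(1) X_minus[OF assms(2)]])
  also have "\<dots> = cell_form M T F z Pe n (u x) (\<lambda>j. \<Phi>1 j x) (v a l) (\<lambda>j \<omega>. - \<Theta> a l j \<omega>)"
    by (rule cell_form_swap) (intro v_L2 \<Theta>_L2 L)+
  also have "\<dots> = dirichlet (u x) (v a l)
    + (\<Sum>j\<in>UNIV. - real_of_int (z j) * (pair j (u x) (\<Theta> a l j) + pair j (\<Phi>1 j x) (v a l))
        - (real_of_int (z j))\<^sup>2 / Pe j * pair j (\<Phi>1 j x) (\<Theta> a l j))"
    unfolding cell_form_expand[OF L(1) v_L2 L(2) L2_minus[OF \<Theta>_L2]]
    by (simp add: pair_minus algebra_simps)
  finally show ?thesis .
qed

text \<open>
  Tested with \<open>\<phi>\<close> times a cell solution, the form equals the form of the cell problem tested with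
  the two-scale solution (the skew part changes sign with \<open>\<Theta>\<close>), so that only \<open>P\<close> is differentiated.
\<close>

lemma momentum_test:
  assumes \<phi>: "\<phi> \<in> test_fun G"
  shows "(LINT x|N. \<phi> x * resid a l x) = (LINT x|N. P x * (grad \<phi> x \<bullet> mean a l))"
proof -
  \<comment> \<open>By \<open>load_eq\<close> this is \<open>dirichlet (u x) (v a l)\<close> for
    almost every \<open>x\<close>. The functions \<open>k3\<close> to \<open>k6\<close> are the
    \<open>x\<close>-densities of the remaining terms of the weak form, with \<phi> factored
    out.\<close>
  define D where "D x = load a l x - (\<Sum>j\<in>UNIV. - real_of_int (z j) * (pair j (u x) (\<Theta> a l j) + pair j (\<Phi>1 j x) (v a l))
        - (real_of_int (z j))\<^sup>2 / Pe j * pair j (\<Phi>1 j x) (\<Theta> a l j))" for x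
  define k3 where "k3 j x = - real_of_int (z j) * (pair j (\<lambda>_. wgrad G (\<Phi>0 j) x) (v a l) + pair j (\<Phi>1 j x) (v a l) + pair j (u x) (\<Theta> a l j))" for j x
  define k4 where "k4 j x = - 1 * (pair j (\<lambda>_. wgrad G (\<Phi>0 j) x) (\<Theta> a l j) + pair j (\<Phi>1 j x) (\<Theta> a l j))" for j x
  define k5 where "k5 j x = - 1 * pair j (\<lambda>_. E x) (\<Theta> a l j)" for j x
  define k6 where "k6 j x = real_of_int (z j) * pair j (\<lambda>_. E x) (v a l)" for j x
  define c where "c j = (real_of_int (z j))\<^sup>2 / Pe j" for j
  have "D \<in> L2 N" unfolding D_def[abs_def]
    by (intro L2_diff[OF load_L2] L2_sum L2_diff L2_cmult L2_add pair_u_L2 pair_\<Phi>1_L2 v_L2 \<Theta>_L2)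
  then have iD: "integrable N (\<lambda>x. \<phi> x * D x)" by (rule test_integrable(1)[OF \<phi>])
  have i3: "integrable N (\<lambda>x. \<phi> x * k3 j x)" for j unfolding k3_def
    by (intro test_integrable(1)[OF \<phi>] L2_cmult L2_add pair_u_L2 pair_\<Phi>1_L2 pair_const_L2 wgrad_\<Phi>0 v_L2 \<Theta>_L2)
  have i4: "integrable N (\<lambda>x. \<phi> x * k4 j x)" for j unfolding k4_def
    by (intro test_integrable(1)[OF \<phi>] L2_cmult L2_add pair_\<Phi>1_L2 pair_const_L2 wgrad_\<Phi>0 \<Theta>_L2)
  have i5: "integrable N (\<lambda>x. \<phi> x * k5 j x)" for j unfolding k5_def
    by (intro test_integrable(1)[OF \<phi>] L2_cmult pair_const_L2 E \<Theta>_L2)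
  have i6: "integrable N (\<lambda>x. \<phi> x * k6 j x)" for j unfolding k6_def
    by (intro test_integrable(1)[OF \<phi>] L2_cmult pair_const_L2 E v_L2)
  have i7: "integrable N (\<lambda>x. \<phi> x * (f x \<bullet> mean a l))"
    by (rule test_integrable(1)[OF \<phi> L2_inner_const[OF f]])
  define \<xi> where "\<xi> x \<omega> = \<phi> x *\<^sub>R v a l \<omega>" for x \<omega>
  \<comment> \<open>The potentials are reversed to match the exchange used in
    \<open>load_eq\<close>; the macroscopic test potentials are zero.\<close>
  define g where "g j x \<omega> = \<phi> x *\<^sub>R (- \<Theta> a l j \<omega>)" for j x \<omega>
  have T1: "int_GF M F G (\<lambda>x \<omega>. stoch_jac M T (u x) \<omega> \<bullet> stoch_jac M T (\<xi> x) \<omega>) = (LINT x|N. \<phi> x * D x)"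
    unfolding int_GF_def
  proof (rule integral_lebesgue_on_cong_AE[OF G_sets borel_measurable_integrable[OF iD]])
    show "AE x in N. (LINT \<omega>|R. stoch_jac M T (u x) \<omega> \<bullet> stoch_jac M T (\<xi> x) \<omega>) = \<phi> x * D x"
      using AE_W_X
    proof eventually_elim
      case (elim x)
      have \<xi>x: "\<xi> x = (\<lambda>\<omega>. \<phi> x *\<^sub>R v a l \<omega>)" by (simp add: \<xi>_def fun_eq_iff)
      have \<xi>W: "\<xi> x \<in> W_space M T F" unfolding \<xi>_def by (rule W_space_scale[OF v_W])
      have "v a l \<in> stoch_D_vec M T" using v_W unfolding W_space_def by auto
      from AE_R[OF stoch_jac_scale(2)[OF this, of "\<phi> x"]]
      have "(LINT \<omega>|R. stoch_jac M T (u x) \<omega> \<bullet> stoch_jac M T (\<xi> x) \<omega>) = (LINT \<omega>|R. \<phi> x * (stoch_jac M T (u x) \<omega> \<bullet> stoch_jac M T (v a l) \<omega>))"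
        using elim \<xi>W v_W[of a l]
        by (intro integral_cong_AE borel_measurable_integrable L2_integrable_inner integrable_mult_right W_L2_R(2))
           (auto elim!: eventually_mono simp: \<xi>x)
      then show ?case using load_eq[where x = x and a = a and l = l] elim by (simp add: D_def dirichlet_def)
    qed
  qed
  have T2: "int_GF M F G (\<lambda>x \<omega>. P x * div_x M \<xi> x \<omega>) = (LINT x|N. P x * (grad \<phi> x \<bullet> mean a l))"
    unfolding int_GF_def
  proof (rule Bochner_Integration.integral_cong[OF refl])
    fix x
    have ae: "AE \<omega> in R. v a l \<omega> \<bullet> grad \<phi> x = div_x M \<xi> x \<omega>"
      using AE_R[OF test_W_product(2)[OF \<phi> v_W[of a l], of x]] unfolding \<xi>_def by eventually_elim (simp add: inner_commute)
    have "(LINT \<omega>|R. div_x M \<xi> x \<omega>) = mean a l \<bullet> grad \<phi> x"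
    proof -
      have "div_x M \<xi> x \<in> borel_measurable R"
        using measurable_restrict_space1[OF test_W_product(3)[OF \<phi> v_W[of a l], of x]] unfolding \<xi>_def[abs_def] .
      then have "(LINT \<omega>|R. div_x M \<xi> x \<omega>) = (LINT \<omega>|R. v a l \<omega> \<bullet> grad \<phi> x)"
        using ae L2_measurable[OF L2_inner_const[OF v_L2]] by (intro integral_cong_AE) (auto elim: eventually_mono)
      then show ?thesis using integral_W_R[OF v_W, of a l "grad \<phi> x"] by (simp add: mean_def)
    qed
    then show "(LINT \<omega>|R. P x * div_x M \<xi> x \<omega>) = P x * (grad \<phi> x \<bullet> mean a l)" by (simp add: inner_commute)
  qed
  have T3: "int_GF M F G (\<lambda>x \<omega>. of_int (z j) * n j \<omega> * (- (\<xi> x \<omega> \<bullet> (wgrad G (\<Phi>0 j) x + \<Phi>1 j x \<omega>)) + u x \<omega> \<bullet> (grad (\<lambda>x. 0) x + g j x \<omega>)))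
     = (LINT x|N. \<phi> x * k3 j x)" for j
    unfolding int_GF_def
  proof (rule integral_lebesgue_on_cong_AE[OF G_sets borel_measurable_integrable[OF i3]])
    show "AE x in N. (LINT \<omega>|R. of_int (z j) * n j \<omega> * (- (\<xi> x \<omega> \<bullet> (wgrad G (\<Phi>0 j) x + \<Phi>1 j x \<omega>)) + u x \<omega> \<bullet> (grad (\<lambda>x. 0) x + g j x \<omega>)))
      = \<phi> x * k3 j x"
      using AE_W_X
    proof eventually_elim
      case (elim x)
      then have L: "u x \<in> L2 R" "\<Phi>1 j x \<in> L2 R" using W_L2_R X_L2_R by auto
      have "(LINT \<omega>|R. of_int (z j) * n j \<omega> * (- (\<xi> x \<omega> \<bullet> (wgrad G (\<Phi>0 j) x + \<Phi>1 j x \<omega>)) + u x \<omega> \<bullet> (grad (\<lambda>x. 0) x + g j x \<omega>)))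
        = (LINT \<omega>|R. (\<phi> x * - real_of_int (z j)) * (n j \<omega> * (wgrad G (\<Phi>0 j) x \<bullet> v a l \<omega>) + n j \<omega> * (\<Phi>1 j x \<omega> \<bullet> v a l \<omega>) + n j \<omega> * (u x \<omega> \<bullet> \<Theta> a l j \<omega>)))"
        by (intro Bochner_Integration.integral_cong refl)
           (simp add: \<xi>_def g_def grad_zero inner_add_right inner_commute[of "v a l _"] algebra_simps)
      also have "\<dots> = \<phi> x * k3 j x"
        using weight_integrable[OF L2_R_const v_L2, of j "wgrad G (\<Phi>0 j) x" a l] weight_integrable[OF L(2) v_L2, of j a l] weight_integrable[OF L(1) \<Theta>_L2, of j a l j]
        unfolding k3_def pair_def by (subst integral_mult_right_zero) (simp add: mult.assoc)
      finally show ?case .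
    qed
  qed
  have T4: "int_GF M F G (\<lambda>x \<omega>. n j \<omega> * ((wgrad G (\<Phi>0 j) x + \<Phi>1 j x \<omega>) \<bullet> (grad (\<lambda>x. 0) x + g j x \<omega>))) = (LINT x|N. \<phi> x * k4 j x)" for j
    unfolding int_GF_def
  proof (rule integral_lebesgue_on_cong_AE[OF G_sets borel_measurable_integrable[OF i4]])
    show "AE x in N. (LINT \<omega>|R. n j \<omega> * ((wgrad G (\<Phi>0 j) x + \<Phi>1 j x \<omega>) \<bullet> (grad (\<lambda>x. 0) x + g j x \<omega>))) = \<phi> x * k4 j x"
      using AE_W_X
    proof eventually_elim
      case (elim x)
      then have L: "\<Phi>1 j x \<in> L2 R" using X_L2_R by auto
      have "(LINT \<omega>|R. n j \<omega> * ((wgrad G (\<Phi>0 j) x + \<Phi>1 j x \<omega>) \<bullet> (grad (\<lambda>x. 0) x + g j x \<omega>)))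
        = (LINT \<omega>|R. (\<phi> x * - 1) * (n j \<omega> * (wgrad G (\<Phi>0 j) x \<bullet> \<Theta> a l j \<omega>) + n j \<omega> * (\<Phi>1 j x \<omega> \<bullet> \<Theta> a l j \<omega>)))"
        by (intro Bochner_Integration.integral_cong refl)
           (simp add: g_def grad_zero inner_add_left algebra_simps)
      also have "\<dots> = \<phi> x * k4 j x"
        using weight_integrable[OF L2_R_const \<Theta>_L2, of j "wgrad G (\<Phi>0 j) x" a l j] weight_integrable[OF L \<Theta>_L2, of j a l j]
        unfolding k4_def pair_def by (subst integral_mult_right_zero) (simp add: algebra_simps)
      finally show ?case .
    qed
  qed
  have T5: "int_GF M F G (\<lambda>x \<omega>. n j \<omega> * (E x \<bullet> (grad (\<lambda>x. 0) x + g j x \<omega>))) = (LINT x|N. \<phi> x * k5 j x)" for j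
    unfolding int_GF_def k5_def pair_def
    by (simp add: g_def grad_zero mult.left_commute[of "n j _" "\<phi> _"])
  have T6: "int_GF M F G (\<lambda>x \<omega>. of_int (z j) * n j \<omega> * (E x \<bullet> \<xi> x \<omega>)) = (LINT x|N. \<phi> x * k6 j x)" for j
  proof -
    have "(LINT \<omega>|R. of_int (z j) * n j \<omega> * (E x \<bullet> \<xi> x \<omega>)) = \<phi> x * k6 j x" for x
    proof -
      have "(LINT \<omega>|R. of_int (z j) * n j \<omega> * (E x \<bullet> \<xi> x \<omega>)) = (LINT \<omega>|R. (\<phi> x * of_int (z j)) * (n j \<omega> * (E x \<bullet> v a l \<omega>)))"
        by (intro Bochner_Integration.integral_cong refl) (simp add: \<xi>_def algebra_simps)
      then show ?thesis by (simp add: k6_def pair_def mult.assoc)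
    qed
    then show ?thesis by (simp add: int_GF_def)
  qed
  have T7: "int_GF M F G (\<lambda>x \<omega>. f x \<bullet> \<xi> x \<omega>) = (LINT x|N. \<phi> x * (f x \<bullet> mean a l))"
  proof -
    have "(LINT \<omega>|R. f x \<bullet> \<xi> x \<omega>) = \<phi> x * (f x \<bullet> mean a l)" for x
      using integral_W_R[OF v_W, of a l "f x"] by (simp add: \<xi>_def mean_def inner_commute[of "f x"])
    then show ?thesis by (simp add: int_GF_def)
  qed
  have "(\<lambda>x \<omega>. \<phi> x *\<^sub>R v a l \<omega>) \<in> test_W M T F G" by (rule test_W_product(1)[OF \<phi> v_W])
  then have \<xi>: "\<xi> \<in> test_W M T F G" unfolding \<xi>_def[abs_def] .
  have g: "g j \<in> L2_X M T F G" for j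
    using L2_X_product[OF \<phi> X_minus[OF \<Theta>_X]] unfolding g_def[abs_def] .
  have eq: "(LINT x|N. \<phi> x * D x) - (LINT x|N. P x * (grad \<phi> x \<bullet> mean a l)) + (\<Sum>j\<in>UNIV. LINT x|N. \<phi> x * k3 j x)
    + (\<Sum>j\<in>UNIV. c j * (LINT x|N. \<phi> x * k4 j x))
    = - (\<Sum>j\<in>UNIV. c j * (LINT x|N. \<phi> x * k5 j x)) + (\<Sum>j\<in>UNIV. LINT x|N. \<phi> x * k6 j x) - (LINT x|N. \<phi> x * (f x \<bullet> mean a l))"
    using weak_form[where \<phi> = "\<lambda>_ x. 0" and g = g, OF \<xi> test_fun_zero g] unfolding T1 T2 T3 T4 T5 T6 T7 c_def .
  have res: "\<phi> x * resid a l x = \<phi> x * D x + (\<Sum>j\<in>UNIV. \<phi> x * k3 j x) + (\<Sum>j\<in>UNIV. c j * (\<phi> x * k4 j x)) + (\<Sum>j\<in>UNIV. c j * (\<phi> x * k5 j x))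
    - (\<Sum>j\<in>UNIV. \<phi> x * k6 j x) + \<phi> x * (f x \<bullet> mean a l)" for x
  proof -
    have fe: "pair j (\<lambda>_. field j x) h = pair j (\<lambda>_. wgrad G (\<Phi>0 j) x) h + pair j (\<lambda>_. E x) h" if "h \<in> L2 R" for h j
      unfolding field_def by (rule pair_add[OF L2_R_const L2_R_const that])
    have "resid a l x = D x + (\<Sum>j\<in>UNIV. k3 j x + c j * k4 j x + c j * k5 j x - k6 j x) + f x \<bullet> mean a l"
      unfolding resid_def D_def fe[OF v_L2] fe[OF \<Theta>_L2] k3_def k4_def k5_def k6_def c_def
      by (simp add: sum.distrib sum_subtractf sum_negf algebra_simps)
    then show ?thesis
      by (simp add: sum.distrib sum_subtractf distrib_left right_diff_distrib sum_distrib_left mult.left_commute)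
  qed
  have "(LINT x|N. \<phi> x * resid a l x) = (LINT x|N. \<phi> x * D x) + (\<Sum>j\<in>UNIV. LINT x|N. \<phi> x * k3 j x)
    + (\<Sum>j\<in>UNIV. c j * (LINT x|N. \<phi> x * k4 j x)) + (\<Sum>j\<in>UNIV. c j * (LINT x|N. \<phi> x * k5 j x))
    - (\<Sum>j\<in>UNIV. LINT x|N. \<phi> x * k6 j x) + (LINT x|N. \<phi> x * (f x \<bullet> mean a l))"
    unfolding res using iD i3 i4 i5 i6 i7 by simp
  with eq show ?thesis by linarith
qed

text \<open>The fluid block inherits positive definiteness and is therefore invertible, so
  combinations of the fluid cell solutions have any prescribed mean.\<close>

lemma K_columns_span: "\<exists>c. (\<Sum>l\<in>UNIV. c l *\<^sub>R mean None l) = axis i (1::real)"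
proof -
  define K where "K = K_mat M v"
  have K_entry: "K $ l $ k = mean None k $ l" for l k
  proof -
    have "(LINT \<omega>|M. v None k \<omega> \<bullet> axis l 1) = (LINT \<omega>|M. v None k \<omega>) \<bullet> axis l 1"
      by (rule integral_inner_left) (rule L2_integrable[OF W_L2(1)[OF v_W]])
    then show ?thesis by (simp add: K_def K_mat_def mean_def inner_axis)
  qed
  have pos: "0 < x \<bullet> (K *v x)" if "x \<noteq> 0" for x
  proof -
    \<comment> \<open>A vector supported in the fluid block reduces the quadratic form of the tensor
      to that of \<open>K\<close>.\<close>
    define \<eta> where "\<eta> = block_vec x (\<lambda>_::'s. 0)"
    have \<eta>: "\<eta> $ (None, k) = x $ k" "\<eta> $ (Some j, k) = 0" for j k by (simp_all add: \<eta>_def block_vec_def)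
    have sum: "(\<Sum>p\<in>UNIV. h p) = (\<Sum>k\<in>UNIV. h (None, k))" if "\<And>j k. h (Some j, k) = 0" for h :: "'s option \<times> 'n \<Rightarrow> real"
    proof -
      have "(\<Sum>p\<in>UNIV. h p) = (\<Sum>a\<in>UNIV. \<Sum>k\<in>UNIV. h (a, k))"
        by (simp add: sum.cartesian_product UNIV_Times_UNIV[symmetric] del: UNIV_Times_UNIV)
      also have "\<dots> = (\<Sum>k\<in>UNIV. h (None, k))"
        using that by (simp add: UNIV_option_conv sum.reindex)
      finally show ?thesis .
    qed
    have "\<eta> \<bullet> (B_mat M z Pe n v \<Theta> *v \<eta>) = (\<Sum>p\<in>UNIV. \<eta> $ p * (\<Sum>q\<in>UNIV. B_mat M z Pe n v \<Theta> $ p $ q * \<eta> $ q))"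
      by (simp add: inner_vec_def matrix_vector_mult_def)
    also have "\<dots> = (\<Sum>l\<in>UNIV. x $ l * (\<Sum>k\<in>UNIV. K $ l $ k * x $ k))"
      by (subst sum, simp add: \<eta>, subst sum, simp add: \<eta>, simp add: \<eta> B_mat_def K_def)
    also have "\<dots> = x \<bullet> (K *v x)" by (simp add: inner_vec_def matrix_vector_mult_def)
    finally have "\<eta> \<bullet> (B_mat M z Pe n v \<Theta> *v \<eta>) = x \<bullet> (K *v x)" .
    moreover have "\<eta> \<noteq> 0" using that \<eta>(1) by (metis vec_eq_iff zero_index)
    ultimately show ?thesis using B_positive[of \<eta>] by simp
  qed
  have "inj ((*v) K)"
  proof (rule injI)
    fix x y assume "K *v x = K *v y"
    then have "K *v (x - y) = 0" by (simp add: matrix_vector_mult_diff_distrib)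
    then show "x = y" using pos[of "x - y"] by fastforce
  qed
  then have "surj ((*v) K)"
    by (intro linear_injective_imp_surjective[OF matrix_vector_mul_linear]) auto
  then obtain c where c: "K *v c = axis i 1" by (metis surjD)
  have "(\<Sum>l\<in>UNIV. c $ l *\<^sub>R mean None l) = K *v c"
    by (simp add: vec_eq_iff matrix_vector_mult_def K_entry mult.commute)
  with c show ?thesis by metis
qed

text \<open>A combination of fluid cell solutions with mean \<open>axis i 1\<close> turns
  \<open>momentum_test\<close> into the weak derivative of \<open>P\<close> in direction
  \<open>i\<close>, with the corresponding combination of \<open>resid\<close> as minus its
  value.\<close>

lemma P_weak_grad: "\<exists>g\<in>L2 N. has_weak_grad G P g"
proof -
  obtain c where c: "\<And>i. (\<Sum>l\<in>UNIV. c i l *\<^sub>R mean None l) = axis i (1::real)"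
    using K_columns_span by metis
  define g where "g x = (\<chi> i. \<Sum>l\<in>UNIV. - c i l * resid None l x)" for x
  have gi: "(\<lambda>x. \<Sum>l\<in>UNIV. - c i l * resid None l x) \<in> L2 N" for i
    by (intro L2_sum L2_cmult resid_L2)
  have g: "g \<in> L2 N" unfolding g_def[abs_def] by (rule L2_vec_lambda[OF gi])
  have ibp: "(LINT x|N. P x * grad \<phi> x $ i) = - (LINT x|N. g x $ i * \<phi> x)" if \<phi>: "\<phi> \<in> test_fun G" for \<phi> i
  proof -
    have iP: "integrable N (\<lambda>x. P x * (grad \<phi> x \<bullet> m))" for m
    proof -
      have "integrable N (\<lambda>x. \<Sum>k\<in>UNIV. m $ k * (grad \<phi> x $ k * P x))"
        by (intro Bochner_Integration.integrable_sum integrable_mult_right test_integrable(2)[OF \<phi> P_L2])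
      then show ?thesis by (simp add: inner_vec_def sum_distrib_left algebra_simps)
    qed
    have "grad \<phi> x $ i = (\<Sum>l\<in>UNIV. c i l * (grad \<phi> x \<bullet> mean None l))" for x
    proof -
      have "grad \<phi> x $ i = grad \<phi> x \<bullet> (\<Sum>l\<in>UNIV. c i l *\<^sub>R mean None l)" by (simp add: c inner_axis)
      then show ?thesis by (simp add: inner_sum_right)
    qed
    then have "(LINT x|N. P x * grad \<phi> x $ i) = (LINT x|N. (\<Sum>l\<in>UNIV. c i l * (P x * (grad \<phi> x \<bullet> mean None l))))"
      by (simp add: sum_distrib_left mult.left_commute)
    also have "\<dots> = (\<Sum>l\<in>UNIV. c i l * (LINT x|N. \<phi> x * resid None l x))"
      using iP by (simp add: momentum_test[OF \<phi>])
    also have "\<dots> = (LINT x|N. (\<Sum>l\<in>UNIV. c i l * (\<phi> x * resid None l x)))"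
      using test_integrable(1)[OF \<phi> resid_L2] by simp
    also have "\<dots> = (LINT x|N. - (g x $ i * \<phi> x))"
      by (intro Bochner_Integration.integral_cong refl) (simp add: g_def sum_distrib_right sum_distrib_left sum_negf mult.assoc mult.left_commute mult.commute)
    finally show ?thesis by simp
  qed
  have "has_weak_grad G P g"
    unfolding has_weak_grad_def by (intro conjI ballI allI L2_N_locally_integrable P_L2 g ibp)
  then show ?thesis using g by blast
qed

lemma P_H1: "P \<in> H1 G"
  unfolding H1_def using P_L2 P_weak_grad by blast

text \<open>Once \<open>P\<close> has a weak gradient, the derivative in
  \<open>momentum_test\<close> moves back to the pressure, for the species problems as well as the
  fluid ones, and the fundamental lemma gives the identity almost everywhere.\<close>

lemma pressure_gradient: "AE x in N. resid a l x + wgrad G P x \<bullet> mean a l = 0"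
proof (rule AE_zero_if_test_integrals_zero[OF G(1)])
  have gP: "wgrad G P \<in> L2 N" "has_weak_grad G P (wgrad G P)" using H1_wgrad[OF G(1) P_H1] by auto
  have L: "(\<lambda>x. resid a l x + wgrad G P x \<bullet> mean a l) \<in> L2 N"
    by (rule L2_add[OF resid_L2 L2_inner_const[OF gP(1)]])
  then show "locally_integrable G (\<lambda>x. resid a l x + wgrad G P x \<bullet> mean a l)"
    by (rule L2_N_locally_integrable)
  fix \<phi> assume \<phi>: "\<phi> \<in> test_fun G"
  have iP: "integrable N (\<lambda>x. P x * grad \<phi> x $ k)" for k
    using test_integrable(2)[OF \<phi> P_L2, of k] by (simp add: mult.commute)
  have ig: "integrable N (\<lambda>x. wgrad G P x $ k * \<phi> x)" for k
    using test_integrable(1)[OF \<phi> L2_nth[OF gP(1)], of k] by (simp add: mult.commute)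
  have "(LINT x|N. \<phi> x * resid a l x) = (LINT x|N. (\<Sum>k\<in>UNIV. mean a l $ k * (P x * grad \<phi> x $ k)))"
    unfolding momentum_test[OF \<phi>] by (simp add: inner_vec_def sum_distrib_left algebra_simps)
  also have "\<dots> = (\<Sum>k\<in>UNIV. mean a l $ k * (LINT x|N. P x * grad \<phi> x $ k))"
    using iP by simp
  also have "\<dots> = (\<Sum>k\<in>UNIV. mean a l $ k * - (LINT x|N. wgrad G P x $ k * \<phi> x))"
    using gP(2) \<phi> unfolding has_weak_grad_def by simp
  also have "\<dots> = - (LINT x|N. (\<Sum>k\<in>UNIV. mean a l $ k * (wgrad G P x $ k * \<phi> x)))"
    using ig by (simp add: sum_negf)
  also have "\<dots> = - (LINT x|N. \<phi> x * (wgrad G P x \<bullet> mean a l))"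
    by (simp add: inner_vec_def sum_distrib_left algebra_simps)
  finally have "(LINT x|N. \<phi> x * resid a l x) + (LINT x|N. \<phi> x * (wgrad G P x \<bullet> mean a l)) = 0" by simp
  then show "(LINT x|N. (resid a l x + wgrad G P x \<bullet> mean a l) * \<phi> x) = 0"
    using test_integrable(1)[OF \<phi> resid_L2, of a l] test_integrable(1)[OF \<phi> L2_inner_const[OF gP(1)], of "mean a l"]
    by (subst (asm) Bochner_Integration.integral_add[symmetric]) (auto simp: algebra_simps)
qed

text \<open>The flux contains the full gradient, \<open>field j x\<close> plus
  \<open>\<Phi>1 j x\<close>, but the load only the corrector \<open>\<Phi>1 j x\<close>; the last
  sum supplies the macroscopic part. The factor \<open>scal a\<close> is the one in
  \<open>B_row\<close>.\<close>

lemma flux_scaled: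
  assumes "u x \<in> W_space M T F" "\<And>j. \<Phi>1 j x \<in> X_space M T F"
  shows "scal a * (block_vec (mean_velocity M u x) (\<lambda>j. ionic_flux M G z Pe n E u \<Phi>0 \<Phi>1 j x) $ (a, l))
    = load a l x + (\<Sum>j\<in>UNIV. (real_of_int (z j))\<^sup>2 / Pe j * pair j (\<lambda>_. field j x) (\<lambda>_. unit (a, l) j))"
proof (cases a)
  case None
  have "mean_velocity M u x $ l = (LINT \<omega>|R. u x \<omega> \<bullet> axis l 1)"
    using integral_W_R[OF assms(1), of "axis l 1"] by (simp add: mean_velocity_def inner_axis)
  then show ?thesis using None by (simp add: load_def scal_def block_vec_def unit_def pair_def)
next
  case (Some i)
  have single: "(\<Sum>j\<in>UNIV. h j) = h i" if "\<And>j. j \<noteq> i \<Longrightarrow> h j = 0" for h :: "'s \<Rightarrow> real"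
    using that by (subst sum.remove[of UNIV i]) auto
  have un: "unit (Some i, l) i = axis l 1" "j \<noteq> i \<Longrightarrow> unit (Some i, l) j = 0" for j by (auto simp: unit_def)
  have p0: "pair j h (\<lambda>_. 0) = 0" for j h by (simp add: pair_def)
  have "ionic_flux M G z Pe n E u \<Phi>0 \<Phi>1 i x $ l = ionic_flux M G z Pe n E u \<Phi>0 \<Phi>1 i x \<bullet> axis l 1"
    by (simp add: inner_axis)
  also have "\<dots> = real_of_int (z i) / Pe i * (pair i (\<lambda>_. field i x) (\<lambda>_. axis l 1) + pair i (\<Phi>1 i x) (\<lambda>_. axis l 1)) + pair i (u x) (\<lambda>_. axis l 1)"
    by (rule ionic_flux_inner[OF assms])
  finally show ?thesis
    unfolding load_def Some
    by (subst (1 2) single) (simp_all add: un p0 scal_def block_vec_def power2_eq_square algebra_simps)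
qed

text \<open>By symmetry an entry of the row \<open>(a, l)\<close> is the load of the column's
  problem at the cell solution \<open>(a, l)\<close>, so the whole row involves only
  \<open>v a l\<close> and \<open>\<Theta> a l\<close>, as \<open>resid\<close> does. The ionic
  arguments carry \<open>- z j\<close>, which \<open>scal\<close> reduces to a sign.\<close>

lemma B_row:
  "scal a * ((B_mat M z Pe n v \<Theta> *v block_vec p (\<lambda>j. - real_of_int (z j) *\<^sub>R e j)) $ (a, l)) = p \<bullet> mean a l
    - (\<Sum>j\<in>UNIV. real_of_int (z j) * pair j (\<lambda>_. e j) (v a l) + (real_of_int (z j))\<^sup>2 / Pe j * pair j (\<lambda>_. e j) (\<Theta> a l j)
        + (real_of_int (z j))\<^sup>2 / Pe j * pair j (\<lambda>_. e j) (\<lambda>_. unit (a, l) j))"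
proof -
  define X where "X = block_vec p (\<lambda>j. - real_of_int (z j) *\<^sub>R e j)"
  define S where "S b k = scal a * (B_mat M z Pe n v \<Theta> $ (a, l) $ (b, k)) * scal b" for b k
  have single: "(\<Sum>j\<in>UNIV. h j) = h i" if "\<And>j. j \<noteq> i \<Longrightarrow> h j = 0" for i and h :: "'s \<Rightarrow> real"
    using that by (subst sum.remove[of UNIV i]) auto
  have S: "S b k = cell_load M F z Pe n b k (v a l) (\<lambda>j \<omega>. - \<Theta> a l j \<omega>)
     + (\<Sum>j\<in>UNIV. (real_of_int (z j))\<^sup>2 / Pe j * pair j (\<lambda>_. unit (a, l) j) (\<lambda>_. unit (b, k) j))" for b k
    using B_entry[where a = a and b = b and l = l and k = k] cell_load_symmetric[of a l b k]
    by (simp add: S_def mult.commute mult.left_commute)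
  have S0: "S None k = mean a l $ k" for k
    using integral_W_R[OF v_W, of a l "axis k 1"]
    by (simp add: S cell_load_def mean_def unit_def pair_def inner_axis inner_axis')
  have S1: "S (Some i) k = real_of_int (z i) * pair i (\<lambda>_. axis k 1) (v a l) + (real_of_int (z i))\<^sup>2 / Pe i * pair i (\<lambda>_. axis k 1) (\<Theta> a l i)
     + (real_of_int (z i))\<^sup>2 / Pe i * pair i (\<lambda>_. axis k 1) (\<lambda>_. unit (a, l) i)" for i k
  proof -
    have un: "unit (Some i, k) i = axis k 1" "j \<noteq> i \<Longrightarrow> unit (Some i, k) j = 0" for j by (auto simp: unit_def)
    have p0: "pair j h (\<lambda>_. 0) = 0" "pair j (\<lambda>_. 0) h = 0" for j h by (simp_all add: pair_def)
    show ?thesis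
      unfolding S cell_load_expand[OF v_L2 L2_minus[OF \<Theta>_L2]]
      by (subst (1 2) single[of i]) (simp_all add: un p0 pair_minus pair_commute[of i "\<lambda>_. unit (a, l) i"])
  qed
  have "scal a * ((B_mat M z Pe n v \<Theta> *v X) $ (a, l)) = (\<Sum>q\<in>UNIV. S (fst q) (snd q) * (X $ q / scal (fst q)))"
    using scal_nonzero by (simp add: matrix_vector_mult_def S_def sum_distrib_left mult.assoc)
  also have "\<dots> = (\<Sum>b\<in>UNIV. \<Sum>k\<in>UNIV. S b k * (X $ (b, k) / scal b))"
    by (simp add: sum.cartesian_product UNIV_Times_UNIV[symmetric] case_prod_beta' del: UNIV_Times_UNIV)
  also have "\<dots> = (\<Sum>k\<in>UNIV. S None k * p $ k) + (\<Sum>i\<in>UNIV. \<Sum>k\<in>UNIV. S (Some i) k * (- e i $ k))"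
    using z by (simp add: UNIV_option_conv sum.reindex X_def block_vec_def scal_def)
  also have "(\<Sum>k\<in>UNIV. S None k * p $ k) = p \<bullet> mean a l"
    by (simp add: S0 inner_vec_def mult.commute)
  also have "(\<Sum>i\<in>UNIV. \<Sum>k\<in>UNIV. S (Some i) k * (- e i $ k)) = (\<Sum>i\<in>UNIV. - (real_of_int (z i) * pair i (\<lambda>_. e i) (v a l) + (real_of_int (z i))\<^sup>2 / Pe i * pair i (\<lambda>_. e i) (\<Theta> a l i)
        + (real_of_int (z i))\<^sup>2 / Pe i * pair i (\<lambda>_. e i) (\<lambda>_. unit (a, l) i)))"
  proof (rule sum.cong[OF refl])
    fix i
    have "(\<Sum>k\<in>UNIV. S (Some i) k * (- e i $ k)) = (\<Sum>k\<in>UNIV. - (real_of_int (z i) * (e i $ k * pair i (\<lambda>_. axis k 1) (v a l))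
        + (real_of_int (z i))\<^sup>2 / Pe i * (e i $ k * pair i (\<lambda>_. axis k 1) (\<Theta> a l i))
        + (real_of_int (z i))\<^sup>2 / Pe i * (e i $ k * pair i (\<lambda>_. axis k 1) (\<lambda>_. unit (a, l) i))))"
      by (intro sum.cong refl) (simp add: S1 algebra_simps)
    then show "(\<Sum>k\<in>UNIV. S (Some i) k * (- e i $ k)) = - (real_of_int (z i) * pair i (\<lambda>_. e i) (v a l) + (real_of_int (z i))\<^sup>2 / Pe i * pair i (\<lambda>_. e i) (\<Theta> a l i)
        + (real_of_int (z i))\<^sup>2 / Pe i * pair i (\<lambda>_. e i) (\<lambda>_. unit (a, l) i))"
      by (simp only: sum_negf sum.distrib sum_distrib_left pair_axis_expand[OF v_L2, of i "e i"]
          pair_axis_expand[OF \<Theta>_L2, of i "e i"] pair_axis_expand[OF L2_R_const, of i "e i"])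
  qed
  finally show ?thesis unfolding X_def by (simp only: sum_negf add_uminus_conv_diff)
qed

text \<open>Adding \<open>B_row\<close> to \<open>flux_scaled\<close> cancels the pairings of the
  macroscopic field with \<open>unit\<close> and leaves \<open>resid\<close> plus the pressure
  gradient along \<open>mean a l\<close>, which is zero.\<close>

theorem flux_law:
  assumes grad\<mu>: "AE x in N. \<forall>j. g\<mu> j x = - real_of_int (z j) *\<^sub>R field j x"
  shows "AE x in N. block_vec (mean_velocity M u x) (\<lambda>j. ionic_flux M G z Pe n E u \<Phi>0 \<Phi>1 j x)
    = - (B_mat M z Pe n v \<Theta> *v block_vec (wgrad G P x) (\<lambda>j. g\<mu> j x)) - B_mat M z Pe n v \<Theta> *v block_vec (f x) (\<lambda>j. 0)"
proof -
  have "AE x in N. \<forall>a\<in>UNIV. \<forall>l\<in>UNIV. resid a l x + wgrad G P x \<bullet> mean a l = 0"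
    by (intro AE_finite_allI pressure_gradient) auto
  with AE_W_X grad\<mu> show ?thesis
  proof eventually_elim
    case (elim x)
    define B where "B = B_mat M z Pe n v \<Theta>"
    define J where "J = block_vec (mean_velocity M u x) (\<lambda>j. ionic_flux M G z Pe n E u \<Phi>0 \<Phi>1 j x)"
    \<comment> \<open>The body force and the pressure gradient act only through their sum, so
      \<open>B_row\<close> is applied once.\<close>
    have split: "block_vec (wgrad G P x) (\<lambda>j. g\<mu> j x) + block_vec (f x) (\<lambda>j. 0) = block_vec (wgrad G P x + f x) (\<lambda>j. - real_of_int (z j) *\<^sub>R field j x)"
      using elim by (auto simp: vec_eq_iff block_vec_def split: option.split)
    have "J $ (a, l) = (- (B *v block_vec (wgrad G P x + f x) (\<lambda>j. - real_of_int (z j) *\<^sub>R field j x))) $ (a, l)" for a l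
    proof -
      have "scal a * J $ (a, l) = load a l x + (\<Sum>j\<in>UNIV. (real_of_int (z j))\<^sup>2 / Pe j * pair j (\<lambda>_. field j x) (\<lambda>_. unit (a, l) j))"
        unfolding J_def by (rule flux_scaled) (use elim in auto)
      moreover have "resid a l x + wgrad G P x \<bullet> mean a l = 0" using elim by auto
      ultimately have "scal a * J $ (a, l) = scal a * (- (B *v block_vec (wgrad G P x + f x) (\<lambda>j. - real_of_int (z j) *\<^sub>R field j x))) $ (a, l)"
        using B_row[of a "wgrad G P x + f x" "\<lambda>j. field j x" l]
        by (simp add: B_def resid_def inner_add_left sum.distrib)
      then show ?thesis using mult_left_cancel[OF scal_nonzero[of a]] by blast
    qed
    then have "J = - (B *v block_vec (wgrad G P x + f x) (\<lambda>j. - real_of_int (z j) *\<^sub>R field j x))"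
      by (simp add: vec_eq_iff split_paired_all)
    also have "\<dots> = - (B *v block_vec (wgrad G P x) (\<lambda>j. g\<mu> j x)) - B *v block_vec (f x) (\<lambda>j. 0)"
      unfolding split[symmetric] by (simp add: matrix_vector_right_distrib)
    finally show ?case unfolding J_def B_def .
  qed
qed

end

theorem proposition23:
  fixes M :: "'w measure"
    and T :: "real^'n \<Rightarrow> 'w \<Rightarrow> 'w"
    and F :: "'w set"
    and G :: "(real^'n) set"
    and z :: "'s::{finite,linorder} \<Rightarrow> int"
    and nc Pe :: "'s \<Rightarrow> real"
    and \<beta> N\<^sub>\<sigma> :: real
    and \<sigma> \<Psi>0 :: "'w \<Rightarrow> real"
    and \<Psi>ext :: "real^'n \<Rightarrow> real"
    and E fstar :: "real^'n \<Rightarrow> real^'n"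
    and n :: "'s \<Rightarrow> 'w \<Rightarrow> real"
    and u0 :: "real^'n \<Rightarrow> 'w \<Rightarrow> real^'n"
    and P0 :: "real^'n \<Rightarrow> real"
    and \<Phi>0 :: "'s \<Rightarrow> real^'n \<Rightarrow> real"
    and \<Phi>1 :: "'s \<Rightarrow> real^'n \<Rightarrow> 'w \<Rightarrow> real^'n"
    and v :: "'s option \<Rightarrow> 'n \<Rightarrow> 'w \<Rightarrow> real^'n"
    and \<Theta> :: "'s option \<Rightarrow> 'n \<Rightarrow> 's \<Rightarrow> 'w \<Rightarrow> real^'n"
    and u :: "real^'n \<Rightarrow> real^'n"
    and \<mu> :: "'s \<Rightarrow> real^'n \<Rightarrow> real"
    and J :: "'s \<Rightarrow> real^'n \<Rightarrow> real^'n"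
    and B :: "real^('s option \<times> 'n)^('s option \<times> 'n)"
  assumes "prob_space M" and "separable_L2 M" and "ergodic_system M T"
    and "random_inclusions M T F"
    and "smooth_bounded_domain G"
    and "0 < \<beta>" and "0 < N\<^sub>\<sigma>" and "\<forall>j. 0 < Pe j"
    and "strict_mono z" and "z (Min UNIV) < 0" and "0 < z (Max UNIV)" and "\<forall>j. z j \<noteq> 0"
    and "\<forall>j. 0 < nc j \<and> nc j < 1" and "(\<Sum>j\<in>UNIV. of_int (z j) * nc j) = 0"
    and "surface_charge M T F \<sigma>"
    and "equilibrium_potential M T F \<beta> z nc N\<^sub>\<sigma> \<sigma> \<Psi>0"
    and n_def: "n = n0 F z nc \<Psi>0"
    and "\<Psi>ext \<in> H1 G" and E_def: "E = wgrad G \<Psi>ext"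
    and "fstar \<in> L2 (lebesgue_on G)"
    and "two_scale_solution M T F G z Pe n E fstar u0 P0 \<Phi>0 \<Phi>1"
    and "\<forall>a k. cell_solution M T F z Pe n a k (v a k) (\<Theta> a k)"
    and u_def: "u = mean_velocity M u0"
    and \<mu>_def: "\<mu> = ionic_potential z \<Phi>0 \<Psi>ext"
    and J_def: "J = ionic_flux M G z Pe n E u0 \<Phi>0 \<Phi>1"
    and B_def: "B = B_mat M z Pe n v \<Theta>"
  shows "transpose B = B \<and> (\<forall>\<eta>. \<eta> \<noteq> 0 \<longrightarrow> 0 < \<eta> \<bullet> (B *v \<eta>)) \<and>
    has_weak_div G u (\<lambda>x. 0) \<and> (\<forall>j. has_weak_div G (J j) (\<lambda>x. 0)) \<and>
    P0 \<in> H1 G \<and>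
    (AE x in lebesgue_on G.
       block_vec (u x) (\<lambda>j. J j x)
       = - (B *v block_vec (wgrad G P0 x) (\<lambda>j. wgrad G (\<mu> j) x))
         - B *v block_vec (fstar x) (\<lambda>j. 0)) \<and>
    zero_normal_trace G u (\<lambda>x. 0) \<and> (\<forall>j. \<Phi>0 j \<in> H1_0 G)"
proof -
  have F: "F \<in> sets M" using \<open>random_inclusions M T F\<close> unfolding random_inclusions_def by blast
  interpret prob_space M by fact
  have G: "open G" "bounded G" using \<open>smooth_bounded_domain G\<close> unfolding smooth_bounded_domain_def by auto
  have \<Psi>ext: "has_weak_grad G \<Psi>ext E" "E \<in> L2 (lebesgue_on G)"
    using H1_wgrad[OF G(1) \<open>\<Psi>ext \<in> H1 G\<close>] unfolding E_def by auto
  obtain C where \<Psi>0: "\<Psi>0 \<in> borel_measurable M" and C: "AE \<omega> in M. \<bar>\<Psi>0 \<omega>\<bar> \<le> C"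
    using \<open>equilibrium_potential M T F \<beta> z nc N\<^sub>\<sigma> \<sigma> \<Psi>0\<close>
    unfolding equilibrium_potential_def stoch_D_def L2_def by blast
  have n_measurable: "n j \<in> borel_measurable M" for j
  proof -
    have "(\<lambda>\<omega>. if \<omega> \<in> F then nc j * exp (- of_int (z j) * \<Psi>0 \<omega>) else 0) \<in> borel_measurable M"
      using F \<Psi>0 by (intro measurable_If_set) auto
    then show ?thesis by (simp add: n_def n0_def[abs_def])
  qed
  have n_bounded: "\<exists>B. AE \<omega> in M. \<bar>n j \<omega>\<bar> \<le> B" for j
  proof (intro exI[of _ "exp (\<bar>of_int (z j)\<bar> * C)"])
    show "AE \<omega> in M. \<bar>n j \<omega>\<bar> \<le> exp (\<bar>of_int (z j)\<bar> * C)"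
      using C
    proof eventually_elim
      case (elim \<omega>)
      have nc: "0 < nc j" "nc j < 1" using \<open>\<forall>j. 0 < nc j \<and> nc j < 1\<close> by auto
      have "- of_int (z j) * \<Psi>0 \<omega> \<le> \<bar>of_int (z j) * \<Psi>0 \<omega>\<bar>" by simp
      also have "\<dots> \<le> \<bar>of_int (z j)\<bar> * C" unfolding abs_mult using elim by (intro mult_left_mono) auto
      finally have "nc j * exp (- of_int (z j) * \<Psi>0 \<omega>) \<le> 1 * exp (\<bar>of_int (z j)\<bar> * C)"
        using nc by (intro mult_mono) auto
      then show ?case using nc by (simp add: n_def n0_def abs_mult)
    qed
  qed
  interpret two_scale M T F z Pe n v \<Theta> G E fstar u0 P0 \<Phi>0 \<Phi>1
  proof
    show "\<And>j \<omega>. \<omega> \<in> F \<Longrightarrow> 0 < n j \<omega>" "\<And>j \<omega>. \<omega> \<notin> F \<Longrightarrow> n j \<omega> = 0"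
      using \<open>\<forall>j. 0 < nc j \<and> nc j < 1\<close> by (auto simp: n_def n0_def)
  qed (use assms F G \<Psi>ext n_measurable n_bounded in auto)
  \<comment> \<open>Linearity of weak gradients yields one explicit gradient of
    \<open>\<mu> j\<close>; the chosen \<open>wgrad\<close> agrees with it almost everywhere,
    simultaneously for the finitely many species.\<close>
  have "AE x in lebesgue_on G. \<forall>j\<in>UNIV. wgrad G (\<mu> j) x = - real_of_int (z j) *\<^sub>R field j x"
  proof (rule AE_finite_allI)
    fix j
    have "has_weak_grad G (\<mu> j) (\<lambda>x. - real_of_int (z j) *\<^sub>R field j x)"
      using has_weak_grad_scale[OF has_weak_grad_add[OF G(1) H1_wgrad(1)[OF G(1) \<Phi>0_H1] \<Psi>ext(1)], of "- real_of_int (z j)" j]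
      by (simp add: \<mu>_def ionic_potential_def[abs_def] field_def)
    then show "AE x in lebesgue_on G. wgrad G (\<mu> j) x = - real_of_int (z j) *\<^sub>R field j x"
      by (rule wgrad_unique(2)[OF G(1)])
  qed auto
  then have grad\<mu>: "AE x in lebesgue_on G. \<forall>j. wgrad G (\<mu> j) x = - real_of_int (z j) *\<^sub>R field j x"
    by simp
  have u: "has_weak_div G u (\<lambda>x. 0)" "zero_normal_trace G u (\<lambda>x. 0)"
    using u_V unfolding V_space_def u_def mean_velocity_def[abs_def] by auto
  show ?thesis
    using B_symmetric B_positive u ionic_flux_div P_H1 flux_law[OF grad\<mu>] \<Phi>0_H10
    unfolding B_def J_def u_def by blast
qed

end
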